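(* Every LDE with a non-degenerate resonant irregular singularity at the origin of Poincaré rank $\nu=1$ is analytically equivalent to an LDE of the form $\delta_1^2y-p^{(1)}x\,\delta_1y-\big(\tfrac14x+q^{(2)}x^2\big)y=0$ with $p^{(1)},q^{(2)}\in\mathbb C$, for which $\Delta(x)=x+\Delta^{(2)}x^2$ with $\Delta^{(2)}=(p^{(1)})^2+4q^{(2)}-2p^{(1)}$. Two such equations (with parameters $p^{(1)},q^{(2)}$ and $\tilde p^{(1)},\tilde q^{(2)}$) are analytically equivalent if and only if $p^{(1)}=\tilde p^{(1)}$ and $\cos\pi\sqrt{1+\Delta^{(2)}}=\cos\pi\sqrt{1+\tilde\Delta^{(2)}}$.
   Context: $\delta_1=x^2\frac{d}{dx}$. An LDE of Poincaré rank $1$ is written $\delta_1^2y-p(x)\delta_1y-q(x)y=0$ with $p,q$ holomorphic at $0$ (from $y''+a_1y'+a_0y=0$ via $p=-x^2a_1+2x$, $q=-x^4a_0$, with $1$ the minimal integer making both holomorphic), and $\Delta=p^2+4q-2\delta_1p$. The singularity is non-degenerate resonant irregular if $\Delta(0)=0$ and $p(0)=0$. Analytic equivalence: existence of $\tilde x=\phi(x)$, $\tilde y=t(x)y$ with $\phi$ a biholomorphic germ fixing $0$ and $t$ a nonvanishing holomorphic germ, transforming one equation into the other. The value $\cos\pi\sqrt{z}$ does not depend on the choice of square root. *)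

theory Defs
  imports "HOL-Analysis.Analysis"
begin

text \<open>An LDE of Poincare rank 1 is represented by the pair of germs (p, q) at 0 of
  the equation  delta1^2 y - p(x) delta1 y - q(x) y = 0,  delta1 = x^2 d/dx.\<close>

definition delta1 :: "(complex \<Rightarrow> complex) \<Rightarrow> complex \<Rightarrow> complex" where
  "delta1 y = (\<lambda>x. x\<^sup>2 * deriv y x)"

definition holo_ext_at0 :: "(complex \<Rightarrow> complex) \<Rightarrow> bool" where
  "holo_ext_at0 f \<longleftrightarrow> (\<exists>g r. r > 0 \<and> g holomorphic_on ball 0 r \<and>
       (\<forall>x\<in>ball 0 r - {0}. f x = g x))"

text \<open>Poincare rank exactly 1: p, q holomorphic at 0 and rank 0 does not work, i.e.
  the rank-0 coefficients p/x - 1 and q/x^2 (from y''+a1 y'+a0 y=0 via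
  p0 = -x a1 + 1, q0 = -x^2 a0) are not both holomorphic at 0.\<close>
definition rank1_LDE :: "(complex \<Rightarrow> complex) \<Rightarrow> (complex \<Rightarrow> complex) \<Rightarrow> bool" where
  "rank1_LDE p q \<longleftrightarrow> p analytic_on {0} \<and> q analytic_on {0} \<and>
     \<not> (holo_ext_at0 (\<lambda>x. p x / x - 1) \<and> holo_ext_at0 (\<lambda>x. q x / x\<^sup>2))"

definition Delta :: "(complex \<Rightarrow> complex) \<Rightarrow> (complex \<Rightarrow> complex) \<Rightarrow> complex \<Rightarrow> complex" where
  "Delta p q x = (p x)\<^sup>2 + 4 * q x - 2 * delta1 p x"

definition nondeg_resonant_irregular :: "(complex \<Rightarrow> complex) \<Rightarrow> (complex \<Rightarrow> complex) \<Rightarrow> bool" where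
  "nondeg_resonant_irregular p q \<longleftrightarrow> Delta p q 0 = 0 \<and> p 0 = 0"

definition solves :: "(complex \<Rightarrow> complex) \<Rightarrow> (complex \<Rightarrow> complex) \<Rightarrow> complex set
    \<Rightarrow> (complex \<Rightarrow> complex) \<Rightarrow> bool" where
  "solves p q U y \<longleftrightarrow> y holomorphic_on U \<and>
     (\<forall>x\<in>U. delta1 (delta1 y) x - p x * delta1 y x - q x * y x = 0)"

definition analytically_equivalent ::
  "(complex \<Rightarrow> complex) \<Rightarrow> (complex \<Rightarrow> complex) \<Rightarrow> (complex \<Rightarrow> complex) \<Rightarrow> (complex \<Rightarrow> complex) \<Rightarrow> bool" where
  "analytically_equivalent p q p' q' \<longleftrightarrow>
    (\<exists>\<phi> t r. r > 0 \<and> \<phi> holomorphic_on ball 0 r \<and> inj_on \<phi> (ball 0 r) \<and> \<phi> 0 = 0 \<and>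
       t holomorphic_on ball 0 r \<and> (\<forall>x\<in>ball 0 r. t x \<noteq> 0) \<and>
       (\<forall>U y. open U \<longrightarrow> U \<subseteq> ball 0 r \<longrightarrow>
          (solves p q U y \<longleftrightarrow>
           solves p' q' (\<phi> ` U) (\<lambda>z. t (inv_into (ball 0 r) \<phi> z) * y (inv_into (ball 0 r) \<phi> z)))))"

definition nf_p :: "complex \<Rightarrow> complex \<Rightarrow> complex" where
  "nf_p p1 = (\<lambda>x. p1 * x)"

definition nf_q :: "complex \<Rightarrow> complex \<Rightarrow> complex" where
  "nf_q q2 = (\<lambda>x. x / 4 + q2 * x\<^sup>2)"

definition Delta2 :: "complex \<Rightarrow> complex \<Rightarrow> complex" where
  "Delta2 p1 q2 = p1\<^sup>2 + 4 * q2 - 2 * p1"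

end

theory Submission imports Defs "HOL-Complex_Analysis.Complex_Analysis"
begin

text \<open>Write \<open>\<theta> = x d/dx = d/dw\<close> with \<open>x = exp w\<close>. Removing the first-order term turns the equation into
  \<open>\<theta>\<^sup>2 v = Q v\<close> with \<open>Q = A/x + \<dots>\<close>, where rank one forces \<open>A \<noteq> 0\<close>.

  Normal form. Let \<open>exp (2 \<pi> \<i> a)\<close> be an eigenvalue of the monodromy. Dividing a fundamental matrix by its Floquet factor leaves a matrix \<open>G\<close>, holomorphic on a
  punctured disc, with determinant one. A Birkhoff factorisation of \<open>G\<close> is sought as a basis of holomorphic sections of the
  vector bundle on the sphere glued by \<open>G\<close>. A pair of independent sections with poles comes from approximating \<open>G\<close> by Laurent polynomials;
  minimising the total pole order gives a holomorphic basis, since a holomorphic section vanishing at infinity would span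
  a line invariant under the equation, and \<open>A \<noteq> 0\<close> excludes such lines. The resulting gauge transformation is
  holomorphic at 0 and takes the equation to \<open>\<theta>\<^sup>2 y = (A/x + a\<^sup>2) y\<close>. It is converted into a point transformation
  by displacing the point at which the normal form is evaluated, so that the derivative term of the gauge disappears.
  Any \<open>a\<close> with the given multiplier and
  \<open>Re a \<le> 0\<close> may be used, and either eigenvalue, which is why only the trace of the monodromy matters.

  Invariants. Comparing the logarithmic derivatives of the Wronskians of both equations at 0 yields \<open>p\<^sup>(\<^sup>1\<^sup>)\<close>. Normal forms extend over the punctured plane, and Frobenius solutions at infinity
  are monodromy eigenvectors, with multiplier \<open>exp (- 2 \<pi> \<i> \<rho>)\<close> for \<open>\<rho> = sqrt (1 + \<Delta>\<^sup>(\<^sup>2\<^sup>)) / 2\<close> after the twist. The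
  Wronskian of two transported eigenvectors, if non-zero, shows that their multipliers are inverse; if it vanishes, they are equal.\<close>

subsection \<open>Linear equations on half-planes\<close>

text \<open>A matrix that normalises the monodromy is in general essentially singular at 0, and a
  gauge transformation mixes y with its derivative, whereas an analytic equivalence allows neither.
  The singularity is removed by Birkhoff factorisation: since det G = 1 the glued bundle has degree
  0, and it is trivial as soon as no nonzero section vanishes at infinity. The derivative is removed
  by the displacement. The gauge reads y = al v + be \<theta> v, and a constant change of basis
  achieves be = x B. Displacing 1/x by \<eta> moves w = ln x by - Ln (1 + x \<eta>), roughly - x
  \<eta>, so \<eta> has the size of B and stays bounded as x tends to 0. In the equation with
  respect to \<eta> the pole A/x is multiplied by x^2, so the problem for \<eta> is regular at x = 0
  and has a holomorphic solution. Once y \<circ> \<phi> = k v holds for every solution v, comparing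
  coefficients gives exactly the identities for k and e that an equivalence of operators requires.
  The coefficient 1/4 of the normal form comes from rescaling x by 4 A.\<close>

definition solution_on :: "complex set \<Rightarrow> (complex \<Rightarrow> complex) \<Rightarrow> (complex \<Rightarrow> complex) \<Rightarrow> (complex \<Rightarrow> complex) \<Rightarrow> bool" where
  "solution_on S q v d \<longleftrightarrow> (\<forall>w\<in>S. (v has_field_derivative d w) (at w) \<and> (d has_field_derivative q w * v w) (at w))"

lemma solution_onD:
  assumes "solution_on S q v d" "w \<in> S"
  shows "(v has_field_derivative d w) (at w)" "(d has_field_derivative q w * v w) (at w)"
  using assms by (auto simp: solution_on_def)

lemma solution_on_subset: "solution_on S q v d \<Longrightarrow> T \<subseteq> S \<Longrightarrow> solution_on T q v d"
  by (auto simp: solution_on_def)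

lemma solution_on_linear:
  assumes "solution_on S q v d" "solution_on S q v' d'"
  shows "solution_on S q (\<lambda>w. a * v w + b * v' w) (\<lambda>w. a * d w + b * d' w)"
  unfolding solution_on_def
proof (intro ballI conjI)
  fix w assume w: "w \<in> S"
  note D = solution_onD[OF assms(1) w] solution_onD[OF assms(2) w]
  show "((\<lambda>w. a * v w + b * v' w) has_field_derivative a * d w + b * d' w) (at w)"
    by (intro DERIV_add DERIV_cmult D)
  have "((\<lambda>w. a * d w + b * d' w) has_field_derivative a * (q w * v w) + b * (q w * v' w)) (at w)"
    by (intro DERIV_add DERIV_cmult D)
  then show "((\<lambda>w. a * d w + b * d' w) has_field_derivative q w * (a * v w + b * v' w)) (at w)"
    by (simp add: algebra_simps)
qed

lemma solution_on_shift:
  assumes "solution_on S q v d" "\<And>w. w \<in> S \<Longrightarrow> w + c \<in> S" "\<And>w. w \<in> S \<Longrightarrow> q (w + c) = q w"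
  shows "solution_on S q (\<lambda>w. v (w + c)) (\<lambda>w. d (w + c))"
  unfolding solution_on_def
proof (intro ballI conjI)
  fix w assume w: "w \<in> S"
  note D = solution_onD[OF assms(1) assms(2)[OF w]]
  show "((\<lambda>w. v (w + c)) has_field_derivative d (w + c)) (at w)"
    using D(1) by (simp add: DERIV_shift)
  show "((\<lambda>w. d (w + c)) has_field_derivative q w * v (w + c)) (at w)"
    using D(2) assms(3)[OF w] by (simp add: DERIV_shift)
qed

lemma wronskian_constant:
  assumes "solution_on S q v d" "solution_on S q v' d'" "convex S" "w \<in> S" "z \<in> S"
  shows "v w * d' w - v' w * d w = v z * d' z - v' z * d z"
proof -
  have "((\<lambda>w. v w * d' w - v' w * d w) has_field_derivative 0) (at x)" if "x \<in> S" for x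
    by (rule derivative_eq_intros solution_onD[OF assms(1) that] solution_onD[OF assms(2) that] refl)+ (simp add: algebra_simps)
  then have "\<exists>C. \<forall>x\<in>S. v x * d' x - v' x * d x = C"
    by (intro has_field_derivative_zero_constant[OF assms(3)]) (blast intro: has_field_derivative_at_within)
  then show ?thesis using assms(4,5) by metis
qed

text \<open>Cramer's rule: a Wronskian that is 1 at \<open>w0\<close> is 1 everywhere on a convex
  set, so the coefficients of \<open>c\<close> and \<open>s\<close> can be read off at any
  \<open>w\<close> without division. This moves initial conditions from the base point to other
  points.\<close>

lemma solution_initial_values:
  assumes c: "solution_on S q c c'" and s: "solution_on S q s s'"
    and S: "convex S" and w0: "w0 \<in> S" and W: "c w0 * s' w0 - s w0 * c' w0 = 1"
    and w: "w \<in> S"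
  shows "\<exists>v d. solution_on S q v d \<and> v w = a \<and> d w = b"
proof (intro exI conjI)
  have W: "c w * s' w - s w * c' w = 1" using wronskian_constant[OF c s S w w0] W by simp
  show "solution_on S q (\<lambda>z. (a * s' w - b * s w) * c z + (b * c w - a * c' w) * s z)
     (\<lambda>z. (a * s' w - b * s w) * c' z + (b * c w - a * c' w) * s' z)"
    by (rule solution_on_linear[OF c s])
  have "(a * s' w - b * s w) * c w + (b * c w - a * c' w) * s w = a * (c w * s' w - s w * c' w)"
    by algebra
  then show "(a * s' w - b * s w) * c w + (b * c w - a * c' w) * s w = a" using W by simp
  have "(a * s' w - b * s w) * c' w + (b * c w - a * c' w) * s' w = b * (c w * s' w - s w * c' w)"
    by algebra
  then show "(a * s' w - b * s w) * c' w + (b * c w - a * c' w) * s' w = b" using W by simp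
qed

text \<open>The difference \<open>u\<close> of the two solutions has Wronskian 0 with
  \<open>c\<close> and with \<open>s\<close>; Cramer's rule for this fundamental pair turns that
  into \<open>u = 0\<close>.\<close>

lemma solution_unique:
  assumes v: "solution_on S q v d" and v': "solution_on S q v' d'"
    and c: "solution_on S q c c'" and s: "solution_on S q s s'"
    and S: "convex S" and w0: "w0 \<in> S" and W: "c w0 * s' w0 - s w0 * c' w0 = 1"
    and eq: "v w0 = v' w0" "d w0 = d' w0" and w: "w \<in> S"
  shows "v w = v' w" "d w = d' w"
proof -
  define u where "u = (\<lambda>w. 1 * v w + (-1) * v' w)"
  define e where "e = (\<lambda>w. 1 * d w + (-1) * d' w)"
  have u: "solution_on S q u e" unfolding u_def e_def by (rule solution_on_linear[OF v v'])
  have "u w0 = 0" "e w0 = 0" using eq by (auto simp: u_def e_def)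
  then have 1: "u w * c' w - c w * e w = 0" "u w * s' w - s w * e w = 0"
    using wronskian_constant[OF u c S w w0] wronskian_constant[OF u s S w w0] by auto
  have 2: "c w * s' w - s w * c' w = 1" using wronskian_constant[OF c s S w w0] W by simp
  have "u w = u w * (c w * s' w - s w * c' w)" "e w = e w * (c w * s' w - s w * c' w)" using 2 by auto
  moreover have "u w * (c w * s' w - s w * c' w) = c w * (u w * s' w - s w * e w) - s w * (u w * c' w - c w * e w)"
     "e w * (c w * s' w - s w * c' w) = c' w * (u w * s' w - s w * e w) - s' w * (u w * c' w - c w * e w)"
    by algebra+
  ultimately have "u w = 0" "e w = 0" using 1 by auto
  then show "v w = v' w" "d w = d' w" by (auto simp: u_def e_def)
qed

section \<open>Power series solutions on discs\<close>

fun ode_coeff :: "complex fps \<Rightarrow> complex \<Rightarrow> complex \<Rightarrow> nat \<Rightarrow> complex" where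
  "ode_coeff Q a b 0 = a"
| "ode_coeff Q a b (Suc 0) = b"
| "ode_coeff Q a b (Suc (Suc n)) = (\<Sum>j\<le>n. fps_nth Q (n - j) * ode_coeff Q a b j) / (of_nat (Suc (Suc n)) * of_nat (Suc n))"

lemma ode_coeff_ode:
  "fps_deriv (fps_deriv (Abs_fps (ode_coeff Q a b))) = Q * Abs_fps (ode_coeff Q a b)"
proof (rule fps_ext)
  fix n
  have "fps_nth (Q * Abs_fps (ode_coeff Q a b)) n = (\<Sum>j\<le>n. fps_nth Q (n - j) * ode_coeff Q a b j)"
    unfolding fps_mult_nth
    by (rule sum.reindex_bij_witness[where i="\<lambda>j. n - j" and j="\<lambda>j. n - j"]) auto
  then show "fps_nth (fps_deriv (fps_deriv (Abs_fps (ode_coeff Q a b)))) n = fps_nth (Q * Abs_fps (ode_coeff Q a b)) n"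
    by (simp add: field_simps del: of_nat_Suc)
qed

text \<open>After multiplication by \<open>r^n\<close>, the coefficient of index m + 2 is at most
  \<open>M * r^2 / (m + 2)\<close> times the maximum of the earlier ones, because the m + 1 summands
  cancel the factor m + 1 of the denominator. From m = \<open>N\<close> on this quotient is at most
  1, so the maximum \<open>K\<close> of the first terms persists.\<close>

lemma ode_coeff_bound:
  assumes "r > 0" and M: "\<And>j. norm (fps_nth Q j) * r ^ j \<le> M"
  shows "\<exists>K. \<forall>n. norm (ode_coeff Q a b n) * r ^ n \<le> K"
proof -
  define c where "c = (\<lambda>n. norm (ode_coeff Q a b n) * r ^ n)"
  have M0: "M \<ge> 0" using order_trans[OF _ M[of 0], of 0] by simp
  obtain N :: nat where N: "M * r^2 \<le> of_nat N" using real_arch_simple by blast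
  define K where "K = Max (c ` {..Suc N})"
  have cK: "c n \<le> K" if "n \<le> Suc N" for n unfolding K_def using that by (intro Max_ge) auto
  have c0: "c n \<ge> 0" for n using assms by (simp add: c_def)
  then have K0: "K \<ge> 0" using cK[of 0] by (meson order_trans le0)
  have "c n \<le> K" for n
  proof (induction n rule: less_induct)
    case (less n)
    show ?case
    proof (cases "n \<le> Suc N")
      case False
      then obtain m where n: "n = Suc (Suc m)" "N \<le> m" by (metis Suc_le_D not_less_eq_eq le_SucI)
      have "c n = norm (\<Sum>j\<le>m. fps_nth Q (m - j) * ode_coeff Q a b j) * r ^ m * r^2 / (real (Suc (Suc m)) * real (Suc m))"
        unfolding c_def n by (simp add: norm_divide norm_mult power2_eq_square del: of_nat_Suc)
      also have "\<dots> \<le> (real (Suc m) * (M * K)) * r^2 / (real (Suc (Suc m)) * real (Suc m))"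
      proof (intro divide_right_mono mult_right_mono)
        have "norm (\<Sum>j\<le>m. fps_nth Q (m - j) * ode_coeff Q a b j) * r ^ m \<le> (\<Sum>j\<le>m. norm (fps_nth Q (m - j) * ode_coeff Q a b j)) * r^m"
          using assms(1) by (intro mult_right_mono norm_sum) auto
        also have "\<dots> = (\<Sum>j\<le>m. (norm (fps_nth Q (m - j)) * r^(m-j)) * c j)"
          unfolding sum_distrib_right c_def
        proof (rule sum.cong)
          fix j assume "j \<in> {..m}"
          then have "r^m = r^(m-j) * r^j" by (simp add: power_add[symmetric])
          then show "norm (fps_nth Q (m - j) * ode_coeff Q a b j) * r ^ m = norm (fps_nth Q (m - j)) * r ^ (m - j) * (norm (ode_coeff Q a b j) * r ^ j)"
            by (simp add: norm_mult)
        qed auto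
        also have "\<dots> \<le> (\<Sum>j\<le>m. M * K)"
        proof (rule sum_mono, rule mult_mono[OF M _ M0 c0])
          fix j assume "j \<in> {..m}" then show "c j \<le> K" using less.IH n by auto
        qed
        finally show "norm (\<Sum>j\<le>m. fps_nth Q (m - j) * ode_coeff Q a b j) * r ^ m \<le> real (Suc m) * (M * K)" by simp
      qed (use assms in auto)
      also have "\<dots> = (M * r^2) / real (Suc (Suc m)) * K" by (simp add: field_simps del: of_nat_Suc)
      also have "\<dots> \<le> 1 * K" using N n K0 by (intro mult_right_mono) (auto simp: field_simps)
      finally show ?thesis by simp
    qed (use cK in auto)
  qed
  then show ?thesis unfolding c_def by blast
qed

lemma fps_coeff_bound:
  fixes Q :: "complex fps"
  assumes r: "0 < r" "ereal r < fps_conv_radius Q"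
  shows "\<exists>M. \<forall>j. norm (fps_nth Q j) * r ^ j \<le> M"
proof -
  have "summable (\<lambda>n. fps_nth Q n * (of_real r) ^ n)" using r by (intro summable_fps) auto
  then have "(\<lambda>n. fps_nth Q n * (of_real r) ^ n) \<longlonglongrightarrow> 0" by (rule summable_LIMSEQ_zero)
  then have "Bseq (\<lambda>n. fps_nth Q n * (of_real r) ^ n)" by (simp add: convergentI convergent_imp_Bseq)
  then obtain M where "\<forall>n. norm (fps_nth Q n * (of_real r) ^ n) \<le> M" by (auto simp: Bseq_def)
  then show ?thesis using r by (auto simp: norm_mult norm_power)
qed

lemma fps_conv_radius_ge_bound:
  fixes F :: "complex fps"
  assumes r: "0 < r" and K: "\<And>n. norm (fps_nth F n) * r ^ n \<le> K"
  shows "fps_conv_radius F \<ge> ereal r"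
  unfolding fps_conv_radius_def
proof (rule conv_radius_geI_ex')
  fix s assume s: "0 < s" "ereal s < ereal r"
  show "summable (\<lambda>n. fps_nth F n * complex_of_real s ^ n)"
  proof (rule summable_comparison_test')
    show "summable (\<lambda>n. K * (s/r)^n)" using s r by (intro summable_mult summable_geometric) auto
    fix n
    have "norm (fps_nth F n * complex_of_real s ^ n) = norm (fps_nth F n) * r^n * (s/r)^n"
      using s r by (simp add: norm_mult norm_power power_divide)
    also have "\<dots> \<le> K * (s/r)^n" using s r K by (intro mult_right_mono) auto
    finally show "norm (fps_nth F n * complex_of_real s ^ n) \<le> K * (s/r)^n" .
  qed
qed

text \<open>The coefficient bound holds for every radius \<open>r < R\<close>, so the solution
  series converges on the whole disc and the formal identity may be evaluated there.\<close>

lemma linear_ode_exists_ball: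
  assumes q: "q holomorphic_on ball w0 R" and R: "0 < R"
  shows "\<exists>v d. solution_on (ball w0 R) q v d \<and> v w0 = a \<and> d w0 = b"
proof -
  define Q where "Q = fps_expansion q w0"
  have rQ: "fps_conv_radius Q \<ge> ereal R" unfolding Q_def
    by (rule conv_radius_fps_expansion) (use q in simp)
  define F where "F = Abs_fps (ode_coeff Q a b)"
  have rF: "fps_conv_radius F \<ge> ereal R"
  proof (rule ccontr)
    assume "\<not> ?thesis"
    then have "fps_conv_radius F < ereal R" by simp
    then obtain r where r: "fps_conv_radius F < ereal r" "ereal r < ereal R" using ereal_dense2 by blast
    have r0: "0 < r"
      using r(1) conv_radius_nonneg[of "fps_nth F"] unfolding fps_conv_radius_def
      by (metis ereal_less(2) le_less_trans)
    obtain M where M: "\<And>j. norm (fps_nth Q j) * r ^ j \<le> M"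
      using fps_coeff_bound[of r Q] r0 r rQ by (metis order_less_le_trans)
    obtain K where "\<And>n. norm (ode_coeff Q a b n) * r ^ n \<le> K"
      using ode_coeff_bound[OF r0 M] by blast
    then have "fps_conv_radius F \<ge> ereal r" by (intro fps_conv_radius_ge_bound[OF r0]) (auto simp: F_def)
    then show False using r by simp
  qed
  define v where "v = (\<lambda>w. eval_fps F (w - w0))"
  define d where "d = (\<lambda>w. eval_fps (fps_deriv F) (w - w0))"
  have ode: "fps_deriv (fps_deriv F) = Q * F" unfolding F_def by (rule ode_coeff_ode)
  have "solution_on (ball w0 R) q v d" unfolding solution_on_def
  proof (intro ballI conjI)
    fix w assume w: "w \<in> ball w0 R"
    then have n: "ereal (norm (w - w0)) < ereal R" by (simp add: dist_norm norm_minus_commute)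
    have nF: "ereal (norm (w - w0)) < fps_conv_radius F" using n rF by (rule less_le_trans)
    have nQ: "ereal (norm (w - w0)) < fps_conv_radius Q" using n rQ by (rule less_le_trans)
    have rF': "fps_conv_radius (fps_deriv F) \<ge> ereal R" using rF fps_conv_radius_deriv[of F] order_trans by blast
    have nF': "ereal (norm (w - w0)) < fps_conv_radius (fps_deriv F)" using n rF' by (rule less_le_trans)
    have "((\<lambda>w. eval_fps F (w - w0)) has_field_derivative eval_fps (fps_deriv F) (w - w0) * 1) (at w)"
      by (rule DERIV_chain2[where f="eval_fps F"], rule has_field_derivative_eval_fps)
         (use nF in \<open>auto intro!: derivative_eq_intros\<close>)
    then show "(v has_field_derivative d w) (at w)" by (simp add: v_def d_def)
    have "((\<lambda>w. eval_fps (fps_deriv F) (w - w0)) has_field_derivative eval_fps (fps_deriv (fps_deriv F)) (w - w0) * 1) (at w)"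
      by (rule DERIV_chain2[where f="eval_fps (fps_deriv F)"], rule has_field_derivative_eval_fps)
         (use nF' in \<open>auto intro!: derivative_eq_intros\<close>)
    moreover have "eval_fps (Q * F) (w - w0) = eval_fps Q (w - w0) * eval_fps F (w - w0)"
      by (rule eval_fps_mult) (use nF nQ in auto)
    moreover have "eval_fps Q (w - w0) = q w"
      unfolding Q_def using eval_fps_expansion[of q w0 "ereal R" w] q w by (simp add: dist_norm norm_minus_commute)
    ultimately show "(d has_field_derivative q w * v w) (at w)" by (simp add: v_def d_def ode)
  qed
  moreover have "v w0 = a" "d w0 = b" by (auto simp: v_def d_def eval_fps_at_0 F_def)
  ultimately show ?thesis by blast
qed

section \<open>From discs to a half-plane\<close>

lemma halfplane_eq_Union_balls: "{w. Re w < c} = (\<Union>n\<in>{1..}. ball (of_real (c - real n)) (real n))"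
proof (intro set_eqI iffI)
  fix w assume "w \<in> (\<Union>n\<in>{1..}. ball (complex_of_real (c - real n)) (real n))"
  then obtain n :: nat where n: "dist (complex_of_real (c - real n)) w < real n" by auto
  have "Re w - (c - real n) \<le> norm (w - complex_of_real (c - real n))"
    using complex_Re_le_cmod[of "w - complex_of_real (c - real n)"] by simp
  then show "w \<in> {w. Re w < c}" using n by (simp add: dist_norm norm_minus_commute)
next
  fix w assume "w \<in> {w. Re w < c}"
  then have d: "c - Re w > 0" (is "?d > 0") by simp
  obtain n :: nat where n: "n > max 1 ((?d^2 + (Im w)^2) / (2 * ?d))" using reals_Archimedean2 by blast
  then have n1: "n \<ge> 1" by simp
  have nn: "?d^2 + (Im w)^2 < 2 * ?d * real n" using n d by (simp add: field_simps)
  have "(norm (w - complex_of_real (c - real n)))^2 = (Re w - c + real n)^2 + (Im w)^2"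
    by (simp add: cmod_power2 algebra_simps)
  also have "\<dots> < (real n)^2" using nn by (simp add: power2_eq_square algebra_simps)
  finally have "norm (w - complex_of_real (c - real n)) < real n"
    using power_less_imp_less_base by fastforce
  then show "w \<in> (\<Union>n\<in>{1..}. ball (complex_of_real (c - real n)) (real n))"
    using n1 by (auto simp: dist_norm norm_minus_commute intro!: bexI[of _ n])
qed

lemma halfplane_balls_mono:
  assumes "m \<le> n" shows "ball (of_real (c - real m)) (real m) \<subseteq> ball (complex_of_real (c - real n)) (real n)"
proof -
  have "dist (complex_of_real (c - real m)) (complex_of_real (c - real n)) = real n - real m"
    unfolding dist_of_real using assms by (simp add: dist_real_def)
  then show ?thesis by (intro ball_subset_ball_iff[THEN iffD2]) (simp add: dist_commute)
qed

text \<open>The discs \<open>B n\<close> of radius n touching the line Re w = c increase to the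
  half-plane, and \<open>c - 1\<close> lies in all of them with n \<ge> 1. Initial values prescribed
  there make the disc solutions agree by uniqueness, so they fit together.\<close>

lemma linear_ode_exists_halfplane_base:
  assumes q: "q holomorphic_on {w. Re w < c}"
  shows "\<exists>v d. solution_on {w. Re w < c} q v d \<and> v (of_real (c - 1)) = a \<and> d (of_real (c - 1)) = b"
proof -
  define B where "B n = ball (complex_of_real (c - real n)) (real n)" for n
  define w0 where "w0 = complex_of_real (c - 1)"
  have w0: "w0 \<in> B n" if "n \<ge> 1" for n
    using that unfolding B_def w0_def mem_ball dist_of_real by (simp add: dist_real_def)
  have H: "{w. Re w < c} = (\<Union>n\<in>{1..}. B n)" unfolding B_def by (rule halfplane_eq_Union_balls)
  have mono: "B m \<subseteq> B n" if "m \<le> n" for m n unfolding B_def by (rule halfplane_balls_mono[OF that])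
  \<comment> \<open>The series prescribes values at the centre \<open>c - n\<close>; they are
    converted into values at the common point \<open>w0\<close>.\<close>
  have ex: "\<exists>v d. solution_on (B n) q v d \<and> v w0 = a \<and> d w0 = b" if n: "n \<ge> 1" for n a b
  proof -
    have qn: "q holomorphic_on B n" using q H n by (auto intro: holomorphic_on_subset)
    obtain c1 c1' where c1: "solution_on (B n) q c1 c1'" "c1 (of_real (c - real n)) = 1" "c1' (of_real (c - real n)) = 0"
      using linear_ode_exists_ball[of q "of_real (c - real n)" "real n" 1 0] qn n unfolding B_def by auto
    obtain s1 s1' where s1: "solution_on (B n) q s1 s1'" "s1 (of_real (c - real n)) = 0" "s1' (of_real (c - real n)) = 1"
      using linear_ode_exists_ball[of q "of_real (c - real n)" "real n" 0 1] qn n unfolding B_def by auto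
    show ?thesis
      using solution_initial_values[OF c1(1) s1(1) _ _ _ w0[OF n], of "of_real (c - real n)" a b] c1 s1 n
      by (auto simp: B_def)
  qed
  have "\<forall>n. \<exists>v d. n \<ge> 1 \<longrightarrow> solution_on (B n) q v d \<and> v w0 = a \<and> d w0 = b" using ex by blast
  then obtain v d where vd: "\<And>n. n \<ge> 1 \<Longrightarrow> solution_on (B n) q (v n) (d n) \<and> v n w0 = a \<and> d n w0 = b" by metis
  have agree: "v m w = v n w \<and> d m w = d n w" if mn: "1 \<le> m" "m \<le> n" "w \<in> B m" for m n w
  proof -
    obtain c1 c1' where c1: "solution_on (B m) q c1 c1'" "c1 w0 = 1" "c1' w0 = 0" using ex[OF mn(1), of 1 0] by blast
    obtain s1 s1' where s1: "solution_on (B m) q s1 s1'" "s1 w0 = 0" "s1' w0 = 1" using ex[OF mn(1), of 0 1] by blast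
    have vn: "solution_on (B m) q (v n) (d n)" using vd[of n] mn mono[OF mn(2)] solution_on_subset by (meson order_trans)
    have *: "convex (B m)" by (auto simp: B_def)
    show ?thesis
      using solution_unique[OF _ vn c1(1) s1(1) * w0[OF mn(1)] _ _ _ mn(3), of "v m" "d m"] vd[of m] vd[of n] mn c1 s1
      by auto
  qed
  define N where "N w = (SOME n. n \<ge> 1 \<and> w \<in> B n)" for w
  have N: "N w \<ge> 1 \<and> w \<in> B (N w)" if "w \<in> {w. Re w < c}" for w
    unfolding N_def by (rule someI_ex) (use that H in auto)
  have eq: "v (N w) w = v n w \<and> d (N w) w = d n w" if "n \<ge> 1" "w \<in> B n" for n w
  proof -
    have "w \<in> {w. Re w < c}" using H that by auto
    then show ?thesis using agree[of n "N w" w] agree[of "N w" n w] N[of w] that by (metis linear)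
  qed
  show ?thesis
  proof (intro exI conjI)
    show "solution_on {w. Re w < c} q (\<lambda>w. v (N w) w) (\<lambda>w. d (N w) w)" unfolding solution_on_def
    proof (intro ballI)
      fix w assume "w \<in> {w. Re w < c}"
      then obtain n where n: "n \<ge> 1" "w \<in> B n" using H by auto
      have o: "open (B n)" by (simp add: B_def)
      have D: "(v n has_field_derivative d n w) (at w)" "(d n has_field_derivative q w * v n w) (at w)"
        using vd[OF n(1)] n(2) solution_onD by blast+
      have "((\<lambda>w. v (N w) w) has_field_derivative d n w) (at w)"
        by (rule has_field_derivative_transform_within_open[OF D(1) o n(2)]) (use eq n in auto)
      moreover have "((\<lambda>w. d (N w) w) has_field_derivative q w * v n w) (at w)"
        by (rule has_field_derivative_transform_within_open[OF D(2) o n(2)]) (use eq n in auto)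
      ultimately show "((\<lambda>w. v (N w) w) has_field_derivative d (N w) w) (at w) \<and>
         ((\<lambda>w. d (N w) w) has_field_derivative q w * v (N w) w) (at w)" using eq[OF n] by simp
    qed
    show "v (N (complex_of_real (c - 1))) (complex_of_real (c - 1)) = a" "d (N (complex_of_real (c - 1))) (complex_of_real (c - 1)) = b"
      using eq[of 1 w0] w0[of 1] vd[of 1] by (auto simp: w0_def)
  qed
qed

lemma linear_ode_exists_halfplane:
  assumes q: "q holomorphic_on {w. Re w < c}" and w: "Re w < c"
  shows "\<exists>v d. solution_on {w. Re w < c} q v d \<and> v w = a \<and> d w = b"
proof -
  obtain c1 c1' where c1: "solution_on {w. Re w < c} q c1 c1'" "c1 (of_real (c - 1)) = 1" "c1' (of_real (c - 1)) = 0"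
    using linear_ode_exists_halfplane_base[OF q] by metis
  obtain s1 s1' where s1: "solution_on {w. Re w < c} q s1 s1'" "s1 (of_real (c - 1)) = 0" "s1' (of_real (c - 1)) = 1"
    using linear_ode_exists_halfplane_base[OF q] by metis
  show ?thesis
    by (rule solution_initial_values[OF c1(1) s1(1), of "of_real (c - 1)"])
       (use c1 s1 w in \<open>auto intro: convex_halfspace_Re_lt\<close>)
qed

subsection \<open>Floquet theory\<close>

lemma exp_in_punctured_ball: "0 < r \<Longrightarrow> exp w \<in> ball 0 r - {0} \<longleftrightarrow> Re w < ln r" for w :: complex
  by (simp add: norm_exp_eq_Re exp_less_cancel_iff[symmetric, of "Re w"])

lemma punctured_ball_cases:
  assumes "0 < r" "x \<in> ball 0 r - {0::complex}"
  obtains w where "x = exp w" "Re w < ln r"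
  using assms that[of "Ln x"] exp_in_punctured_ball[of r "Ln x"] by auto

text \<open>\<open>F\<close> is \<open>f \<circ> Ln\<close>; the jump of the principal branch is a
  period of \<open>f\<close> and hence invisible. For the derivative at \<open>exp w\<close> the
  branch \<open>w + Ln (x / exp w)\<close> is used, which is holomorphic near that point wherever
  the cut lies.\<close>

lemma periodic_descends:
  fixes f f' :: "complex \<Rightarrow> complex"
  assumes f: "\<And>w. Re w < c \<Longrightarrow> (f has_field_derivative f' w) (at w)"
    and per: "\<And>w. Re w < c \<Longrightarrow> f (w + 2 * of_real pi * \<i>) = f w"
  obtains F where "\<And>w. Re w < c \<Longrightarrow> F (exp w) = f w"
    "\<And>w. Re w < c \<Longrightarrow> (F has_field_derivative f' w / exp w) (at (exp w))"
proof -
  have pern: "f (w + of_nat n * (2 * of_real pi * \<i>)) = f w" if "Re w < c" for w n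
  proof (induction n)
    case (Suc n)
    have "f (w + of_nat (Suc n) * (2 * of_real pi * \<i>)) = f (w + of_nat n * (2 * of_real pi * \<i>) + 2 * of_real pi * \<i>)"
      by (simp add: algebra_simps)
    also have "\<dots> = f (w + of_nat n * (2 * of_real pi * \<i>))" by (rule per) (use that in simp)
    finally show ?case using Suc by simp
  qed simp
  have peri: "f (w + of_int n * (2 * of_real pi * \<i>)) = f w" if "Re w < c" for w n
  proof (cases "n \<ge> 0")
    case True
    then show ?thesis using pern[OF that, of "nat n"] by simp
  next
    case False
    then show ?thesis using pern[of "w + of_int n * (2 * of_real pi * \<i>)" "nat (-n)"] that by (simp add: algebra_simps)
  qed
  have eq: "f w = f z" if wz: "exp w = exp z" "Re z < c" for w z
  proof -
    obtain n :: int where "w = z + of_real (of_int (2 * n) * pi) * \<i>" using wz(1) unfolding exp_eq by blast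
    then have "w = z + of_int n * (2 * of_real pi * \<i>)" by simp
    then show ?thesis using peri[OF wz(2)] by simp
  qed
  define F where "F = (\<lambda>x. f (Ln x))"
  have F: "F (exp w) = f w" if "Re w < c" for w
    unfolding F_def by (rule eq) (use that in auto)
  moreover have "(F has_field_derivative f' w / exp w) (at (exp w))" if w: "Re w < c" for w
  proof -
    have oS: "open (ball (exp w) (norm (exp w)) \<inter> (exp ` {z. Re z < c}))"
    proof (intro open_Int open_ball)
      have "open ((exp :: complex \<Rightarrow> complex) ` {z. Re z < c})"
      proof (rule open_mapping_thm[of exp UNIV])
        have "exp (0::complex) \<noteq> exp (\<i> * of_real pi)" by simp
        then show "\<not> (exp :: complex \<Rightarrow> complex) constant_on UNIV" unfolding constant_on_def by (metis UNIV_I)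
      qed (auto intro: holomorphic_intros open_halfspace_Re_lt)
      then show "open ((exp :: complex \<Rightarrow> complex) ` {z. Re z < c})" .
    qed
    have d: "((\<lambda>x. f (w + Ln (x / exp w))) has_field_derivative f' w * (1 / exp w)) (at (exp w))"
    proof (rule DERIV_chain2[where f=f])
      show "(f has_field_derivative f' w) (at (w + Ln (exp w / exp w)))" using f[OF w] by simp
      show "((\<lambda>x. w + Ln (x / exp w)) has_field_derivative 1 / exp w) (at (exp w))"
        by (auto intro!: derivative_eq_intros)
    qed
    show ?thesis
    proof (rule has_field_derivative_transform_within_open[OF _ oS])
      show "((\<lambda>x. f (w + Ln (x / exp w))) has_field_derivative f' w / exp w) (at (exp w))" using d by simp
      show "exp w \<in> ball (exp w) (norm (exp w)) \<inter> exp ` {z. Re z < c}" using w by auto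
      fix x assume x: "x \<in> ball (exp w) (norm (exp w)) \<inter> exp ` {z. Re z < c}"
      then obtain z where z: "x = exp z" "Re z < c" by auto
      have "x \<noteq> 0" using z by simp
      then have "exp (w + Ln (x / exp w)) = exp z" by (simp add: exp_add z)
      then have "f (w + Ln (x / exp w)) = f z" by (rule eq) (use z in auto)
      then show "f (w + Ln (x / exp w)) = F x" using F[OF z(2)] z by simp
    qed
  qed
  ultimately show ?thesis using that by blast
qed

text \<open>Shifts preserve the Wronskian, so the monodromy has determinant one and is triangular
  with diagonal \<open>l\<close>, \<open>1/l\<close> in the basis \<open>v\<close>,
  \<open>v2\<close>. For \<open>l^2 \<noteq> 1\<close> it is diagonalised and \<open>k\<close>
  becomes 0; for \<open>l^2 = 1\<close> a Jordan block may remain.\<close>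

lemma floquet_complement:
  assumes v: "solution_on {w. Re w < c} q v d" and q: "q holomorphic_on {w. Re w < c}"
    and qper: "\<And>w. q (w + 2 * of_real pi * \<i>) = q w"
    and vper: "\<And>w. Re w < c \<Longrightarrow> v (w + 2 * of_real pi * \<i>) = l * v w"
    and nz: "Re w1 < c" "v w1 \<noteq> 0"
  obtains v2 d2 k where "solution_on {w. Re w < c} q v2 d2"
    "\<And>w. Re w < c \<Longrightarrow> v w * d2 w - v2 w * d w = 1"
    "\<And>w. Re w < c \<Longrightarrow> v2 (w + 2 * of_real pi * \<i>) = k * v w + v2 w / l"
    "k \<noteq> 0 \<Longrightarrow> l\<^sup>2 = 1" "l \<noteq> 0"
proof -
  let ?H = "{w. Re w < c}" let ?p = "2 * of_real pi * \<i>"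
  have H: "convex ?H" "open ?H" by (rule convex_halfspace_Re_lt open_halfspace_Re_lt)+
  obtain v2 d2 where v2: "solution_on ?H q v2 d2" "v2 w1 = 0" "d2 w1 = 1 / v w1"
    using linear_ode_exists_halfplane[OF q nz(1)] by metis
  have W: "v w * d2 w - v2 w * d w = 1" if "Re w < c" for w
    using wronskian_constant[OF v v2(1) H(1), of w w1] that nz v2 by simp
  have dper: "d (w + ?p) = l * d w" if "Re w < c" for w
  proof -
    have "((\<lambda>w. v (w + ?p)) has_field_derivative d (w + ?p)) (at w)"
      using solution_onD(1)[OF v, of "w + ?p"] that by (simp add: DERIV_shift)
    then have "((\<lambda>w. l * v w) has_field_derivative d (w + ?p)) (at w)"
      by (rule has_field_derivative_transform_within_open[OF _ H(2)]) (use vper that in auto)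
    moreover have "((\<lambda>w. l * v w) has_field_derivative l * d w) (at w)"
      by (intro DERIV_cmult solution_onD(1)[OF v]) (use that in auto)
    ultimately show ?thesis by (rule DERIV_unique)
  qed
  have l1: "l * (v w * d2 (w + ?p) - v2 (w + ?p) * d w) = 1" if "Re w < c" for w
    using W[of "w + ?p"] vper[OF that] dper[OF that] that by (simp add: algebra_simps)
  have l0: "l \<noteq> 0" using l1[OF nz(1)] by auto
  have v2s: "solution_on ?H q (\<lambda>w. v2 (w + ?p)) (\<lambda>w. d2 (w + ?p))"
    by (rule solution_on_shift[OF v2(1)]) (use qper in auto)
  \<comment> \<open>The coefficient of \<open>v\<close> in the shifted solution is, by Cramer's
    rule, its Wronskian with \<open>v2\<close>, and therefore constant.\<close>
  define k where "k = v2 (w1 + ?p) * d2 w1 - v2 w1 * d2 (w1 + ?p)"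
  have k: "v2 (w + ?p) * d2 w - v2 w * d2 (w + ?p) = k" if "Re w < c" for w
    unfolding k_def using wronskian_constant[OF v2s v2(1) H(1), of w w1] that nz by simp
  have v2per: "v2 (w + ?p) = k * v w + v2 w / l" if "Re w < c" for w
  proof -
    have "v w * d2 (w + ?p) - v2 (w + ?p) * d w = 1 / l" using l1[OF that] l0 by (simp add: field_simps)
    moreover have "v2 (w + ?p) * (v w * d2 w - v2 w * d w) =
       v w * (v2 (w + ?p) * d2 w - v2 w * d2 (w + ?p)) + v2 w * (v w * d2 (w + ?p) - v2 (w + ?p) * d w)" by algebra
    ultimately show ?thesis using W[OF that] k[OF that] by (simp add: mult.commute)
  qed
  show ?thesis
  proof (cases "l\<^sup>2 = 1")
    case True
    then show ?thesis using that[OF v2(1) W v2per _ l0] by blast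
  next
    case False
    \<comment> \<open>Adding \<open>m * v\<close> to \<open>v2\<close> changes the coefficient of
      \<open>v\<close> into \<open>k + m * l - m / l\<close>, which vanishes for this
      \<open>m\<close>.\<close>
    define m where "m = k / (1 / l - l)"
    have ne: "1 / l - l \<noteq> 0" using False l0 by (auto simp: field_simps power2_eq_square)
    show ?thesis
    proof (rule that[of "\<lambda>w. 1 * v2 w + m * v w" "\<lambda>w. 1 * d2 w + m * d w" 0])
      show "solution_on ?H q (\<lambda>w. 1 * v2 w + m * v w) (\<lambda>w. 1 * d2 w + m * d w)"
        by (rule solution_on_linear[OF v2(1) v])
      fix w assume w: "Re w < c"
      show "v w * (1 * d2 w + m * d w) - (1 * v2 w + m * v w) * d w = 1" using W[OF w] by (simp add: algebra_simps)
      have "k + m * l = m / l" using ne l0 by (simp add: m_def field_simps)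
      then have "k * v w + m * (l * v w) = m / l * v w" by (metis mult.assoc ring_class.ring_distribs(2))
      then show "1 * v2 (w + ?p) + m * v (w + ?p) = 0 * v w + (1 * v2 w + m * v w) / l"
        using v2per[OF w] vper[OF w] by (simp add: add_divide_distrib)
    qed (use l0 in auto)
  qed
qed

text \<open>The exponent is normalised by \<open>Re a \<le> 0\<close> so that the resonant off-diagonal term of the Floquet matrix is a
  non-negative power of \<open>1/x\<close>, hence holomorphic at infinity.\<close>
lemma floquet_normalisation:
  assumes r: "0 < r" and Q: "Q holomorphic_on ball 0 r - {0}" and a: "Re a \<le> 0"
    and v: "solution_on {w. Re w < ln r} (\<lambda>w. Q (exp w)) v d"
    and vper: "\<And>w. Re w < ln r \<Longrightarrow> v (w + 2 * of_real pi * \<i>) = exp (2 * of_real pi * \<i> * a) * v w"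
    and nz: "Re w1 < ln r" "v w1 \<noteq> 0"
  obtains G11 G12 G21 G22 k and j :: nat where
    "\<And>x. x \<in> ball 0 r - {0} \<Longrightarrow> G11 x * G22 x - G12 x * G21 x = 1"
    "\<And>x. x \<in> ball 0 r - {0} \<Longrightarrow> (G11 has_field_derivative (G21 x - a * G11 x) / x) (at x)"
    "\<And>x. x \<in> ball 0 r - {0} \<Longrightarrow> (G21 has_field_derivative (Q x * G11 x - a * G21 x) / x) (at x)"
    "\<And>x. x \<in> ball 0 r - {0} \<Longrightarrow> (G12 has_field_derivative (G22 x - k * (1/x)^j * G11 x + a * G12 x) / x) (at x)"
    "\<And>x. x \<in> ball 0 r - {0} \<Longrightarrow> (G22 has_field_derivative (Q x * G12 x - k * (1/x)^j * G21 x + a * G22 x) / x) (at x)"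
proof -
  let ?H = "{w. Re w < ln r}" let ?p = "2 * of_real pi * \<i>"
  define l where "l = exp (?p * a)"
  have qh: "(\<lambda>w. Q (exp w)) holomorphic_on ?H"
  proof -
    have "exp ` ?H \<subseteq> ball 0 r - {0}" by (rule image_subsetI) (simp only: exp_in_punctured_ball[OF r] mem_Collect_eq)
    then show ?thesis using holomorphic_on_compose_gen[OF holomorphic_on_exp Q, of ?H] by (simp add: o_def)
  qed
  have Qper: "Q (exp (w + ?p)) = Q (exp w)" for w by (simp add: exp_add)
  obtain v2 d2 k0 where v2: "solution_on ?H (\<lambda>w. Q (exp w)) v2 d2"
    and W: "\<And>w. Re w < ln r \<Longrightarrow> v w * d2 w - v2 w * d w = 1"
    and v2per: "\<And>w. Re w < ln r \<Longrightarrow> v2 (w + ?p) = k0 * v w + v2 w / l"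
    and k0: "k0 \<noteq> 0 \<Longrightarrow> l\<^sup>2 = 1" and l0: "l \<noteq> 0"
    by (rule floquet_complement[OF v qh Qper vper nz, folded l_def]) (assumption, rule that, assumption+)
  \<comment> \<open>With this \<open>k\<close> the logarithmic combination
    \<open>v2 - k * w * v\<close> has the pure multiplier \<open>1 / l\<close>: the increment
    \<open>k * ?p\<close> absorbs \<open>k0\<close>, where \<open>l^2 = 1\<close> is available
    whenever \<open>k0 \<noteq> 0\<close>.\<close>
  define k where "k = l * k0 / ?p"
  \<comment> \<open>\<open>l^2 = 1\<close> says that \<open>2 * a\<close> is an integer, and
    \<open>Re a \<le> 0\<close> gives its sign; for \<open>k = 0\<close> any \<open>j\<close>
    serves.\<close>
  have "\<exists>j::nat. k \<noteq> 0 \<longrightarrow> 2 * a = - of_nat j"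
  proof (cases "k = 0")
    case False
    then have "k0 \<noteq> 0" by (auto simp: k_def)
    then have "l\<^sup>2 = 1" by (rule k0)
    then have "exp (2 * (?p * a)) = exp 0"
      unfolding l_def exp_double by (simp only: exp_zero)
    then obtain n :: int where "2 * (?p * a) = 0 + of_real (of_int (2 * n) * pi) * \<i>"
      unfolding exp_eq by blast
    then have "2 * a = of_int n" by simp
    moreover from this have "n \<le> 0" proof -
      have "Re (2 * a) = of_int n" unfolding \<open>2 * a = of_int n\<close> by simp
      then show ?thesis using a by simp
    qed
    ultimately show ?thesis by (intro exI[of _ "nat (-n)"]) simp
  qed simp
  then obtain j :: nat where j: "k \<noteq> 0 \<Longrightarrow> 2 * a = - of_nat j" by blast
  \<comment> \<open>By \<open>2 * a = - j\<close> the exponential factor of the second column is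
    \<open>(1 / x)^j\<close> times that of the first; this turns the off-diagonal term of the
    equation for \<open>G\<close> into a power of \<open>1/x\<close>.\<close>
  have kj: "k * exp (a * w) = k * (1 / exp w)^j * exp (- a * w)" for w
  proof (cases "k = 0")
    case False
    have "exp (a * w) = exp (- (of_nat j * w)) * exp (- a * w)"
    proof -
      have "2 * a * w = - of_nat j * w" using j[OF False] by simp
      then have "a * w = - (of_nat j * w) + - a * w" by (simp add: algebra_simps)
      then have "exp (a * w) = exp (- (of_nat j * w) + - a * w)" by (rule arg_cong)
      then show ?thesis by (simp only: exp_add)
    qed
    moreover have "exp (- (of_nat j * w)) = (1 / exp w)^j"
      by (simp add: exp_minus exp_of_nat_mult inverse_eq_divide power_one_over)
    ultimately show ?thesis by simp
  qed simp
  note D = solution_onD[OF v] solution_onD[OF v2]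
  have e: "((\<lambda>w. exp (b * w)) has_field_derivative b * exp (b * w)) (at w)" for b w :: complex
    by (auto intro!: derivative_eq_intros)
  have exper: "exp (- a * (w + ?p)) = exp (- a * w) / l" "exp (a * (w + ?p)) = exp (a * w) * l" for w
  proof -
    have "- a * (w + ?p) = - a * w - ?p * a" "a * (w + ?p) = a * w + ?p * a" by (auto simp: algebra_simps)
    then show "exp (- a * (w + ?p)) = exp (- a * w) / l" "exp (a * (w + ?p)) = exp (a * w) * l"
      by (auto simp only: l_def exp_diff exp_add)
  qed
  have dper: "d (w + ?p) = l * d w" "d2 (w + ?p) = k0 * d w + d2 w / l" if "Re w < ln r" for w
  proof -
    have o: "open ?H" by (rule open_halfspace_Re_lt)
    have "((\<lambda>w. v (w + ?p)) has_field_derivative d (w + ?p)) (at w)"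
      using D(1)[of "w + ?p"] that by (simp add: DERIV_shift)
    then have "((\<lambda>w. l * v w) has_field_derivative d (w + ?p)) (at w)"
      by (rule has_field_derivative_transform_within_open[OF _ o]) (use vper that in \<open>auto simp: l_def\<close>)
    moreover have "((\<lambda>w. l * v w) has_field_derivative l * d w) (at w)"
      by (intro DERIV_cmult D(1)) (use that in auto)
    ultimately show "d (w + ?p) = l * d w" by (rule DERIV_unique)
    have "((\<lambda>w. v2 (w + ?p)) has_field_derivative d2 (w + ?p)) (at w)"
      using D(3)[of "w + ?p"] that by (simp add: DERIV_shift)
    then have "((\<lambda>w. k0 * v w + v2 w / l) has_field_derivative d2 (w + ?p)) (at w)"
      by (rule has_field_derivative_transform_within_open[OF _ o]) (use v2per that in auto)
    moreover have "((\<lambda>w. k0 * v w + v2 w / l) has_field_derivative k0 * d w + d2 w / l) (at w)"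
      by (intro DERIV_add DERIV_cmult DERIV_cdivide D) (use that in auto)
    ultimately show "d2 (w + ?p) = k0 * d w + d2 w / l" by (rule DERIV_unique)
  qed
  have k2: "k * l * l = k" using k0 by (cases "k0 = 0") (auto simp: k_def power2_eq_square)
  have kp: "l * k0 = k * ?p" by (simp add: k_def)
  \<comment> \<open>The columns of \<open>G\<close> are the Floquet solutions freed of their
    multipliers: \<open>exp (- a * w)\<close> times \<open>(v, d)\<close>, and
    \<open>exp (a * w)\<close> times \<open>(v2, d2) - k * w * (v, d)\<close>.\<close>
  obtain G11 where G11: "\<And>w. Re w < ln r \<Longrightarrow> G11 (exp w) = exp (-a*w) * v w"
    "\<And>w. Re w < ln r \<Longrightarrow> (G11 has_field_derivative (-a * exp (-a*w) * v w + d w * exp (-a*w)) / exp w) (at (exp w))"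
  proof (rule periodic_descends)
    fix w assume w: "Re w < ln r"
    show "((\<lambda>w. exp (-a*w) * v w) has_field_derivative (-a * exp (-a*w) * v w + d w * exp (-a*w))) (at w)"
      by (rule DERIV_mult[OF e D(1)]) (use w in simp)
    show "exp (-a*(w + ?p)) * v (w + ?p) = exp (-a*w) * v w"
      unfolding exper using vper[OF w, folded l_def] l0 by simp
  qed (rule that, assumption, assumption)
  obtain G21 where G21: "\<And>w. Re w < ln r \<Longrightarrow> G21 (exp w) = exp (-a*w) * d w"
    "\<And>w. Re w < ln r \<Longrightarrow> (G21 has_field_derivative (-a * exp (-a*w) * d w + Q (exp w) * v w * exp (-a*w)) / exp w) (at (exp w))"
  proof (rule periodic_descends)
    fix w assume w: "Re w < ln r"
    show "((\<lambda>w. exp (-a*w) * d w) has_field_derivative (-a * exp (-a*w) * d w + Q (exp w) * v w * exp (-a*w))) (at w)"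
      by (rule DERIV_mult[OF e D(2)]) (use w in simp)
    show "exp (-a*(w + ?p)) * d (w + ?p) = exp (-a*w) * d w"
      unfolding exper using dper(1)[OF w] l0 by simp
  qed (rule that, assumption, assumption)
  have lem: "((\<lambda>w. exp (a*w) * (f2 w - k * w * f w)) has_field_derivative
        a * exp (a*w) * (f2 w - k * w * f w) + (f2' - (k * 1 * f w + f' * (k * w))) * exp (a*w)) (at w)"
    if "(f has_field_derivative f') (at w)" "(f2 has_field_derivative f2') (at w)" for f f2 f' f2' w
    by (rule DERIV_mult[OF e DERIV_diff[OF that(2) DERIV_mult[OF DERIV_cmult[OF DERIV_ident] that(1)]]])
  have per2: "exp (a*(w + ?p)) * ((k0 * y + y2 / l) - k * (w + ?p) * (l * y)) = exp (a*w) * (y2 - k * w * y)" for w y y2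
  proof -
    have "exp (a*(w + ?p)) * ((k0 * y + y2 / l) - k * (w + ?p) * (l * y)) = exp (a*w) * (l * k0 * y + y2 - (k * l * l) * (w + ?p) * y)"
      unfolding exper using l0 by (simp add: field_simps)
    also have "\<dots> = exp (a*w) * (y2 - k * w * y)" unfolding k2 kp by (simp add: algebra_simps)
    finally show ?thesis .
  qed
  obtain G12 where G12: "\<And>w. Re w < ln r \<Longrightarrow> G12 (exp w) = exp (a*w) * (v2 w - k * w * v w)"
    "\<And>w. Re w < ln r \<Longrightarrow> (G12 has_field_derivative (a * exp (a*w) * (v2 w - k * w * v w) + (d2 w - (k * 1 * v w + d w * (k * w))) * exp (a*w)) / exp w) (at (exp w))"
  proof (rule periodic_descends)
    fix w assume w: "Re w < ln r"
    show "((\<lambda>w. exp (a*w) * (v2 w - k * w * v w)) has_field_derivative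
        a * exp (a*w) * (v2 w - k * w * v w) + (d2 w - (k * 1 * v w + d w * (k * w))) * exp (a*w)) (at w)"
      by (rule lem) (use D w in auto)
    show "exp (a*(w + ?p)) * (v2 (w + ?p) - k * (w + ?p) * v (w + ?p)) = exp (a*w) * (v2 w - k * w * v w)"
      using per2 v2per[OF w] vper[OF w, folded l_def] by simp
  qed (rule that, assumption, assumption)
  obtain G22 where G22: "\<And>w. Re w < ln r \<Longrightarrow> G22 (exp w) = exp (a*w) * (d2 w - k * w * d w)"
    "\<And>w. Re w < ln r \<Longrightarrow> (G22 has_field_derivative (a * exp (a*w) * (d2 w - k * w * d w) + (Q (exp w) * v2 w - (k * 1 * d w + (Q (exp w) * v w) * (k * w))) * exp (a*w)) / exp w) (at (exp w))"
  proof (rule periodic_descends)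
    fix w assume w: "Re w < ln r"
    show "((\<lambda>w. exp (a*w) * (d2 w - k * w * d w)) has_field_derivative
        a * exp (a*w) * (d2 w - k * w * d w) + (Q (exp w) * v2 w - (k * 1 * d w + (Q (exp w) * v w) * (k * w))) * exp (a*w)) (at w)"
      by (rule lem) (use D w in auto)
    show "exp (a*(w + ?p)) * (d2 (w + ?p) - k * (w + ?p) * d (w + ?p)) = exp (a*w) * (d2 w - k * w * d w)"
      using per2 dper[OF w] by simp
  qed (rule that, assumption, assumption)
  have ee: "exp (-a*w) * exp (a*w) = 1" for w by (simp add: exp_minus)
  show ?thesis
  proof (rule that[of G11 G22 G12 G21 k j])
    fix x :: complex assume x: "x \<in> ball 0 r - {0}"
    obtain w where w: "x = exp w" "Re w < ln r" using punctured_ball_cases[OF r x] by blast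
    have "G11 x * G22 x - G12 x * G21 x = (exp (-a*w) * exp (a*w)) * (v w * d2 w - v2 w * d w)"
      unfolding w G11(1)[OF w(2)] G12(1)[OF w(2)] G21(1)[OF w(2)] G22(1)[OF w(2)] by (simp add: algebra_simps)
    then show "G11 x * G22 x - G12 x * G21 x = 1" using ee W[OF w(2)] by simp
    show "(G11 has_field_derivative (G21 x - a * G11 x) / x) (at x)"
      using G11(2)[OF w(2)] unfolding w G11(1)[OF w(2)] G21(1)[OF w(2)] by (simp add: algebra_simps)
    show "(G21 has_field_derivative (Q x * G11 x - a * G21 x) / x) (at x)"
      using G21(2)[OF w(2)] unfolding w G11(1)[OF w(2)] G21(1)[OF w(2)] by (simp add: algebra_simps)
    have *: "k * (1/x)^j * (exp (-a*w) * y) = k * exp (a*w) * y" for y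
      using kj[of w] unfolding w(1) by (metis mult.assoc)
    have eq12: "a * exp (a*w) * (v2 w - k * w * v w) + (d2 w - (k * 1 * v w + d w * (k * w))) * exp (a*w)
       = G22 x - k * (1/x)^j * G11 x + a * G12 x"
      using *[of "v w"] unfolding w G11(1)[OF w(2)] G12(1)[OF w(2)] G22(1)[OF w(2)] by (simp add: algebra_simps)
    show "(G12 has_field_derivative (G22 x - k * (1/x)^j * G11 x + a * G12 x) / x) (at x)"
      using G12(2)[OF w(2)] unfolding eq12 w(1)[symmetric] .
    have eq22: "a * exp (a*w) * (d2 w - k * w * d w) + (Q x * v2 w - (k * 1 * d w + (Q x * v w) * (k * w))) * exp (a*w)
       = Q x * G12 x - k * (1/x)^j * G21 x + a * G22 x"
      using *[of "d w"] unfolding w G21(1)[OF w(2)] G12(1)[OF w(2)] G22(1)[OF w(2)] by (simp add: algebra_simps)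
    show "(G22 has_field_derivative (Q x * G12 x - k * (1/x)^j * G21 x + a * G22 x) / x) (at x)"
      using G22(2)[OF w(2)] unfolding w(1)[symmetric] eq22 .
  qed
qed

subsection \<open>Laurent splitting and factorisation near the identity\<close>

lemma Cauchy_integral_circlepath_holomorphic:
  assumes f: "continuous_on (sphere 0 r) f" and r: "0 < r"
  shows "(\<lambda>x. contour_integral (circlepath 0 r) (\<lambda>z. f z / (z - x))) holomorphic_on (- sphere 0 r)"
proof -
  have int: "((\<lambda>u. f u / (u - w) ^ 1) has_contour_integral
      contour_integral (circlepath 0 r) (\<lambda>z. f z / (z - w))) (circlepath 0 r)"
    if "w \<in> UNIV - path_image (circlepath 0 r)" for w
    unfolding power_one_right
  proof (rule has_contour_integral_integral, rule contour_integrable_continuous_circlepath)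
    show "continuous_on (path_image (circlepath 0 r)) (\<lambda>u. f u / (u - w))"
      using f r that by (auto intro!: continuous_intros)
  qed
  have "\<exists>d. ((\<lambda>x. contour_integral (circlepath 0 r) (\<lambda>z. f z / (z - x))) has_field_derivative d) (at w)"
    if "w \<in> - sphere 0 r" for w
    using Cauchy_next_derivative(2)[where \<gamma>="circlepath 0 r" and f'=f and S=UNIV and B="2 * pi * \<bar>r\<bar>" and k=1
       and f="\<lambda>x. contour_integral (circlepath 0 r) (\<lambda>z. f z / (z - x))" and w=w] f r that int
    by (auto simp: vector_derivative_circlepath norm_mult)
  then show ?thesis
    by (subst holomorphic_on_open) (auto simp: open_Compl)
qed

text \<open>The difference quotient \<open>g\<close> is holomorphic across \<open>x\<close>, so its
  integrals over the two homotopic circles agree. After splitting off \<open>f x\<close>, the kernel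
  integrates to 2 \<pi> \<i> over the outer circle and to 0 over the inner one.\<close>

lemma Cauchy_integral_annulus:
  assumes f: "f holomorphic_on {x. r0 < norm x \<and> norm x < R0}"
    and r: "0 \<le> r0" "r0 < ra" "ra < norm x" "norm x < rb" "rb < R0"
  shows "2 * of_real pi * \<i> * f x = contour_integral (circlepath 0 rb) (\<lambda>z. f z / (z - x))
           - contour_integral (circlepath 0 ra) (\<lambda>z. f z / (z - x))"
proof -
  define A where "A = {x::complex. r0 < norm x \<and> norm x < R0}"
  have oA: "open A" unfolding A_def by (intro open_Collect_conj open_Collect_less continuous_intros)
  have fA: "f holomorphic_on A" using f by (simp add: A_def)
  have pos: "0 < ra" "0 < rb" using r by auto
  define g where "g = (\<lambda>z. if z = x then deriv f x else (f z - f x) / (z - x))"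
  have g: "g holomorphic_on A" unfolding g_def by (rule pole_lemma_open[OF fA oA])
  have hom: "homotopic_loops A (circlepath 0 ra) (circlepath 0 rb)"
  proof (rule homotopic_loops_linear)
    fix t :: real
    show "closed_segment (circlepath 0 ra t) (circlepath 0 rb t) \<subseteq> A"
    proof
      fix y assume "y \<in> closed_segment (circlepath 0 ra t) (circlepath 0 rb t)"
      then obtain u where u: "0 \<le> u" "u \<le> 1" and y: "y = (1-u) *\<^sub>R circlepath 0 ra t + u *\<^sub>R circlepath 0 rb t"
        by (auto simp: closed_segment_def)
      have yy: "y = of_real ((1-u)*ra + u*rb) * exp (2 * of_real pi * \<i> * of_real t)"
        unfolding y circlepath by (simp add: scaleR_conv_of_real algebra_simps)
      have e1: "norm (exp (2 * of_real pi * \<i> * of_real t)) = 1"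
        using norm_exp_i_times[of "2*pi*t"] by (simp add: mult_ac)
      have "0 \<le> (1-u)*ra + u*rb" using u pos by auto
      then have n: "norm y = (1-u)*ra + u*rb" unfolding yy norm_mult e1 norm_of_real by simp
      have "ra \<le> (1-u)*ra + u*rb" using u r mult_left_mono[of ra rb u] by (simp add: algebra_simps)
      moreover have "(1-u)*ra + u*rb \<le> rb"
        using u r mult_left_mono[of ra rb "1-u"] by (simp add: algebra_simps)
      ultimately show "y \<in> A" using n r by (auto simp: A_def)
    qed
  qed auto
  have eq: "contour_integral (circlepath 0 ra) g = contour_integral (circlepath 0 rb) g"
    by (rule Cauchy_theorem_homotopic_loops[OF hom oA g]) auto
  have split: "contour_integral (circlepath 0 s) g =
      contour_integral (circlepath 0 s) (\<lambda>z. f z / (z - x)) - f x * contour_integral (circlepath 0 s) (\<lambda>z. 1 / (z - x))"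
    if s: "r0 < s" "s < R0" "s \<noteq> norm x" for s
  proof -
    have s0: "0 < s" using s r by auto
    have c: "continuous_on (sphere 0 s) f"
      by (rule continuous_on_subset[OF holomorphic_on_imp_continuous_on[OF fA]]) (use s in \<open>auto simp: A_def\<close>)
    have nx: "z \<noteq> x" if "z \<in> path_image (circlepath 0 s)" for z
      using that s s0 by auto
    have i1: "(\<lambda>z. f z / (z - x)) contour_integrable_on circlepath 0 s"
      by (rule contour_integrable_continuous_circlepath) (use c s s0 in \<open>auto intro!: continuous_intros\<close>)
    have i2: "(\<lambda>z. f x * (1 / (z - x))) contour_integrable_on circlepath 0 s"
      by (rule contour_integrable_continuous_circlepath) (use c s s0 in \<open>auto intro!: continuous_intros\<close>)
    have i3: "(\<lambda>z. 1 / (z - x)) contour_integrable_on circlepath 0 s"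
      by (rule contour_integrable_continuous_circlepath) (use c s s0 in \<open>auto intro!: continuous_intros\<close>)
    have "contour_integral (circlepath 0 s) g = contour_integral (circlepath 0 s) (\<lambda>z. f z / (z - x) - f x * (1 / (z - x)))"
      by (rule contour_integral_eq) (use nx in \<open>auto simp: g_def diff_divide_distrib\<close>)
    also have "\<dots> = contour_integral (circlepath 0 s) (\<lambda>z. f z / (z - x)) - contour_integral (circlepath 0 s) (\<lambda>z. f x * (1 / (z - x)))"
      by (rule contour_integral_diff[OF i1 i2])
    also have "contour_integral (circlepath 0 s) (\<lambda>z. f x * (1 / (z - x))) = f x * contour_integral (circlepath 0 s) (\<lambda>z. 1 / (z - x))"
      by (rule contour_integral_lmul[OF i3])
    finally show ?thesis .
  qed
  have "((\<lambda>u. 1/(u-x)) has_contour_integral (2 * of_real pi * \<i> * 1)) (circlepath 0 rb)"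
    by (rule Cauchy_integral_circlepath_simple) (use r in auto)
  then have b: "contour_integral (circlepath 0 rb) (\<lambda>z. 1 / (z - x)) = 2 * of_real pi * \<i>"
    by (simp add: contour_integral_unique)
  have "((\<lambda>u. 1/(u-x)) has_contour_integral 0) (circlepath 0 ra)"
    by (rule Cauchy_theorem_disc_simple[where a=0 and e="norm x"])
       (use r in \<open>auto intro!: holomorphic_intros\<close>)
  then have a: "contour_integral (circlepath 0 ra) (\<lambda>z. 1 / (z - x)) = 0"
    by (simp add: contour_integral_unique)
  show ?thesis using eq split[of ra] split[of rb] a b r by (simp add: algebra_simps)
qed

text \<open>\<open>fp\<close> is the Cauchy integral over the outer circle, \<open>fm\<close> minus
  the one over the inner circle, in the coordinate \<open>u = 1/x\<close>. The explicit bound on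
  \<open>fm\<close> removes its singularity at \<open>u = 0\<close> and later makes the Neumann
  iteration contract.\<close>

lemma Laurent_splitting:
  assumes f: "f holomorphic_on {x. r0 < norm x \<and> norm x < R0}"
    and r: "0 \<le> r0" "r0 < ra" "ra < rb" "rb < R0"
  obtains fp fm where "fp holomorphic_on ball 0 rb" "fm holomorphic_on ball 0 (1/ra)" "fm 0 = (0::complex)"
    "\<And>x. ra < norm x \<Longrightarrow> norm x < rb \<Longrightarrow> f x = fp x + fm (1/x)"
    "\<And>B u. (\<And>x. norm x = ra \<Longrightarrow> norm (f x) \<le> B) \<Longrightarrow> norm u < 1/ra \<Longrightarrow>
        norm (fm u) \<le> B * (norm u * ra / (1 - norm u * ra))"
proof -
  define J where "J s = (\<lambda>x. contour_integral (circlepath 0 s) (\<lambda>z. f z / (z - x)) / (2 * of_real pi * \<i>))" for s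
  have pos: "0 < ra" "0 < rb" using r by auto
  have cf: "continuous_on {x. r0 < norm x \<and> norm x < R0} f"
    by (rule holomorphic_on_imp_continuous_on[OF f])
  have c: "continuous_on (sphere 0 s) f" if "r0 < s" "s < R0" for s
    by (rule continuous_on_subset[OF cf]) (use that in auto)
  have hJ: "J s holomorphic_on - sphere 0 s" if "r0 < s" "s < R0" for s
    unfolding J_def using that r
    by (intro holomorphic_intros Cauchy_integral_circlepath_holomorphic c) auto
  define fm where "fm = (\<lambda>u. if u = 0 then 0 else - J ra (1/u))"
  have bound: "norm (fm u) \<le> B * (norm u * ra / (1 - norm u * ra))"
    if B: "\<And>x. norm x = ra \<Longrightarrow> norm (f x) \<le> B" and u: "norm u < 1/ra" for B u
  proof (cases "u = 0")
    case False
    have B0: "0 \<le> B" using B[of "of_real ra"] pos order_trans[OF norm_ge_zero] by auto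
    have nu: "ra < norm (1/u)" using u False pos by (auto simp: norm_divide field_simps)
    have "norm (contour_integral (circlepath 0 ra) (\<lambda>z. f z / (z - 1/u))) \<le> (B / (norm (1/u) - ra)) * (2*pi*ra)"
    proof (rule has_contour_integral_bound_circlepath)
      show "((\<lambda>z. f z / (z - 1/u)) has_contour_integral contour_integral (circlepath 0 ra) (\<lambda>z. f z / (z - 1/u))) (circlepath 0 ra)"
        by (rule has_contour_integral_integral, rule contour_integrable_continuous_circlepath)
           (use c[of ra] r nu pos in \<open>auto intro!: continuous_intros\<close>)
      show "0 \<le> B / (norm (1/u) - ra)" using B0 nu by auto
      fix z :: complex assume z: "norm (z - 0) = ra"
      have "norm (z - 1/u) \<ge> norm (1/u) - ra"
        using norm_triangle_ineq2[of "1/u" z] z by (simp add: norm_minus_commute)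
      then show "norm (f z / (z - 1/u)) \<le> B / (norm (1/u) - ra)"
        unfolding norm_divide[of "f z"] using B[of z] z B0 nu by (intro frac_le) auto
    qed (use pos in auto)
    then have "norm (fm u) \<le> B / (norm (1/u) - ra) * ra"
      using False by (simp add: fm_def J_def norm_divide norm_mult field_simps)
    also have "\<dots> = B * (norm u * ra / (1 - norm u * ra))"
      using False nu by (simp add: norm_divide field_simps)
    finally show ?thesis .
  qed (simp add: fm_def)
  obtain B where B: "norm (f x) \<le> B" if "norm x = ra" for x
  proof -
    have "compact (f ` sphere 0 ra)" by (intro compact_continuous_image c) (use r in auto)
    then have "bounded (f ` sphere 0 ra)" by (rule compact_imp_bounded)
    then obtain B where "\<forall>x\<in>f ` sphere 0 ra. norm x \<le> B" unfolding bounded_iff by blast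
    then show ?thesis using that[of B] by auto
  qed
  have "fm holomorphic_on ball 0 (1/ra)"
  proof (rule no_isolated_singularity'[where K="{0}"])
    have "(\<lambda>u. - J ra (1/u)) holomorphic_on ball 0 (1/ra) - {0}"
    proof (intro holomorphic_on_minus)
      have "J ra \<circ> (\<lambda>u. 1/u) holomorphic_on ball 0 (1/ra) - {0}"
        by (rule holomorphic_on_compose_gen[OF _ hJ])
           (use r pos in \<open>auto intro!: holomorphic_intros simp: norm_divide field_simps\<close>)
      then show "(\<lambda>u. J ra (1/u)) holomorphic_on ball 0 (1/ra) - {0}" by (simp add: o_def)
    qed
    then show "fm holomorphic_on ball 0 (1/ra) - {0}"
      by (rule holomorphic_transform) (auto simp: fm_def)
    fix z :: complex assume "z \<in> {0}"
    have "(fm \<longlongrightarrow> 0) (at 0)"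
    proof (rule Lim_null_comparison)
      have "eventually (\<lambda>u::complex. u \<in> ball 0 (1/ra)) (at 0)"
        by (rule eventually_at_in_open') (use pos in auto)
      then show "eventually (\<lambda>u. norm (fm u) \<le> B * (norm u * ra / (1 - norm u * ra))) (at 0)"
        by eventually_elim (use bound[OF B] in auto)
      have "((\<lambda>u::complex. B * (norm u * ra / (1 - norm u * ra))) \<longlongrightarrow> B * (norm (0::complex) * ra / (1 - norm (0::complex) * ra))) (at 0)"
        by (intro tendsto_intros) auto
      then show "((\<lambda>u::complex. B * (norm u * ra / (1 - norm u * ra))) \<longlongrightarrow> 0) (at 0)" by simp
    qed
    then show "(fm \<longlongrightarrow> fm z) (at z within ball 0 (1/ra))"
      using \<open>z \<in> {0}\<close> by (auto simp: fm_def intro: tendsto_within_subset)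
  qed auto
  moreover have "J rb holomorphic_on ball 0 rb"
    by (rule holomorphic_on_subset[OF hJ]) (use r in auto)
  moreover have "f x = J rb x + fm (1/x)" if x: "ra < norm x" "norm x < rb" for x
  proof -
    have "x \<noteq> 0" using x pos by auto
    then show ?thesis
      using Cauchy_integral_annulus[OF f r(1,2) x r(4)]
      by (simp add: fm_def J_def diff_divide_distrib[symmetric] del: diff_divide_distrib)
         (simp add: field_simps)
  qed
  moreover have "fm 0 = 0" by (simp add: fm_def)
  ultimately show ?thesis using bound that by blast
qed

section \<open>Approximation by Laurent polynomials\<close>

lemma poly_approx_holomorphic:
  assumes f: "f holomorphic_on ball 0 r" and s: "0 < s" "s < r" and e: "0 < e"
  obtains p where "\<And>x. norm x \<le> s \<Longrightarrow> norm (f x - poly p x) < e"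
proof -
  define a where "a = fps_nth (fps_expansion f 0)"
  have hf: "f holomorphic_on eball 0 (ereal r)" using f by simp
  have cr: "conv_radius a \<ge> ereal r"
    using conv_radius_fps_expansion[OF hf] unfolding a_def fps_conv_radius_def .
  have "ereal s < conv_radius a" using s cr by (metis ereal_less_eq(3) less_ereal.simps(1) less_le_trans)
  then have "uniform_limit (cball 0 s) (\<lambda>n x. \<Sum>i<n. a i * (x - 0) ^ i) (\<lambda>x. \<Sum>i. a i * (x - 0) ^ i) sequentially"
    by (rule powser_uniform_limit)
  then have "eventually (\<lambda>n. \<forall>x\<in>cball 0 s. dist (\<Sum>i<n. a i * (x - 0) ^ i) (\<Sum>i. a i * (x - 0) ^ i) < e) sequentially"
    by (rule uniform_limitD) (rule e)
  from eventually_happens'[OF sequentially_bot this]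
  obtain n where n: "\<forall>x\<in>cball 0 s. dist (\<Sum>i<n. a i * (x - 0) ^ i) (\<Sum>i. a i * (x - 0) ^ i) < e" by blast
  have "(\<Sum>i. a i * (x - 0) ^ i) = f x" if "norm x \<le> s" for x
    using eval_fps_expansion'[OF hf, of x] that s by (simp add: a_def eval_fps_def)
  moreover have "(\<Sum>i<n. a i * (x - 0) ^ i) = poly (\<Sum>i<n. monom (a i) i) x" for x
    by (simp add: poly_sum poly_monom)
  ultimately show ?thesis using n by (intro that[of "\<Sum>i<n. monom (a i) i"]) (auto simp: dist_norm norm_minus_commute)
qed

lemma Laurent_polynomial_approx:
  assumes f: "f holomorphic_on ball 0 R - {0}" and r: "0 < r1" "r1 < r2" "r2 < R" and e: "0 < e"
  obtains m p where "\<And>x. r1 \<le> norm x \<Longrightarrow> norm x \<le> r2 \<Longrightarrow> norm (f x - poly p x / x ^ m) < e"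
proof -
  have A: "{x::complex. 0 < norm x \<and> norm x < R} = ball 0 R - {0}" by auto
  have rr: "r1/2 < (r2+R)/2" "0 < r1/2" "(r2+R)/2 < R" using r by auto
  obtain fp fm where fp: "fp holomorphic_on ball 0 ((r2+R)/2)" and fm: "fm holomorphic_on ball 0 (1/(r1/2))"
    and eq: "\<And>x. r1/2 < norm x \<Longrightarrow> norm x < (r2+R)/2 \<Longrightarrow> f x = fp x + fm (1/x)"
    by (rule Laurent_splitting[of f 0 R "r1/2" "(r2+R)/2"]) (use f rr A in auto)
  obtain p where p: "\<And>x. norm x \<le> r2 \<Longrightarrow> norm (fp x - poly p x) < e/2"
    using poly_approx_holomorphic[OF fp, of r2 "e/2"] r e by auto
  obtain g where g: "\<And>x. norm x \<le> 1/r1 \<Longrightarrow> norm (fm x - poly g x) < e/2"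
    using poly_approx_holomorphic[OF fm, of "1/r1" "e/2"] r e by (auto simp: field_simps)
  show ?thesis
  \<comment> \<open>The reflected polynomial divided by \<open>x ^ degree g\<close> is
    \<open>g (1/x)\<close>, so both parts get a common denominator.\<close>
  proof (rule that[of "p * monom 1 (degree g) + reflect_poly g" "degree g"])
    fix x :: complex assume x: "r1 \<le> norm x" "norm x \<le> r2"
    then have x0: "x \<noteq> 0" using r by auto
    have "poly (p * monom 1 (degree g) + reflect_poly g) x / x ^ degree g = poly p x + poly g (1/x)"
      using x0 by (simp add: poly_reflect_poly_nz poly_monom add_divide_distrib inverse_eq_divide)
    moreover have "f x = fp x + fm (1/x)" using eq x r by auto
    moreover have "norm (fp x - poly p x) < e/2" using p x by auto
    moreover have "norm (fm (1/x) - poly g (1/x)) < e/2" 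
    proof (rule g)
      show "norm (1/x) \<le> 1/r1" using x r by (simp add: norm_divide frac_le)
    qed
    ultimately show "norm (f x - poly (p * monom 1 (degree g) + reflect_poly g) x / x ^ degree g) < e"
      using norm_triangle_ineq[of "fp x - poly p x" "fm (1/x) - poly g (1/x)"] by (simp add: algebra_simps)
  qed
qed

lemma holomorphic_suminf:
  fixes f :: "nat \<Rightarrow> complex \<Rightarrow> complex"
  assumes S: "open S" and f: "\<And>k. f k holomorphic_on S" and M: "\<And>k x. x \<in> S \<Longrightarrow> norm (f k x) \<le> M k" "summable M"
  shows "(\<lambda>x. \<Sum>k. f k x) holomorphic_on S"
proof (rule holomorphic_uniform_sequence[OF S])
  show "(\<lambda>x. \<Sum>k<n. f k x) holomorphic_on S" for n using f by (intro holomorphic_intros)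
  have u: "uniform_limit S (\<lambda>n x. \<Sum>k<n. f k x) (\<lambda>x. \<Sum>k. f k x) sequentially"
    by (rule Weierstrass_m_test[OF M])
  fix x assume "x \<in> S"
  then obtain d where "d > 0" "cball x d \<subseteq> S" using S open_contains_cball by blast
  then show "\<exists>d>0. cball x d \<subseteq> S \<and> uniform_limit (cball x d) (\<lambda>n x. \<Sum>k<n. f k x) (\<lambda>x. \<Sum>k. f k x) sequentially"
    using uniform_limit_on_subset[OF u] by blast
qed

lemma maximum_modulus_disc:
  assumes f: "f holomorphic_on ball 0 R" and r: "0 < r" "r < R" and B: "\<And>x. norm x = r \<Longrightarrow> norm (f x) \<le> B"
    and x: "norm x \<le> r"
  shows "norm (f x) \<le> B"
proof (rule maximum_modulus_frontier[of f "cball 0 r"])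
  have sub: "cball (0::complex) r \<subseteq> ball 0 R" using r by auto
  show "f holomorphic_on interior (cball 0 r)"
    by (rule holomorphic_on_subset[OF f]) (use r in auto)
  show "continuous_on (closure (cball 0 r)) f"
    using holomorphic_on_imp_continuous_on[OF holomorphic_on_subset[OF f sub]] by simp
qed (use B x in auto)

text \<open>Since \<open>f\<close> is holomorphic up to \<open>R\<close>, the plus part extends to
  the full disc as \<open>f x - fm (1/x)\<close>. On the circle of radius \<open>2 * \<rho>\<close>
  the factor in the bound on \<open>fm\<close> is exactly (1/2) / (1 - 1/2) = 1, which gives
  \<open>2 * B\<close> for \<open>fp\<close> there and, by the maximum principle, inside. The bound
  comes back on the annulus on which it was assumed, so the projection can be iterated.\<close>

lemma plus_part:
  assumes f: "f holomorphic_on ball 0 R - {0}" and r: "0 < \<rho>" "2 * \<rho> < R"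
  obtains fp fm where "fp holomorphic_on ball 0 R" "fm holomorphic_on ball 0 (1/\<rho>)"
    "\<And>x. \<rho> < norm x \<Longrightarrow> norm x < R \<Longrightarrow> f x = fp x + fm (1/x)"
    "\<And>B x. (\<And>x. \<rho> \<le> norm x \<Longrightarrow> norm x \<le> 2*\<rho> \<Longrightarrow> norm (f x) \<le> B) \<Longrightarrow> norm x \<le> 2*\<rho> \<Longrightarrow> norm (fp x) \<le> 2 * B"
proof -
  have A: "{x::complex. 0 < norm x \<and> norm x < R} = ball 0 R - {0}" by auto
  define rb where "rb = (2*\<rho>+R)/2"
  have rb: "\<rho> < rb" "rb < R" "2 * \<rho> < rb" using r by (auto simp: rb_def)
  obtain fp fm where fp: "fp holomorphic_on ball 0 rb" and fm: "fm holomorphic_on ball 0 (1/\<rho>)"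
    and eq: "\<And>x. \<rho> < norm x \<Longrightarrow> norm x < rb \<Longrightarrow> f x = fp x + fm (1/x)"
    and bd: "\<And>B u. (\<And>x. norm x = \<rho> \<Longrightarrow> norm (f x) \<le> B) \<Longrightarrow> norm u < 1/\<rho> \<Longrightarrow>
        norm (fm u) \<le> B * (norm u * \<rho> / (1 - norm u * \<rho>))"
    by (rule Laurent_splitting[of f 0 R \<rho> rb]) (use f r rb A in auto)
  define g where "g = (\<lambda>x. if norm x < rb then fp x else f x - fm (1/x))"
  define U where "U = {x::complex. \<rho> < norm x \<and> norm x < R}"
  have oU: "open U" unfolding U_def by (intro open_Collect_conj open_Collect_less continuous_intros)
  have gU: "g x = f x - fm (1/x)" if "x \<in> U" for x
    using eq that by (auto simp: g_def U_def)
  have "(\<lambda>x. fm (1/x)) holomorphic_on U"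
  proof -
    have "(\<lambda>x. 1/x) holomorphic_on U" by (intro holomorphic_intros) (use r in \<open>auto simp: U_def\<close>)
    moreover have "(\<lambda>x. 1/x) ` U \<subseteq> ball 0 (1/\<rho>)"
      using r by (auto simp: U_def norm_divide intro!: divide_strict_left_mono mult_pos_pos)
    ultimately show ?thesis using holomorphic_on_compose_gen[OF _ fm] by (simp add: o_def)
  qed
  then have "(\<lambda>x. f x - fm (1/x)) holomorphic_on U"
    by (intro holomorphic_on_diff holomorphic_on_subset[OF f]) (use r in \<open>auto simp: U_def\<close>)
  then have 1: "g holomorphic_on U" by (rule holomorphic_transform) (use gU in auto)
  have 2: "g holomorphic_on ball 0 rb" by (rule holomorphic_transform[OF fp]) (auto simp: g_def)
  have "ball 0 R = ball 0 rb \<union> U" using rb r by (auto simp: U_def)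
  then have g: "g holomorphic_on ball 0 R" using holomorphic_on_Un[OF 2 1 open_ball oU] by simp
  show ?thesis
  proof (rule that[OF g fm])
    fix x :: complex assume "\<rho> < norm x" "norm x < R"
    then show "f x = g x + fm (1/x)" using gU[of x] by (simp add: U_def)
  next
    fix B and x :: complex
    assume B: "\<And>x. \<rho> \<le> norm x \<Longrightarrow> norm x \<le> 2*\<rho> \<Longrightarrow> norm (f x) \<le> B" and x: "norm x \<le> 2*\<rho>"
    show "norm (g x) \<le> 2 * B"
    proof (rule maximum_modulus_disc[OF g _ _ _ x])
      fix x :: complex assume x: "norm x = 2 * \<rho>"
      have "norm (fm (1/x)) \<le> B * (norm (1/x) * \<rho> / (1 - norm (1/x) * \<rho>))"
        by (rule bd) (use B r x in \<open>auto simp: norm_divide field_simps\<close>)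
      also have "\<dots> = B" using x r by (simp add: norm_divide)
      finally have "norm (fm (1/x)) \<le> B" .
      moreover have "norm (f x) \<le> B" using B[of x] x r by auto
      moreover have "g x = f x - fm (1/x)" using gU[of x] x r by (auto simp: U_def)
      ultimately show "norm (g x) \<le> 2 * B" using norm_triangle_ineq4[of "f x" "fm (1/x)"] by simp
    qed (use r in auto)
  qed
qed

text \<open>The row equation t (I + E) = s is solved by a Neumann series: \<open>u (Suc k)\<close>
  is the part of \<open>u k\<close> times E that is holomorphic at 0, the remainder
  \<open>g k\<close> belongs to infinity, and \<open>t\<close>, \<open>s\<close> are alternating
  sums of these. Two entries of size 1/32 give 1/16 and the projection doubles it, so the terms
  decay like \<open>(1/8)^k\<close> and \<open>t\<close> at 0 differs from \<open>e\<close> by at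
  most 1/7.\<close>

lemma near_identity_factorisation:
  fixes E :: "bool \<Rightarrow> bool \<Rightarrow> complex \<Rightarrow> complex" and e :: "bool \<Rightarrow> complex"
  assumes E: "\<And>i j. E i j holomorphic_on ball 0 R - {0}" and r: "0 < \<rho>" "2 * \<rho> < R"
    and small: "\<And>i j x. \<rho> \<le> norm x \<Longrightarrow> norm x \<le> 2 * \<rho> \<Longrightarrow> norm (E i j x) \<le> 1/32"
    and e: "\<And>i. norm (e i) \<le> 1"
  obtains t s where "\<And>i. t i holomorphic_on ball 0 (2*\<rho>)" "\<And>i. s i holomorphic_on ball 0 (2/(3*\<rho>))"
    "\<And>j x. 3*\<rho>/2 < norm x \<Longrightarrow> norm x < 2*\<rho> \<Longrightarrow> t j x + (\<Sum>i\<in>UNIV. t i x * E i j x) = s j (1/x)"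
    "\<And>i. norm (t i 0 - e i) \<le> 1/3"
proof -
  have ex: "\<exists>fp fm. f holomorphic_on ball 0 R - {0} \<longrightarrow> fp holomorphic_on ball 0 R \<and> fm holomorphic_on ball 0 (1/\<rho>) \<and>
    (\<forall>x. \<rho> < norm x \<longrightarrow> norm x < R \<longrightarrow> f x = fp x + fm (1/x)) \<and>
    (\<forall>B x. (\<forall>x. \<rho> \<le> norm x \<longrightarrow> norm x \<le> 2*\<rho> \<longrightarrow> norm (f x) \<le> B) \<longrightarrow> norm x \<le> 2*\<rho> \<longrightarrow> norm (fp x) \<le> 2 * B)" for f
    using plus_part[OF _ r, of f] by metis
  obtain P N where PN: "\<And>f. f holomorphic_on ball 0 R - {0} \<Longrightarrow> P f holomorphic_on ball 0 R \<and> N f holomorphic_on ball 0 (1/\<rho>) \<and>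
    (\<forall>x. \<rho> < norm x \<longrightarrow> norm x < R \<longrightarrow> f x = P f x + N f (1/x)) \<and>
    (\<forall>B x. (\<forall>x. \<rho> \<le> norm x \<longrightarrow> norm x \<le> 2*\<rho> \<longrightarrow> norm (f x) \<le> B) \<longrightarrow> norm x \<le> 2*\<rho> \<longrightarrow> norm (P f x) \<le> 2 * B)"
    using ex by metis
  define mul where "mul u j = (\<lambda>x. \<Sum>i\<in>UNIV. u i x * E i j x)" for u :: "bool \<Rightarrow> complex \<Rightarrow> complex" and j
  define u where "u = rec_nat (\<lambda>i x. e i) (\<lambda>_ u j. P (mul u j))"
  have u0: "u 0 = (\<lambda>i x. e i)" and uS: "\<And>k j. u (Suc k) j = P (mul (u k) j)" by (auto simp: u_def)
  define g where "g k j = N (mul (u k) j)" for k j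
  have mh: "mul v j holomorphic_on ball 0 R - {0}" if "\<And>i. v i holomorphic_on ball 0 R" for v j
    unfolding mul_def by (intro holomorphic_intros E holomorphic_on_subset[OF that]) auto
  have uh: "u k i holomorphic_on ball 0 R" for k i
  proof (induction k arbitrary: i)
    case (Suc k) then show ?case unfolding uS using PN[OF mh[of "u k", OF Suc]] by blast
  qed (simp add: u0)
  have mB: "norm (mul v j x) \<le> B/16" if "\<And>i. norm (v i x) \<le> B" "\<rho> \<le> norm x" "norm x \<le> 2*\<rho>" for v j x B
  proof -
    have "norm (mul v j x) \<le> (\<Sum>i\<in>UNIV. norm (v i x * E i j x))" unfolding mul_def by (rule norm_sum)
    also have "\<dots> \<le> (\<Sum>i\<in>(UNIV::bool set). B * (1/32))"
      unfolding norm_mult using that small order_trans[OF norm_ge_zero that(1)] by (intro sum_mono mult_mono) auto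
    finally show ?thesis by simp
  qed
  have ub: "norm (u k i x) \<le> (1/8)^k" if "norm x \<le> 2*\<rho>" for k i x
    using that
  proof (induction k arbitrary: i x)
    case (Suc k)
    have "norm (mul (u k) i x) \<le> (1/8)^k/16" if "\<rho> \<le> norm x" "norm x \<le> 2*\<rho>" for x
      by (rule mB) (use Suc.IH that in auto)
    then have "norm (u (Suc k) i x) \<le> 2 * ((1/8)^k/16)" unfolding uS using PN[OF mh[of "u k", OF uh]] Suc.prems by blast
    then show ?case by simp
  qed (use e in \<open>auto simp: u0\<close>)
  have spl: "mul (u k) j x = u (Suc k) j x + g k j (1/x)" if "\<rho> < norm x" "norm x < R" for k j x
    unfolding uS g_def using PN[OF mh[of "u k", OF uh]] that by blast
  have gh: "g k j holomorphic_on ball 0 (1/\<rho>)" for k j unfolding g_def using PN[OF mh[of "u k", OF uh]] by blast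
  \<comment> \<open>The splitting holds only for norms above \<open>\<rho>\<close>, so the estimate
    is made on the intermediate circle of radius \<open>3*\<rho>/2\<close>, which has radius
    \<open>2/(3*\<rho>)\<close> in the coordinate \<open>1/x\<close>.\<close>
  have gb: "norm (g k j z) \<le> (1/8)^k" if z: "norm z \<le> 2/(3*\<rho>)" for k j z
  proof (rule maximum_modulus_disc[OF gh _ _ _ z])
    fix z :: complex assume z: "norm z = 2/(3*\<rho>)"
    define x where "x = 1/z"
    have nx: "norm x = 3*\<rho>/2" using z by (simp add: x_def norm_divide)
    have "norm (mul (u k) j x) \<le> (1/8)^k/16" by (rule mB) (use ub nx r in auto)
    moreover have "norm (u (Suc k) j x) \<le> (1/8)^Suc k" by (rule ub) (use nx r in auto)
    moreover have "g k j z = mul (u k) j x - u (Suc k) j x" using spl[of x k j] nx r by (simp add: x_def)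
    ultimately have "norm (g k j z) \<le> (1/8)^k/16 + (1/8)^Suc k" using norm_triangle_ineq4[of "mul (u k) j x" "u (Suc k) j x"] by simp
    also have "\<dots> \<le> (1/8)^k" by simp
    finally show "norm (g k j z) \<le> (1/8)^k" .
  qed (use r in \<open>auto simp: field_simps\<close>)
  have sm: "summable (\<lambda>k. (1/8::real)^k)" by (intro summable_geometric) auto
  define t where "t i x = (\<Sum>k. (-1)^k * u k i x)" for i x
  define s where "s i z = e i + (\<Sum>k. (-1)^k * g k i z)" for i z
  have su: "summable (\<lambda>k. (-1)^k * u k i x)" if "norm x \<le> 2*\<rho>" for i x
    by (rule summable_comparison_test'[OF sm]) (use ub that in \<open>auto simp: norm_mult norm_power\<close>)
  have sg: "summable (\<lambda>k. (-1)^k * g k i z)" if "norm z \<le> 2/(3*\<rho>)" for i z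
    by (rule summable_comparison_test'[OF sm]) (use gb that in \<open>auto simp: norm_mult norm_power\<close>)
  \<comment> \<open>The projected terms are the summands of \<open>t\<close> shifted by one index
    with the sign reversed; this \<open>e - t\<close> will cancel the \<open>t\<close> of the row
    equation and leave \<open>e\<close> in \<open>s\<close>.\<close>
  have tS: "(\<Sum>k. (-1)^k * u (Suc k) j x) = e j - t j x" if "norm x \<le> 2*\<rho>" for j x
  proof -
    have s': "summable (\<lambda>k. (-1)^Suc k * u (Suc k) j x)"
      using su[of x j] that by (subst summable_Suc_iff[where f="\<lambda>k. (-1)^k * u k j x"]) auto
    have "t j x = e j + (\<Sum>k. (-1)^Suc k * u (Suc k) j x)"
      using suminf_split_head[OF su, of x j] that by (simp add: t_def u0 del: power_Suc)
    moreover have "(\<Sum>k. - ((-1)^Suc k * u (Suc k) j x)) = - (\<Sum>k. (-1)^Suc k * u (Suc k) j x)"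
      by (rule suminf_minus[OF s'])
    ultimately show ?thesis by simp
  qed
  show ?thesis
  proof (rule that[of t s])
    fix i show "t i holomorphic_on ball 0 (2*\<rho>)" unfolding t_def
      by (rule holomorphic_suminf[OF _ _ _ sm])
         (use ub r in \<open>auto intro!: holomorphic_intros holomorphic_on_subset[OF uh] simp: norm_mult norm_power\<close>)
    show "s i holomorphic_on ball 0 (2/(3*\<rho>))" unfolding s_def
      by (intro holomorphic_on_add holomorphic_on_const holomorphic_suminf[OF _ _ _ sm])
         (use gb r in \<open>auto intro!: holomorphic_intros holomorphic_on_subset[OF gh] simp: norm_mult norm_power field_simps\<close>)
    have t0: "t i 0 - e i = - (\<Sum>k. (-1)^k * u (Suc k) i 0)" using tS[of 0 i] r by simp
    have "norm (\<Sum>k. (-1)^k * u (Suc k) i 0) \<le> (\<Sum>k. (1/8) * (1/8::real)^k)"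
      by (rule norm_suminf_le) (use ub[of 0 "Suc _" i] r sm in \<open>auto simp: norm_mult norm_power intro!: summable_mult\<close>)
    also have "\<dots> = 1/7" by (subst suminf_mult[OF sm]) (simp add: suminf_geometric)
    finally show "norm (t i 0 - e i) \<le> 1/3" unfolding t0 by simp
  next
    fix j and x :: complex assume x: "3*\<rho>/2 < norm x" "norm x < 2*\<rho>"
    have nz: "norm (1/x) \<le> 2/(3*\<rho>)" 
    proof -
      have "1 / norm x \<le> 1 / (3*\<rho>/2)" using x r by (intro frac_le) auto
      then show ?thesis by (simp add: norm_divide)
    qed
    have "(\<Sum>i\<in>UNIV. t i x * E i j x) = (\<Sum>i\<in>UNIV. \<Sum>k. (-1)^k * u k i x * E i j x)"
      unfolding t_def using su x by (intro sum.cong) (auto simp: suminf_mult2)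
    also have "\<dots> = (\<Sum>k. \<Sum>i\<in>UNIV. (-1)^k * u k i x * E i j x)"
      by (rule suminf_sum[symmetric]) (use su x in \<open>auto intro!: summable_mult2\<close>)
    also have "\<dots> = (\<Sum>k. (-1)^k * u (Suc k) j x + (-1)^k * g k j (1/x))"
    proof (rule arg_cong[where f=suminf], rule ext)
      fix k
      have "(\<Sum>i\<in>UNIV. (-1)^k * u k i x * E i j x) = (-1)^k * mul (u k) j x"
        unfolding mul_def by (simp add: sum_distrib_left mult.assoc)
      then show "(\<Sum>i\<in>UNIV. (-1)^k * u k i x * E i j x) = (-1)^k * u (Suc k) j x + (-1)^k * g k j (1/x)"
        using spl[of x k j] x r by (simp add: distrib_left)
    qed
    also have "\<dots> = (\<Sum>k. (-1)^k * u (Suc k) j x) + (\<Sum>k. (-1)^k * g k j (1/x))"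
    proof (rule suminf_add[symmetric])
      have "summable (\<lambda>k. - ((-1)^Suc k * u (Suc k) j x))"
        using su[of x j] x by (intro summable_minus, subst summable_Suc_iff[where f="\<lambda>k. (-1)^k * u k j x"]) auto
      then show "summable (\<lambda>k. (-1)^k * u (Suc k) j x)" by simp
    qed (use sg nz in auto)
    also have "(\<Sum>k. (-1)^k * u (Suc k) j x) = e j - t j x" using tS x by simp
    finally show "t j x + (\<Sum>i\<in>UNIV. t i x * E i j x) = s j (1/x)" by (simp add: s_def)
  qed
qed

subsection \<open>Sections glued by a cocycle\<close>

lemma poly_at_infinity:
  assumes "degree p \<le> N" "x \<noteq> (0::complex)"
  shows "poly p x = x ^ N * poly (reflect_poly p * monom 1 (N - degree p)) (1/x)"
proof -
  have "x ^ N = x ^ degree p * x ^ (N - degree p)" using assms(1) by (simp add: power_add[symmetric])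
  moreover have "poly (reflect_poly p) (1/x) = (1/x) ^ degree p * poly p x"
    using poly_reflect_poly_nz[of "1/x" p] assms(2) by simp
  ultimately show ?thesis using assms(2) by (simp add: poly_monom power_one_over)
qed

lemma finite_common_power:
  fixes G :: "'i::finite \<Rightarrow> complex \<Rightarrow> complex"
  assumes G: "\<And>i. G i holomorphic_on ball 0 R - {0}" and r: "0 < r1" "r1 < r2" "r2 < R" and e: "0 < e"
  obtains m p where "\<And>i x. r1 \<le> norm x \<Longrightarrow> norm x \<le> r2 \<Longrightarrow> norm (G i x - poly (p i) x / x ^ m) < e"
proof -
  have "\<exists>m p. \<forall>x. r1 \<le> norm x \<longrightarrow> norm x \<le> r2 \<longrightarrow> norm (G i x - poly p x / x ^ m) < e" for i
    using Laurent_polynomial_approx[OF G r e] by metis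
  then obtain m p where mp: "\<And>i x. r1 \<le> norm x \<Longrightarrow> norm x \<le> r2 \<Longrightarrow> norm (G i x - poly (p i) x / x ^ m i) < e" by metis
  define M where "M = Max (range m)"
  have mM: "m i \<le> M" for i unfolding M_def by (intro Max_ge) auto
  show ?thesis
  proof (rule that[of "\<lambda>i. p i * monom 1 (M - m i)" M])
    fix i and x :: complex assume x: "r1 \<le> norm x" "norm x \<le> r2"
    have "x \<noteq> 0" using x r by auto
    moreover have "x ^ M = x ^ m i * x ^ (M - m i)" using mM[of i] by (simp add: power_add[symmetric])
    ultimately have "poly (p i * monom 1 (M - m i)) x / x ^ M = poly (p i) x / x ^ m i"
      by (simp add: poly_monom)
    then show "norm (G i x - poly (p i * monom 1 (M - m i)) x / x ^ M) < e" using mp[OF x] by simp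
  qed
qed

text \<open>\<open>G\<close> is the transition matrix on the annulus in which the disc around 0 and
  the disc around infinity overlap. Determinant one makes the determinant of two sections a scalar
  function on the sphere, up to a power of \<open>x\<close>.\<close>

locale cocycle =
  fixes r1 r2 :: real and G :: "bool \<Rightarrow> bool \<Rightarrow> complex \<Rightarrow> complex"
  assumes r: "0 < r1" "r1 < r2"
    and Ghol: "\<And>i j. G i j holomorphic_on {x. r1 < norm x \<and> norm x < r2}"
    and Gdet: "\<And>x. r1 < norm x \<Longrightarrow> norm x < r2 \<Longrightarrow> G False False x * G True True x - G False True x * G True False x = 1"
begin

text \<open>A section of the bundle glued by \<open>G\<close> with a pole of order at most \<open>n\<close> at infinity: \<open>t\<close> is its row vector near 0
  and \<open>s\<close>, in the variable \<open>1/x\<close>, its row vector near infinity. The indices \<open>False\<close>, \<open>True\<close> stand for 1, 2.\<close>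
definition glued :: "nat \<Rightarrow> (bool \<Rightarrow> complex \<Rightarrow> complex) \<Rightarrow> (bool \<Rightarrow> complex \<Rightarrow> complex) \<Rightarrow> bool" where
  "glued n t s \<longleftrightarrow> (\<forall>i. t i holomorphic_on ball 0 r2) \<and> (\<forall>i. s i holomorphic_on ball 0 (1/r1)) \<and>
     (\<forall>j x. r1 < norm x \<longrightarrow> norm x < r2 \<longrightarrow> t False x * G False j x + t True x * G True j x = x ^ n * s j (1/x))"

lemma gluedD:
  assumes "glued n t s"
  shows "t i holomorphic_on ball 0 r2" "s i holomorphic_on ball 0 (1/r1)"
    "\<And>x. r1 < norm x \<Longrightarrow> norm x < r2 \<Longrightarrow> t False x * G False j x + t True x * G True j x = x ^ n * s j (1/x)"
  using assms by (auto simp: glued_def)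

text \<open>Serves for the row vectors near 0 and near infinity alike; its zeros are the points
  where two sections become dependent.\<close>

definition wedge :: "(bool \<Rightarrow> complex \<Rightarrow> complex) \<Rightarrow> (bool \<Rightarrow> complex \<Rightarrow> complex) \<Rightarrow> complex \<Rightarrow> complex" where
  "wedge t t' x = t False x * t' True x - t True x * t' False x"

end

text \<open>Let P be a matrix of Laurent polynomials close to G. Then G adj(P) = I + E with E = G
  adj(P - G) small, because G adj(G) = I. A solution of t (I + E) = s, multiplied by P from the
  right, reads det(P) t G = s P, and clearing denominators leaves a section with a pole only at
  infinity. Two unit vectors as starting values give an independent pair.\<close>

lemma glued_pair_exists:
  fixes G :: "bool \<Rightarrow> bool \<Rightarrow> complex \<Rightarrow> complex"
  assumes R: "0 < R" and G: "\<And>i j. G i j holomorphic_on ball 0 R - {0}"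
    and det: "\<And>x. x \<in> ball 0 R - {0} \<Longrightarrow> G False False x * G True True x - G False True x * G True False x = 1"
  obtains r1 r2 n t t' s s' x where "cocycle r1 r2 G" "r2 < R"
    "cocycle.glued r1 r2 G n t s" "cocycle.glued r1 r2 G n t' s'"
    "x \<in> ball 0 r2" "cocycle.wedge t t' x \<noteq> 0"
proof -
  define \<rho> where "\<rho> = R/4"
  have \<rho>: "0 < \<rho>" "2 * \<rho> < R" using R by (auto simp: \<rho>_def)
  define r1 where "r1 = 3*\<rho>/2"
  define r2 where "r2 = 2*\<rho>"
  interpret cocycle r1 r2 G
  proof unfold_locales
    fix x :: complex assume "r1 < norm x" "norm x < r2"
    then have "x \<in> ball 0 R - {0}" using \<rho> by (auto simp: r1_def r2_def)
    then show "G False False x * G True True x - G False True x * G True False x = 1" by (rule det)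
  next
    fix i j
    have "{x. r1 < norm x \<and> norm x < r2} \<subseteq> ball 0 R - {0}" using \<rho> by (auto simp: r1_def r2_def)
    then show "G i j holomorphic_on {x. r1 < norm x \<and> norm x < r2}" by (rule holomorphic_on_subset[OF G])
  qed (use \<rho> in \<open>auto simp: r1_def r2_def\<close>)
  define K where "K = {x::complex. \<rho> \<le> norm x \<and> norm x \<le> 2 * \<rho>}"
  have "\<exists>M. \<forall>i j. \<forall>x\<in>K. norm (G i j x) \<le> M"
  proof -
    have Ke: "K = cball 0 (2*\<rho>) - ball 0 \<rho>" by (auto simp: K_def)
    have cK: "compact K" unfolding Ke by (intro compact_diff compact_cball open_ball)
    have sub: "K \<subseteq> ball 0 R - {0}" using \<rho> by (auto simp: K_def)
    have "\<exists>M. \<forall>x\<in>K. norm (G i j x) \<le> M" for i j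
    proof -
      have "compact (G i j ` K)"
        by (rule compact_continuous_image[OF holomorphic_on_imp_continuous_on[OF holomorphic_on_subset[OF G sub]] cK])
      then have "bounded (G i j ` K)" by (rule compact_imp_bounded)
      then show ?thesis unfolding bounded_iff by (metis imageI)
    qed
    then obtain M where M: "\<And>i j x. x \<in> K \<Longrightarrow> norm (G i j x) \<le> M i j" by metis
    have "M i j \<le> Max (range (\<lambda>(i,j). M i j))" for i j by (rule Max_ge) (auto intro!: image_eqI[where x="(i,j)"])
    then show ?thesis
      by (intro exI[of _ "Max (range (\<lambda>(i,j). M i j))"] allI ballI) (rule order_trans[OF M])
  qed
  then obtain M where M: "\<And>i j x. x \<in> K \<Longrightarrow> norm (G i j x) \<le> M" by blast
  have M0: "0 \<le> M" using M[of "of_real \<rho>" False False] \<rho> order_trans[OF norm_ge_zero] by (auto simp: K_def)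
  \<comment> \<open>An entry of \<open>E\<close> is a sum of two products of an entry of
    \<open>G\<close>, at most \<open>M\<close>, with an approximation error, at most
    \<open>e\<close>; the 64 brings it below the 1/32 required by the Neumann series.\<close>
  define e where "e = 1 / (64 * (M + 1))"
  have e: "0 < e" "2 * (M * e) \<le> 1/32" using M0 by (auto simp: e_def field_simps)
  obtain m p0 where p0: "\<And>ij x. \<rho> \<le> norm x \<Longrightarrow> norm x \<le> 2*\<rho> \<Longrightarrow>
      norm ((\<lambda>(i,j). G i j) ij x - poly (p0 ij) x / x ^ m) < e"
    by (rule finite_common_power[of "\<lambda>(i,j). G i j" R \<rho> "2*\<rho>" e]) (use G \<rho> e in auto)
  define p where "p i j = p0 (i,j)" for i j
  define P where "P i j x = poly (p i j) x / x ^ m" for i j x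
  have P: "norm (P i j x - G i j x) \<le> e" if "x \<in> K" for i j x
    using p0[of x "(i,j)"] that by (auto simp: K_def P_def p_def norm_minus_commute)
  define E where "E i j x = (if j then - G i False x * (P False True x - G False True x) + G i True x * (P False False x - G False False x)
     else G i False x * (P True True x - G True True x) - G i True x * (P True False x - G True False x))" for i j x
  have Ph: "P i j holomorphic_on ball 0 R - {0}" for i j unfolding P_def by (intro holomorphic_intros) auto
  have Eh: "E i j holomorphic_on ball 0 R - {0}" for i j
    unfolding E_def by (cases j) (auto intro!: holomorphic_intros G Ph)
  have aux: "norm (a * b + c * d) \<le> 1/32" if "norm a \<le> M" "norm c \<le> M" "norm b \<le> e" "norm d \<le> e" for a b c d :: complex
  proof -
    have "norm (a * b + c * d) \<le> norm a * norm b + norm c * norm d" using norm_triangle_ineq[of "a*b" "c*d"] by (simp add: norm_mult)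
    also have "\<dots> \<le> M * e + M * e" using that M0 by (intro add_mono mult_mono) auto
    finally show ?thesis using e by simp
  qed
  have Esm: "norm (E i j x) \<le> 1/32" if "\<rho> \<le> norm x" "norm x \<le> 2 * \<rho>" for i j x
  proof -
    have x: "x \<in> K" using that by (simp add: K_def)
    show ?thesis using aux[of "- G i False x" "G i True x" "P False True x - G False True x" "P False False x - G False False x"]
       aux[of "G i False x" "- G i True x" "P True True x - G True True x" "P True False x - G True False x"] M[OF x] P[OF x]
      by (cases j) (auto simp: E_def)
  qed
  \<comment> \<open>\<open>d\<close> is \<open>x^(2*m)\<close> times det P, the polynomial factor
    that both sections acquire.\<close>
  define d where "d = p False False * p True True - p False True * p True False"
  obtain N where N: "\<And>i j. degree (p i j) \<le> N"
  proof
    fix i j show "degree (p i j) \<le> Max (range (\<lambda>(i,j). degree (p i j)))" by (rule Max_ge) (auto intro!: image_eqI[where x="(i,j)"])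
  qed
  define ph where "ph i j = (\<lambda>u. poly (reflect_poly (p i j) * monom 1 (N - degree (p i j))) u)" for i j
  have ph: "poly (p i j) x = x ^ N * ph i j (1/x)" if "x \<noteq> 0" for i j x
    unfolding ph_def by (rule poly_at_infinity[OF N that])
  have IE: "(if i = j then 1 else 0) + E i j x = (if j then - G i False x * P False True x + G i True x * P False False x
      else G i False x * P True True x - G i True x * P True False x)" if "x \<in> ball 0 R - {0}" for i j x
    using det[OF that] by (cases i; cases j) (simp_all add: E_def algebra_simps)
  \<comment> \<open>If det P vanished identically, det (I + E) = det G det P would be 0 at
    \<open>x = \<rho>\<close>, against the smallness of E.\<close>
  have d0: "d \<noteq> 0"
  proof
    assume d: "d = 0"
    define x where "x = complex_of_real \<rho>"
    have x: "x \<in> ball 0 R - {0}" "\<rho> \<le> norm x" "norm x \<le> 2 * \<rho>" using \<rho> by (auto simp: x_def)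
    have "P False False x * P True True x - P False True x * P True False x = poly d x / x^(2*m)"
      using x by (simp add: P_def d_def field_simps power_mult power2_eq_square power_add[symmetric] mult_2)
    then have PD: "P False False x * P True True x - P False True x * P True False x = 0" using d by simp
    have "(1 + E False False x) * (1 + E True True x) - E False True x * E True False x
      = (G False False x * G True True x - G False True x * G True False x) * (P False False x * P True True x - P False True x * P True False x)"
    proof -
      have IE': "1 + E False False x = G False False x * P True True x - G False True x * P True False x"
        "1 + E True True x = - G True False x * P False True x + G True True x * P False False x"
        "E False True x = - G False False x * P False True x + G False True x * P False False x"
        "E True False x = G True False x * P True True x - G True True x * P True False x"
        using IE[OF x(1), of False False] IE[OF x(1), of True True] IE[OF x(1), of False True] IE[OF x(1), of True False]
        by simp_all
      show ?thesis unfolding IE' by algebra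
    qed
    then have *: "1 = E False True x * E True False x - E False False x - E True True x - E False False x * E True True x"
      using PD by (simp add: algebra_simps)
    have n: "norm (E i j x) \<le> 1/32" for i j using Esm x by auto
    have "norm (E i j x * E i' j' x) \<le> 1/32" for i j i' j'
      using mult_mono[OF n[of i j] n[of i' j']] by (simp add: norm_mult)
    then have "norm (E False True x * E True False x - E False False x - E True True x - E False False x * E True True x) \<le> 1/32+1/32+1/32+1/32"
      by (intro order_trans[OF norm_triangle_ineq4] add_mono n)
    then show False using *[symmetric] by simp
  qed
  have sol: "\<exists>t s. glued (m+N) (\<lambda>i x. poly d x * t i x) s \<and> (\<forall>i. t i holomorphic_on ball 0 r2) \<and> (\<forall>i. norm (t i 0 - e i) \<le> 1/3)"
    if e1: "\<And>i. norm (e i) \<le> 1" for e :: "bool \<Rightarrow> complex"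
  proof -
    obtain t s where ts: "\<And>i. t i holomorphic_on ball 0 (2*\<rho>)" "\<And>i. s i holomorphic_on ball 0 (2/(3*\<rho>))"
      "\<And>j x. 3*\<rho>/2 < norm x \<Longrightarrow> norm x < 2*\<rho> \<Longrightarrow> t j x + (\<Sum>i\<in>UNIV. t i x * E i j x) = s j (1/x)"
      "\<And>i. norm (t i 0 - e i) \<le> 1/3"
    proof (rule near_identity_factorisation[of E R \<rho> e])
      show "E i j holomorphic_on ball 0 R - {0}" for i j by (rule Eh)
      show "norm (E i j x) \<le> 1/32" if "\<rho> \<le> norm x" "norm x \<le> 2 * \<rho>" for i j x by (rule Esm[OF that])
      show "0 < \<rho>" "2 * \<rho> < R" by (rule \<rho>)+
      show "norm (e i) \<le> 1" for i by (rule e1)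
      fix t s assume "\<And>i. t i holomorphic_on ball 0 (2*\<rho>)" "\<And>i. s i holomorphic_on ball 0 (2/(3*\<rho>))"
        "\<And>j x. 3*\<rho>/2 < norm x \<Longrightarrow> norm x < 2*\<rho> \<Longrightarrow> t j x + (\<Sum>i\<in>UNIV. t i x * E i j x) = s j (1/x)"
        "\<And>i. norm (t i 0 - e i) \<le> 1/3"
      then show thesis by (rule that[of t s])
    qed
    have "glued (m+N) (\<lambda>i x. poly d x * t i x) (\<lambda>j u. s False u * ph False j u + s True u * ph True j u)"
      unfolding glued_def
    proof (intro conjI allI impI)
      fix i show "(\<lambda>x. poly d x * t i x) holomorphic_on ball 0 r2" using ts(1) by (auto intro!: holomorphic_intros simp: r2_def)
      show "(\<lambda>u. s False u * ph False i u + s True u * ph True i u) holomorphic_on ball 0 (1/r1)"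
        using ts(2) unfolding ph_def r1_def by (auto intro!: holomorphic_intros)
      fix x :: complex assume x: "r1 < norm x" "norm x < r2"
      have x0: "x \<noteq> 0" "x \<in> ball 0 R - {0}" using x r \<rho> by (auto simp: r2_def)
      define T where "T j = t False x * G False j x + t True x * G True j x" for j
      have s: "s j (1/x) = t j x + (t False x * E False j x + t True x * E True j x)" for j
        using ts(3)[of x j] x by (simp add: r1_def r2_def UNIV_bool add_ac)
      have sF: "s False (1/x) = T False * P True True x - T True * P True False x"
        using IE[OF x0(2), of False False] IE[OF x0(2), of True False] unfolding s T_def by simp algebra
      have sT: "s True (1/x) = T True * P False False x - T False * P False True x"
        using IE[OF x0(2), of False True] IE[OF x0(2), of True True] unfolding s T_def by simp algebra
      have P': "poly (p i j) x = x^m * P i j x" for i j using x0 by (simp add: P_def)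
      have "x^N * (s False (1/x) * ph False i (1/x) + s True (1/x) * ph True i (1/x)) =
         s False (1/x) * poly (p False i) x + s True (1/x) * poly (p True i) x"
        using ph[OF x0(1)] by (simp add: algebra_simps)
      also have "\<dots> = x^m * (P False False x * P True True x - P False True x * P True False x) * T i"
        unfolding P' sF sT by (cases i) (simp_all add: algebra_simps)
      finally have 1: "x^(m+N) * (s False (1/x) * ph False i (1/x) + s True (1/x) * ph True i (1/x))
         = x^m * x^m * (P False False x * P True True x - P False True x * P True False x) * T i"
        by (simp add: power_add mult.assoc)
      have "poly d x = x^m * x^m * (P False False x * P True True x - P False True x * P True False x)"
        unfolding d_def by (simp add: P' algebra_simps)
      note pd = this
      show "poly d x * t False x * G False i x + poly d x * t True x * G True i x =
         x ^ (m + N) * (s False (1/x) * ph False i (1/x) + s True (1/x) * ph True i (1/x))"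
        unfolding 1 pd[symmetric] T_def by (simp add: algebra_simps)
    qed
    then show ?thesis using ts(1,4) by (auto simp: r2_def)
  qed
  have b1: "norm (if i then 0 else 1 :: complex) \<le> 1" for i by simp
  have b1': "norm (if i then 1 else 0 :: complex) \<le> 1" for i by simp
  obtain t s where t: "glued (m+N) (\<lambda>i x. poly d x * t i x) s" "\<And>i. t i holomorphic_on ball 0 r2"
     "\<And>i. norm (t i 0 - (if i then 0 else 1)) \<le> 1/3"
    using sol[of "\<lambda>i. if i then 0 else 1", OF b1] by blast
  obtain t' s' where t': "glued (m+N) (\<lambda>i x. poly d x * t' i x) s'" "\<And>i. t' i holomorphic_on ball 0 r2"
     "\<And>i. norm (t' i 0 - (if i then 1 else 0)) \<le> 1/3"
    using sol[of "\<lambda>i. if i then 1 else 0", OF b1'] by blast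
  \<comment> \<open>Entrywise the row vectors are within 1/3 of the unit vectors, so the diagonal
    product has norm at least 4/9 and the other one at most 1/9.\<close>
  have w0: "wedge t t' 0 \<noteq> 0"
  proof
    assume w: "wedge t t' 0 = 0"
    have a: "norm (t False 0 - 1) \<le> 1/3" "norm (t' True 0 - 1) \<le> 1/3" "norm (t True 0) \<le> 1/3" "norm (t' False 0) \<le> 1/3"
      using t(3)[of False] t(3)[of True] t'(3)[of False] t'(3)[of True] by auto
    have b: "2/3 \<le> norm (t False 0)" "2/3 \<le> norm (t' True 0)"
      using a norm_triangle_ineq2[of 1 "1 - t False 0"] norm_triangle_ineq2[of 1 "1 - t' True 0"] by (auto simp: norm_minus_commute)
    have "2/3 * (2/3) \<le> norm (t False 0) * norm (t' True 0)" using b by (intro mult_mono) auto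
    moreover have "norm (t True 0) * norm (t' False 0) \<le> 1/3 * (1/3)" using a by (intro mult_mono) auto
    moreover have "norm (t False 0) * norm (t' True 0) = norm (t True 0) * norm (t' False 0)"
      using w by (simp add: wedge_def norm_mult[symmetric])
    ultimately show False by simp
  qed
  \<comment> \<open>\<open>d\<close> may vanish at 0, where independence is known; the open set of
    independence contains a point off the finitely many zeros of \<open>d\<close>.\<close>
  have "wedge t t' holomorphic_on ball 0 r2" unfolding wedge_def using t(2) t'(2) by (intro holomorphic_intros) auto
  then have "continuous_on (ball 0 r2) (wedge t t')" by (rule holomorphic_on_imp_continuous_on)
  then have "open (ball 0 r2 \<inter> wedge t t' -` (- {0}))" by (intro continuous_open_preimage) auto
  moreover have "0 \<in> ball 0 r2 \<inter> wedge t t' -` (- {0})" using w0 r by auto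
  ultimately have "infinite (ball 0 r2 \<inter> wedge t t' -` (- {0}))" using finite_imp_not_open by blast
  moreover have "finite {x. poly d x = 0}" using d0 by (rule poly_roots_finite)
  ultimately have "infinite (ball 0 r2 \<inter> wedge t t' -` (- {0}) - {x. poly d x = 0})" by (intro Diff_infinite_finite)
  then obtain x where x: "x \<in> ball 0 r2 \<inter> wedge t t' -` (- {0}) - {x. poly d x = 0}" by (metis infinite_imp_nonempty ex_in_conv)
  have "wedge (\<lambda>i x. poly d x * t i x) (\<lambda>i x. poly d x * t' i x) x = (poly d x)^2 * wedge t t' x"
    by (simp add: wedge_def algebra_simps power2_eq_square)
  then have "wedge (\<lambda>i x. poly d x * t i x) (\<lambda>i x. poly d x * t' i x) x \<noteq> 0" using x by auto
  then show ?thesis using that[OF cocycle_axioms _ t(1) t'(1)] x \<rho> by (auto simp: r2_def)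
qed

section \<open>Dividing sections by their zeros\<close>

lemma holomorphic_divide_root:
  assumes "f holomorphic_on S" "open S" "p \<in> S \<Longrightarrow> f p = 0"
  obtains g where "g holomorphic_on S" "\<And>x. x \<in> S \<Longrightarrow> f x = (x - p) * g x"
proof (cases "p \<in> S")
  case True
  show ?thesis
  proof (rule that)
    show "(\<lambda>z. if z = p then deriv f p else (f z - f p)/(z-p)) holomorphic_on S"
      by (rule pole_lemma_open[OF assms(1,2)])
  qed (use True assms(3) in auto)
next
  case False
  show ?thesis
  proof (rule that)
    show "(\<lambda>z. f z / (z - p)) holomorphic_on S" using False assms(1) by (auto intro!: holomorphic_intros)
  qed (use False in auto)
qed

text \<open>In the coordinate \<open>u = 1/x\<close> the divisor \<open>x - p\<close> is
  \<open>(1 - p * u) / u\<close>; for \<open>p = 0\<close> the numerator is the unit 1, as its zero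
  has moved out of the \<open>u\<close>-plane.\<close>

lemma holomorphic_divide_root_inverse:
  assumes "f holomorphic_on S" "open S" "p \<noteq> 0 \<Longrightarrow> 1/p \<in> S \<Longrightarrow> f (1/p) = 0"
  obtains g where "g holomorphic_on S" "\<And>u. u \<in> S \<Longrightarrow> f u = (1 - p * u) * g u"
proof (cases "p = 0")
  case False
  obtain g where g: "g holomorphic_on S" "\<And>u. u \<in> S \<Longrightarrow> f u = (u - 1/p) * g u"
    using holomorphic_divide_root[OF assms(1,2), of "1/p"] assms(3) False by metis
  show ?thesis
    by (rule that[of "\<lambda>u. - g u / p"]) (use g False in \<open>auto intro!: holomorphic_intros simp: field_simps\<close>)
qed (use assms(1) that in auto)

lemma linear_relation:
  fixes a b c d :: complex
  assumes "a * d - b * c = 0"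
  obtains x y where "(x, y) \<noteq> (0, 0)" "x * a + y * c = 0" "x * b + y * d = 0"
proof (cases "a = 0 \<and> c = 0")
  case True
  show ?thesis
  proof (cases "b = 0 \<and> d = 0")
    case True
    with \<open>a = 0 \<and> c = 0\<close> show ?thesis by (intro that[of 1 0]) auto
  next
    case False
    with True show ?thesis by (intro that[of d "-b"]) auto
  qed
next
  case False
  show ?thesis by (rule that[of c "-a"]) (use False assms in \<open>auto simp: algebra_simps\<close>)
qed

context cocycle
begin

text \<open>Liouville on the sphere: \<open>f x\<close> and \<open>g (1/x)\<close> form an entire
  function with the limit \<open>g 0\<close> at infinity.\<close>

lemma glued_constant:
  assumes f: "f holomorphic_on ball 0 r2" and g: "g holomorphic_on ball 0 (1/r1)"
    and eq: "\<And>x. r1 < norm x \<Longrightarrow> norm x < r2 \<Longrightarrow> f x = g (1/x)"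
  shows "x \<in> ball 0 r2 \<Longrightarrow> f x = g 0" "u \<in> ball 0 (1/r1) \<Longrightarrow> g u = g 0"
proof -
  define h where "h x = (if norm x < r2 then f x else g (1/x))" for x
  define U where "U = {x::complex. r1 < norm x}"
  have oU: "open U" unfolding U_def by (intro open_Collect_less continuous_intros)
  have im: "1/x \<in> ball 0 (1/r1)" if "x \<in> U" for x
    using that r by (auto simp: U_def norm_divide intro!: divide_strict_left_mono mult_pos_pos)
  have hU: "h x = g (1/x)" if "x \<in> U" for x using eq[of x] that by (auto simp: h_def U_def)
  have "(\<lambda>x. 1/x) holomorphic_on U" by (intro holomorphic_intros) (use r in \<open>auto simp: U_def\<close>)
  then have "(\<lambda>x. g (1/x)) holomorphic_on U"
  proof -
    assume "(\<lambda>x. 1/x) holomorphic_on U"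
    moreover have "(\<lambda>x. 1/x) ` U \<subseteq> ball 0 (1/r1)" using im by blast
    ultimately show ?thesis using holomorphic_on_compose_gen[OF _ g] by (simp add: o_def)
  qed
  then have 1: "h holomorphic_on U" by (rule holomorphic_transform) (use hU in auto)
  have 2: "h holomorphic_on ball 0 r2" by (rule holomorphic_transform[OF f]) (auto simp: h_def)
  have "UNIV = ball 0 r2 \<union> U" using r by (auto simp: U_def)
  then have hh: "h holomorphic_on UNIV" using holomorphic_on_Un[OF 2 1 open_ball oU] by simp
  have "(h \<longlongrightarrow> g 0) at_infinity"
  proof -
    have "isCont g 0" using g r by (intro holomorphic_on_imp_continuous_on[THEN continuous_on_interior]) auto
    moreover have "((\<lambda>x::complex. 1/x) \<longlongrightarrow> 0) at_infinity"
      using tendsto_inverse_0 by (simp add: divide_inverse)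
    ultimately have "((\<lambda>x. g (1/x)) \<longlongrightarrow> g 0) at_infinity" by (rule isCont_tendsto_compose)
    moreover have "eventually (\<lambda>x. g (1/x) = h x) at_infinity"
      unfolding eventually_at_infinity by (rule exI[of _ "r1+1"]) (auto simp: hU U_def)
    ultimately show ?thesis by (rule Lim_transform_eventually)
  qed
  then have hc: "h x = g 0" for x by (rule Liouville_weak[OF hh])
  show "x \<in> ball 0 r2 \<Longrightarrow> f x = g 0" using hc[of x] by (auto simp: h_def)
  show "u \<in> ball 0 (1/r1) \<Longrightarrow> g u = g 0"
  proof (cases "u = 0")
    case False
    assume "u \<in> ball 0 (1/r1)"
    then have "1/u \<in> U" using False r by (auto simp: U_def norm_divide field_simps)
    then show "g u = g 0" using hc[of "1/u"] hU[of "1/u"] by simp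
  qed simp
qed

text \<open>A section of pole order \<open>n\<close> is raised to order \<open>n'\<close> either by
  keeping \<open>t\<close> and multiplying \<open>s\<close> by a power of \<open>u\<close>, or by
  keeping \<open>s\<close> and multiplying \<open>t\<close> by a power of \<open>x\<close>. The
  first form suits combinations with a zero at a finite point, the second those with a zero at
  infinity.\<close>

lemma glued_combine:
  assumes "glued n t s" "glued n' t' s'" "n \<le> n'"
  shows "glued n' (\<lambda>i x. c * t i x + c' * t' i x) (\<lambda>i u. c * u^(n'-n) * s i u + c' * s' i u)"
    "glued n' (\<lambda>i x. c * x^(n'-n) * t i x + c' * t' i x) (\<lambda>i u. c * s i u + c' * s' i u)"
proof -
  note D = gluedD[OF assms(1)] gluedD[OF assms(2)]
  have pw: "x ^ n' = x ^ n * x ^ (n' - n)" for x :: complex using assms(3) by (simp add: power_add[symmetric])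
  show "glued n' (\<lambda>i x. c * t i x + c' * t' i x) (\<lambda>i u. c * u^(n'-n) * s i u + c' * s' i u)"
    unfolding glued_def
  proof (intro conjI allI impI)
    fix j and x :: complex assume x: "r1 < norm x" "norm x < r2"
    then have x0: "x \<noteq> 0" using r by auto
    have "x ^ n' * (c * (1/x)^(n'-n) * s j (1/x)) = c * (x^n * s j (1/x))"
      using x0 by (simp add: pw power_one_over)
    note 1 = this
    have "(c * t False x + c' * t' False x) * G False j x + (c * t True x + c' * t' True x) * G True j x
      = c * (t False x * G False j x + t True x * G True j x) + c' * (t' False x * G False j x + t' True x * G True j x)"
      by (simp add: algebra_simps)
    also have "\<dots> = x ^ n' * (c * (1/x)^(n'-n) * s j (1/x) + c' * s' j (1/x))"
      unfolding D(3)[OF x] D(6)[OF x] 1[symmetric] by (simp add: algebra_simps)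
    finally show "(c * t False x + c' * t' False x) * G False j x + (c * t True x + c' * t' True x) * G True j x
      = x ^ n' * (c * (1/x)^(n'-n) * s j (1/x) + c' * s' j (1/x))" .
  qed (use D in \<open>auto intro!: holomorphic_intros\<close>)
  show "glued n' (\<lambda>i x. c * x^(n'-n) * t i x + c' * t' i x) (\<lambda>i u. c * s i u + c' * s' i u)"
    unfolding glued_def
  proof (intro conjI allI impI)
    fix j and x :: complex assume x: "r1 < norm x" "norm x < r2"
    have "x ^ n' * (c * s j (1/x)) = c * x^(n'-n) * (t False x * G False j x + t True x * G True j x)"
      using D(3)[OF x, of j] by (simp add: pw)
    note 1 = this
    have "(c * x^(n'-n) * t False x + c' * t' False x) * G False j x + (c * x^(n'-n) * t True x + c' * t' True x) * G True j x
      = c * x^(n'-n) * (t False x * G False j x + t True x * G True j x) + c' * (t' False x * G False j x + t' True x * G True j x)"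
      by (simp add: algebra_simps)
    also have "\<dots> = x ^ n' * (c * s j (1/x) + c' * s' j (1/x))"
      unfolding D(6)[OF x] 1[symmetric] by (simp add: algebra_simps)
    finally show "(c * x^(n'-n) * t False x + c' * t' False x) * G False j x + (c * x^(n'-n) * t True x + c' * t' True x) * G True j x
      = x ^ n' * (c * s j (1/x) + c' * s' j (1/x))" .
  qed (use D in \<open>auto intro!: holomorphic_intros\<close>)
qed

text \<open>Division by \<open>x - p\<close> trades the zero for one order of the pole at infinity.
  For \<open>n = 0\<close> no order is left, and the factor \<open>u\<close> records that the
  quotient vanishes at infinity. The gluing relation is cancelled off \<open>p\<close> and extends
  to \<open>p\<close> by continuity.\<close>

lemma glued_divide:
  assumes g: "glued n t s" and p: "\<And>i. p \<in> ball 0 r2 \<Longrightarrow> t i p = 0" "\<And>i. r1 < norm p \<Longrightarrow> s i (1/p) = 0"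
  obtains T S where "\<And>i x. x \<in> ball 0 r2 \<Longrightarrow> t i x = (x - p) * T i x"
    "n > 0 \<Longrightarrow> glued (n - 1) T S" "n = 0 \<Longrightarrow> glued 0 T (\<lambda>i u. u * S i u)"
proof -
  note D = gluedD[OF g]
  have "\<exists>T. T holomorphic_on ball 0 r2 \<and> (\<forall>x\<in>ball 0 r2. t i x = (x - p) * T x)" for i
    by (rule holomorphic_divide_root[of "t i" "ball 0 r2" p]) (use D p in auto)
  then obtain T where T: "\<And>i. T i holomorphic_on ball 0 r2" "\<And>i x. x \<in> ball 0 r2 \<Longrightarrow> t i x = (x - p) * T i x" by metis
  have "\<exists>S. S holomorphic_on ball 0 (1/r1) \<and> (\<forall>u\<in>ball 0 (1/r1). s i u = (1 - p * u) * S u)" for i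
  proof (rule holomorphic_divide_root_inverse[of "s i" "ball 0 (1/r1)" p])
    assume "p \<noteq> 0" "1/p \<in> ball 0 (1/r1)"
    then show "s i (1/p) = 0" using p(2) r by (auto simp: norm_divide field_simps)
  qed (use D in auto)
  then obtain S where S: "\<And>i. S i holomorphic_on ball 0 (1/r1)" "\<And>i u. u \<in> ball 0 (1/r1) \<Longrightarrow> s i u = (1 - p * u) * S i u" by metis
  have TS: "T False x * G False j x + T True x * G True j x = x^n * (1/x * S j (1/x))"
    if x: "r1 < norm x" "norm x < r2" for j x
  proof -
    define A where "A = {x::complex. r1 < norm x \<and> norm x < r2}"
    have oA: "open A" unfolding A_def by (intro open_Collect_conj open_Collect_less continuous_intros)
    define D where "D x = (T False x * G False j x + T True x * G True j x) - x^n * (1/x * S j (1/x))" for x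
    have off: "D x = 0" if "x \<in> A" "x \<noteq> p" for x
    proof -
      have x: "r1 < norm x" "norm x < r2" "x \<noteq> 0" using that r by (auto simp: A_def)
      have "norm (1/x) < 1/r1" using x r by (auto simp: norm_divide intro!: divide_strict_left_mono mult_pos_pos)
      then have sj: "s j (1/x) = (1 - p * (1/x)) * S j (1/x)" using S(2) by simp
      have "x^n * s j (1/x) = (x - p) * (x^n * (1/x * S j (1/x)))" unfolding sj using x by (simp add: field_simps)
      moreover have tT: "t i x = (x - p) * T i x" for i using T(2)[of x i] x by simp
      have "t False x * G False j x + t True x * G True j x = (x - p) * (T False x * G False j x + T True x * G True j x)"
        unfolding tT by (simp add: algebra_simps)
      ultimately have "(x - p) * D x = 0" using gluedD(3)[OF g x(1,2), of j] by (simp add: D_def right_diff_distrib)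
      then show ?thesis using that by simp
    qed
    have "(\<lambda>x. S j (1/x)) holomorphic_on A"
    proof -
      have "(\<lambda>x. 1/x) holomorphic_on A" by (intro holomorphic_intros) (use r in \<open>auto simp: A_def\<close>)
      moreover have "(\<lambda>x. 1/x) ` A \<subseteq> ball 0 (1/r1)"
        using r by (auto simp: A_def norm_divide intro!: divide_strict_left_mono mult_pos_pos)
      ultimately show ?thesis using holomorphic_on_compose_gen[OF _ S(1)] by (simp add: o_def)
    qed
    then have "D holomorphic_on A" unfolding D_def
      by (intro holomorphic_intros Ghol[folded A_def] holomorphic_on_subset[OF T(1)]) (use r in \<open>auto simp: A_def\<close>)
    then have "isCont D x" using x oA continuous_on_eq_continuous_at holomorphic_on_imp_continuous_on by (auto simp: A_def)
    then have "(D \<longlongrightarrow> D x) (at x)" by (simp add: isCont_def)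
    moreover have "eventually (\<lambda>y. D y = 0) (at x)"
    proof -
      have "eventually (\<lambda>y. y \<in> A) (at x)" by (rule eventually_at_in_open'[OF oA]) (use x in \<open>simp add: A_def\<close>)
      moreover have "eventually (\<lambda>y. y \<noteq> p) (at x)"
        by (cases "x = p") (auto simp: eventually_neq_at_within intro: eventually_at_filter[THEN iffD2])
      ultimately show ?thesis by eventually_elim (rule off)
    qed
    then have "(D \<longlongrightarrow> 0) (at x)" by (rule tendsto_eventually)
    ultimately have "D x = 0" by (metis LIM_unique)
    then show ?thesis by (simp add: D_def)
  qed
  show ?thesis
  proof (rule that[OF T(2)])
    assume "n > 0"
    then obtain m where m: "n = Suc m" by (cases n) auto
    show "glued (n - 1) T S" unfolding glued_def
    proof (intro conjI allI impI)
      fix j and x :: complex assume x: "r1 < norm x" "norm x < r2"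
      then have "x \<noteq> 0" using r by auto
      then show "T False x * G False j x + T True x * G True j x = x ^ (n - 1) * S j (1/x)"
        using TS[OF x, of j] by (simp add: m)
    qed (use T S in auto)
  next
    assume "n = 0"
    then show "glued 0 T (\<lambda>i u. u * S i u)" unfolding glued_def
      using T S TS by (auto intro!: holomorphic_intros)
  qed
qed

lemma glued_divide_infinity:
  assumes g: "glued n t s" and n: "n > 0" and p: "\<And>i. s i 0 = 0"
  obtains S where "glued (n - 1) t S"
proof -
  note D = gluedD[OF g]
  have "\<exists>S. S holomorphic_on ball 0 (1/r1) \<and> (\<forall>u\<in>ball 0 (1/r1). s i u = (u - 0) * S u)" for i
    by (rule holomorphic_divide_root[of "s i" "ball 0 (1/r1)" 0]) (use D p in auto)
  then obtain S where S: "\<And>i. S i holomorphic_on ball 0 (1/r1)" "\<And>i u. u \<in> ball 0 (1/r1) \<Longrightarrow> s i u = u * S i u"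
    by (metis diff_zero)
  obtain m where m: "n = Suc m" using n by (cases n) auto
  have "glued (n - 1) t S" unfolding glued_def
  proof (intro conjI allI impI)
    fix j and x :: complex assume x: "r1 < norm x" "norm x < r2"
    then have "x \<noteq> 0" using r by auto
    moreover have "norm (1/x) < 1/r1" using x r by (auto simp: norm_divide intro!: divide_strict_left_mono mult_pos_pos)
    ultimately show "t False x * G False j x + t True x * G True j x = x ^ (n - 1) * S j (1/x)"
      using D(3)[OF x, of j] S(2)[of "1/x" j] by (simp add: m)
  qed (use D S in auto)
  then show ?thesis by (rule that)
qed

lemma wedge_glued:
  assumes "glued n t s" "glued n' t' s'" "r1 < norm x" "norm x < r2"
  shows "wedge t t' x = x^(n+n') * wedge s s' (1/x)"
proof -
  have "wedge t t' x = wedge t t' x * (G False False x * G True True x - G False True x * G True False x)"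
    using Gdet assms by simp
  also have "\<dots> = (t False x * G False False x + t True x * G True False x) * (t' False x * G False True x + t' True x * G True True x)
     - (t False x * G False True x + t True x * G True True x) * (t' False x * G False False x + t' True x * G True False x)"
    by (simp add: wedge_def algebra_simps)
  also have "\<dots> = x^(n+n') * wedge s s' (1/x)"
    using gluedD(3)[OF assms(1,3,4)] gluedD(3)[OF assms(2,3,4)]
    by (simp add: wedge_def power_add algebra_simps)
  finally show ?thesis .
qed

text \<open>Induction on the total pole order. Where the wedge vanishes, some combination of the two
  sections vanishes too; divided by that zero and put in place of one of them, it lowers the order
  by one and keeps the pair independent. Without zeros, 1 / wedge would be holomorphic on the whole
  sphere and 0 at infinity. \<open>no_neg\<close> prevents a division that would lead below order
  0.\<close>

lemma glued_basis_aux: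
  assumes no_neg: "\<And>t s. glued 0 t s \<Longrightarrow> (\<And>i. s i 0 = 0) \<Longrightarrow> (\<And>i x. x \<in> ball 0 r2 \<Longrightarrow> t i x = 0)"
    and "glued n t s" "glued n' t' s'" "x \<in> ball 0 r2" "wedge t t' x \<noteq> 0"
  shows "\<exists>t s t' s' x. glued 0 t s \<and> glued 0 t' s' \<and> x \<in> ball 0 r2 \<and> wedge t t' x \<noteq> 0"
  using assms(2-)
proof (induction "n + n'" arbitrary: n n' t s t' s' x rule: less_induct)
  case less
  show ?case
  proof (cases "n + n' = 0")
    case True
    then show ?thesis using less.prems by auto
  next
    case False
    \<comment> \<open>By symmetry the first section may have the smaller order; the induction
      hypothesis travels along as \<open>IH\<close> so that the swapped pair can use the same
      argument.\<close>
    have main: ?thesis if nn: "n \<le> n'" "n + n' \<noteq> 0" and g: "glued n t s" and g': "glued n' t' s'"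
       and x: "x \<in> ball 0 r2" "wedge t t' x \<noteq> 0"
       and IH: "\<And>m m' t s t' s' x. m + m' < n + n' \<Longrightarrow> glued m t s \<Longrightarrow> glued m' t' s' \<Longrightarrow> x \<in> ball 0 r2 \<Longrightarrow> wedge t t' x \<noteq> 0
          \<Longrightarrow> \<exists>t s t' s' x. glued 0 t s \<and> glued 0 t' s' \<and> x \<in> ball 0 r2 \<and> wedge t t' x \<noteq> 0"
       for n n' t s t' s' x
    proof -
      note D = gluedD[OF g] and D' = gluedD[OF g']
      have n': "n' > 0" using nn by auto
      have div_t: ?thesis if p: "\<And>i. p \<in> ball 0 r2 \<Longrightarrow> t i p = 0" "\<And>i. r1 < norm p \<Longrightarrow> s i (1/p) = 0" for p
      proof -
        obtain T S where TS: "\<And>i x. x \<in> ball 0 r2 \<Longrightarrow> t i x = (x - p) * T i x"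
          "n > 0 \<Longrightarrow> glued (n - 1) T S" "n = 0 \<Longrightarrow> glued 0 T (\<lambda>i u. u * S i u)"
          using glued_divide[OF g p] by metis
        have w: "wedge t t' x = (x - p) * wedge T t' x" unfolding wedge_def TS(1)[OF x(1)] by (simp add: algebra_simps)
        have "n \<noteq> 0"
        proof
          assume "n = 0"
          then have "T i x = 0" for i using no_neg[OF TS(3)] x(1) by auto
          then show False using w x(2) by (simp add: wedge_def)
        qed
        then have n: "n > 0" by simp
        have w': "wedge T t' x \<noteq> 0" using w x(2) by auto
        show ?thesis by (rule IH[OF _ TS(2)[OF n] g' x(1) w']) (use n in simp)
      qed
      \<comment> \<open>For \<open>c' \<noteq> 0\<close> the combination replaces the second
        section, whose order it does not exceed before the division. For \<open>c' = 0\<close> the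
        first section itself has the zero.\<close>
      have div: ?thesis if cc: "(c, c') \<noteq> (0, 0)"
         and p: "\<And>i. p \<in> ball 0 r2 \<Longrightarrow> c * t i p + c' * t' i p = 0"
            "\<And>i. r1 < norm p \<Longrightarrow> c * (1/p)^(n'-n) * s i (1/p) + c' * s' i (1/p) = 0" for c c' p
      proof (cases "c' = 0")
        case True
        show ?thesis
        proof (rule div_t[of p])
          show "p \<in> ball 0 r2 \<Longrightarrow> t i p = 0" for i using p(1)[of i] cc True by auto
          show "r1 < norm p \<Longrightarrow> s i (1/p) = 0" for i using p(2)[of i] cc True r by auto
        qed
      next
        case False
        obtain T S where TS: "\<And>i x. x \<in> ball 0 r2 \<Longrightarrow> c * t i x + c' * t' i x = (x - p) * T i x" "glued (n' - 1) T S"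
          using glued_divide[OF glued_combine(1)[OF g g' nn(1), of c c'] p] n' by metis
        have "c' * wedge t t' x = t False x * (c * t True x + c' * t' True x) - t True x * (c * t False x + c' * t' False x)"
          by (simp add: wedge_def algebra_simps)
        also have "\<dots> = (x - p) * wedge t T x" unfolding wedge_def TS(1)[OF x(1)] by (simp add: algebra_simps)
        finally have "wedge t T x \<noteq> 0" using False x(2) by auto
        then show ?thesis by (rule IH[OF _ g TS(2) x(1), rotated]) (use n' in simp)
      qed
      \<comment> \<open>A zero of the wedge on the sphere lies in the disc around 0, at a finite
        point outside it, or at infinity.\<close>
      consider (fin) p where "p \<in> ball 0 r2" "wedge t t' p = 0"
        | (far) p where "p \<notin> ball 0 r2" "wedge s s' (1/p) = 0"
        | (infinity) "wedge s s' 0 = 0"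
        | (none) "\<And>x. x \<in> ball 0 r2 \<Longrightarrow> wedge t t' x \<noteq> 0" "\<And>u. u \<in> ball 0 (1/r1) \<Longrightarrow> wedge s s' u \<noteq> 0"
      proof -
        have "\<exists>p. (p \<in> ball 0 r2 \<and> wedge t t' p = 0) \<or> (p \<notin> ball 0 r2 \<and> wedge s s' (1/p) = 0)"
          if u: "u \<in> ball 0 (1/r1)" "wedge s s' u = 0" "u \<noteq> 0" for u
        proof (cases "1/u \<in> ball 0 r2")
          case True
          have "r1 < norm (1/u)" using u r by (auto simp: norm_divide field_simps)
          then have "wedge t t' (1/u) = 0" using wedge_glued[OF g g', of "1/u"] True u by simp
          then show ?thesis using True by blast
        next
          case False
          then show ?thesis using u by (intro exI[of _ "1/u"]) auto
        qed
        then show ?thesis using that by metis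
      qed
      then show ?thesis
      proof cases
        case fin
        obtain c c' where cc: "(c, c') \<noteq> (0, 0)" "c * t False p + c' * t' False p = 0" "c * t True p + c' * t' True p = 0"
          using linear_relation[of "t False p" "t' True p" "t True p" "t' False p"] fin(2) unfolding wedge_def by metis
        have tp: "c * t i p + c' * t' i p = 0" for i using cc by (cases i) auto
        show ?thesis
        proof (rule div[OF cc(1) tp])
          fix i assume p: "r1 < norm p"
          have "p^n' * (c * (1/p)^(n'-n) * s i (1/p) + c' * s' i (1/p)) =
             (c * t False p + c' * t' False p) * G False i p + (c * t True p + c' * t' True p) * G True i p"
            using gluedD(3)[OF glued_combine(1)[OF g g' nn(1), of c c'] p, of i] fin(1) by simp
          then show "c * (1/p)^(n'-n) * s i (1/p) + c' * s' i (1/p) = 0" using tp p r by auto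
        qed
      next
        case far
        then have p0: "p \<noteq> 0" using r by auto
        obtain e e' where ee: "(e, e') \<noteq> (0, 0)" "e * s False (1/p) + e' * s' False (1/p) = 0" "e * s True (1/p) + e' * s' True (1/p) = 0"
          using linear_relation[of "s False (1/p)" "s' True (1/p)" "s True (1/p)" "s' False (1/p)"] far(2) unfolding wedge_def by metis
        have sp: "e * s i (1/p) + e' * s' i (1/p) = 0" for i using ee by (cases i) auto
        \<comment> \<open>The power of \<open>p\<close> undoes the factor
          \<open>(1/p)^(n'-n)\<close> with which the first section enters a combination near
          infinity.\<close>
        show ?thesis
          by (rule div[of "e * p^(n'-n)" e' p]) (use ee(1) sp p0 far(1) in \<open>auto simp: power_one_over\<close>)
      next
        case infinity
        obtain e e' where ee: "(e, e') \<noteq> (0, 0)" "e * s False 0 + e' * s' False 0 = 0" "e * s True 0 + e' * s' True 0 = 0"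
          using linear_relation[of "s False 0" "s' True 0" "s True 0" "s' False 0"] infinity unfolding wedge_def by metis
        have sp: "e * s i 0 + e' * s' i 0 = 0" for i using ee by (cases i) auto
        show ?thesis
        proof (cases "e' = 0")
          case True
          then have s0: "s i 0 = 0" for i using sp[of i] ee(1) by auto
          have "n > 0"
          proof (rule ccontr)
            assume "\<not> n > 0"
            then have "t i x = 0" for i using no_neg[of t s] g s0 x(1) by auto
            then show False using x(2) by (simp add: wedge_def)
          qed
          obtain S where "glued (n - 1) t S" using glued_divide_infinity[OF g \<open>n > 0\<close> s0] by blast
          show ?thesis by (rule IH[OF _ \<open>glued (n - 1) t S\<close> g' x]) (use \<open>n > 0\<close> in simp)
        next
          case False
          obtain S where S: "glued (n' - 1) (\<lambda>i x. e * x^(n'-n) * t i x + e' * t' i x) S"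
            using glued_divide_infinity[OF glued_combine(2)[OF g g' nn(1), of e e'] n' sp] by blast
          have "wedge t (\<lambda>i x. e * x^(n'-n) * t i x + e' * t' i x) x = e' * wedge t t' x"
            by (simp add: wedge_def algebra_simps)
          then have "wedge t (\<lambda>i x. e * x^(n'-n) * t i x + e' * t' i x) x \<noteq> 0" using False x(2) by simp
          then show ?thesis by (rule IH[OF _ g S x(1), rotated]) (use n' in simp)
        qed
      next
        case none
        have "wedge t t' holomorphic_on ball 0 r2" unfolding wedge_def by (intro holomorphic_intros D D')
        then have 1: "(\<lambda>x. 1 / wedge t t' x) holomorphic_on ball 0 r2" by (intro holomorphic_intros) (use none in auto)
        have "wedge s s' holomorphic_on ball 0 (1/r1)" unfolding wedge_def by (intro holomorphic_intros D D')
        then have 2: "(\<lambda>u. u^(n+n') / wedge s s' u) holomorphic_on ball 0 (1/r1)" by (intro holomorphic_intros) (use none in auto)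
        \<comment> \<open>The total order is positive, so \<open>0^(n+n')\<close> is 0 and the
          reciprocal of the wedge would vanish.\<close>
        have "1 / wedge t t' x = 0^(n+n') / wedge s s' 0"
        proof (rule glued_constant(1)[OF 1 2 _ x(1)])
          fix x :: complex assume "r1 < norm x" "norm x < r2"
          then show "1 / wedge t t' x = (1/x)^(n+n') / wedge s s' (1/x)"
            using wedge_glued[OF g g', of x] r by (simp add: power_one_over)
        qed
        then show ?thesis using nn x(2) by (auto simp: zero_power)
      qed
    qed
    show ?thesis
    proof (cases "n \<le> n'")
      case True
      show ?thesis by (rule main[OF True False less.prems(1-4)]) (rule less.hyps, assumption+)
    next
      case ge: False
      have w: "wedge t' t x \<noteq> 0" using less.prems(4) by (auto simp: wedge_def algebra_simps)
      show ?thesis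
      proof (rule main[OF _ _ less.prems(2,1,3) w])
        fix m m' t s t' s' x assume *: "m + m' < n' + n" "glued m t s" "glued m' t' s'" "x \<in> ball 0 r2" "wedge t t' x \<noteq> 0"
        show "\<exists>t s t' s' x. glued 0 t s \<and> glued 0 t' s' \<and> x \<in> ball 0 r2 \<and> wedge t t' x \<noteq> 0"
          by (rule less.hyps[OF _ *(2-)]) (use *(1) in simp)
      qed (use ge False in auto)
    qed
  qed
qed

end

subsection \<open>From the Floquet matrix to a gauge transformation\<close>

lemma zero_of_infinite_order:
  assumes f: "f holomorphic_on ball 0 R" and g: "\<And>k. g k holomorphic_on ball 0 R"
    and fg: "\<And>k x. x \<in> ball 0 R \<Longrightarrow> f x = x ^ k * g k x" and x: "x \<in> ball (0::complex) R"
  shows "f x = 0"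
proof -
  define s where "s = (norm x + R) / 2"
  have s: "norm x < s" "s < R" using x by (auto simp: s_def)
  then have s0: "0 < s" using norm_ge_zero[of x] by linarith
  have sub: "sphere 0 s \<subseteq> ball (0::complex) R" using s by auto
  have "compact (f ` sphere 0 s)"
    by (rule compact_continuous_image[OF holomorphic_on_imp_continuous_on[OF holomorphic_on_subset[OF f sub]]]) simp
  then have "bounded (f ` sphere 0 s)" by (rule compact_imp_bounded)
  then obtain M where M: "\<And>y. norm y = s \<Longrightarrow> norm (f y) \<le> M" unfolding bounded_iff by (auto simp: sphere_def)
  \<comment> \<open>The maximum principle on the circle of radius \<open>s\<close> bounds
    \<open>g k\<close> by means of \<open>f\<close> alone.\<close>
  have le: "norm (f x) \<le> M * (norm x / s) ^ k" for k
  proof -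
    have "norm (g k x) \<le> M / s ^ k"
    proof (rule maximum_modulus_disc[OF g s0 s(2)])
      fix y :: complex assume y: "norm y = s"
      then have "norm (f y) = s ^ k * norm (g k y)" using fg[of y k] s by (simp add: norm_mult norm_power)
      then show "norm (g k y) \<le> M / s ^ k" using M[OF y] s0 by (simp add: field_simps)
    qed (use s in auto)
    then have "norm x ^ k * norm (g k x) \<le> norm x ^ k * (M / s ^ k)" by (intro mult_left_mono) auto
    then show ?thesis using fg[OF x, of k] by (simp add: norm_mult norm_power power_divide mult_ac)
  qed
  have "(\<lambda>k. M * (norm x / s) ^ k) \<longlonglongrightarrow> M * 0"
    by (intro tendsto_intros LIMSEQ_realpow_zero) (use s s0 in auto)
  then have "norm (f x) \<le> 0" using LIMSEQ_le_const[of _ 0 "norm (f x)"] le by simp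
  then show ?thesis by simp
qed

lemma continuous_eq_at_0:
  assumes "F holomorphic_on ball 0 R" "H holomorphic_on ball 0 R" "0 < R" "\<And>x. x \<in> ball 0 R \<Longrightarrow> x \<noteq> 0 \<Longrightarrow> F x = H x"
    "x \<in> ball (0::complex) R"
  shows "F x = H x"
proof (cases "x = 0")
  case True
  have c: "isCont F 0" "isCont H 0"
    using assms(1-3) holomorphic_on_imp_continuous_on continuous_on_interior by (metis centre_in_ball interior_ball)+
  have "eventually (\<lambda>x::complex. x \<in> ball 0 R - {0}) (at 0)" by (rule eventually_at_in_open) (use assms in auto)
  then have "eventually (\<lambda>x. F x = H x) (at 0)" by eventually_elim (use assms in auto)
  moreover have "(F \<longlongrightarrow> F 0) (at 0)" "(H \<longlongrightarrow> H 0) (at 0)" using c by (auto simp: isCont_def)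
  ultimately have "(H \<longlongrightarrow> F 0) (at 0)" by (metis (mono_tags, lifting) Lim_transform_eventually)
  then show ?thesis using True LIM_unique[OF _ \<open>(H \<longlongrightarrow> H 0) (at 0)\<close>] by blast
qed (use assms in auto)

text \<open>The equation says that the line spanned by the row \<open>(al, be)\<close> is invariant under the system. Both entries vanish
  at 0, and dividing them by \<open>x\<close> reproduces the equation.\<close>
lemma no_invariant_line_step:
  fixes A :: complex
  assumes A: "A \<noteq> 0" and R: "0 < R" and b: "b holomorphic_on ball 0 R"
    and h: "al holomorphic_on ball 0 R" "be holomorphic_on ball 0 R"
    and eq: "\<And>x. x \<in> ball 0 R \<Longrightarrow> x * ((al x)\<^sup>2 + al x * (x * deriv be x) - be x * (x * deriv al x)) = (be x)\<^sup>2 * (A + x * b x)"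
  obtains al1 be1 where "al1 holomorphic_on ball 0 R" "be1 holomorphic_on ball 0 R"
    "\<And>x. x \<in> ball 0 R \<Longrightarrow> al x = x * al1 x" "\<And>x. x \<in> ball 0 R \<Longrightarrow> be x = x * be1 x"
    "\<And>x. x \<in> ball 0 R \<Longrightarrow> x * ((al1 x)\<^sup>2 + al1 x * (x * deriv be1 x) - be1 x * (x * deriv al1 x)) = (be1 x)\<^sup>2 * (A + x * b x)"
proof -
  \<comment> \<open>At \<open>x = 0\<close> only \<open>A * (be 0)^2\<close> survives, and
    \<open>A \<noteq> 0\<close>. Then the right side is divisible by \<open>x^2\<close>, and
    cancelling one \<open>x\<close> exposes \<open>(al 0)^2 = 0\<close>.\<close>
  have b0: "be 0 = 0" using eq[of 0] R A by simp
  obtain be1 where be1: "be1 holomorphic_on ball 0 R" "\<And>x. x \<in> ball 0 R \<Longrightarrow> be x = x * be1 x"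
    using holomorphic_divide_root[OF h(2) open_ball, of 0] b0 by (metis diff_zero)
  have "(al x)\<^sup>2 + al x * (x * deriv be x) - be x * (x * deriv al x) = x * (be1 x)\<^sup>2 * (A + x * b x)" if x: "x \<in> ball 0 R" for x
  proof (rule continuous_eq_at_0[OF _ _ R _ x])
    show "(\<lambda>x. (al x)\<^sup>2 + al x * (x * deriv be x) - be x * (x * deriv al x)) holomorphic_on ball 0 R"
      using h by (intro holomorphic_intros) auto
    show "(\<lambda>x. x * (be1 x)\<^sup>2 * (A + x * b x)) holomorphic_on ball 0 R" using be1 b by (intro holomorphic_intros)
    fix x :: complex assume x: "x \<in> ball 0 R" "x \<noteq> 0"
    have "x * ((al x)\<^sup>2 + al x * (x * deriv be x) - be x * (x * deriv al x)) = x * (x * (be1 x)\<^sup>2 * (A + x * b x))"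
      unfolding eq[OF x(1)] using be1(2)[OF x(1)] by (simp add: power2_eq_square)
    then show "(al x)\<^sup>2 + al x * (x * deriv be x) - be x * (x * deriv al x) = x * (be1 x)\<^sup>2 * (A + x * b x)" using x by simp
  qed
  from this[of 0] have a0: "al 0 = 0" using R by simp
  obtain al1 where al1: "al1 holomorphic_on ball 0 R" "\<And>x. x \<in> ball 0 R \<Longrightarrow> al x = x * al1 x"
    using holomorphic_divide_root[OF h(1) open_ball, of 0] a0 by (metis diff_zero)
  have d: "deriv f x = f1 x + x * deriv f1 x" if "f1 holomorphic_on ball 0 R" "\<And>x. x \<in> ball 0 R \<Longrightarrow> f x = x * f1 x" "x \<in> ball 0 R"
    for f f1 x
  proof -
    have "((\<lambda>x. x * f1 x) has_field_derivative (1 * f1 x + deriv f1 x * x)) (at x)"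
      by (rule DERIV_mult[OF DERIV_ident holomorphic_derivI[OF that(1) open_ball that(3)]])
    then have "(f has_field_derivative (1 * f1 x + deriv f1 x * x)) (at x)"
      by (rule has_field_derivative_transform_within_open[OF _ open_ball that(3)]) (use that in auto)
    then show ?thesis by (simp add: DERIV_imp_deriv mult.commute)
  qed
  show ?thesis
  proof (rule that[OF al1(1) be1(1) al1(2) be1(2)])
    fix x :: complex assume x: "x \<in> ball 0 R"
    show "x * ((al1 x)\<^sup>2 + al1 x * (x * deriv be1 x) - be1 x * (x * deriv al1 x)) = (be1 x)\<^sup>2 * (A + x * b x)"
    proof (rule continuous_eq_at_0[OF _ _ R _ x])
      show "(\<lambda>x. x * ((al1 x)\<^sup>2 + al1 x * (x * deriv be1 x) - be1 x * (x * deriv al1 x))) holomorphic_on ball 0 R"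
        using al1 be1 by (intro holomorphic_intros) auto
      show "(\<lambda>x. (be1 x)\<^sup>2 * (A + x * b x)) holomorphic_on ball 0 R" using be1 b by (intro holomorphic_intros)
      fix x :: complex assume x: "x \<in> ball 0 R" "x \<noteq> 0"
      have da: "deriv al x = al1 x + x * deriv al1 x" by (rule d[OF al1 x(1)])
      have db: "deriv be x = be1 x + x * deriv be1 x" by (rule d[OF be1 x(1)])
      have "x\<^sup>2 * (x * ((al1 x)\<^sup>2 + al1 x * (x * deriv be1 x) - be1 x * (x * deriv al1 x))) = x\<^sup>2 * ((be1 x)\<^sup>2 * (A + x * b x))"
        using eq[OF x(1)] unfolding da db al1(2)[OF x(1)] be1(2)[OF x(1)]
        by (simp add: algebra_simps power2_eq_square)
      then show "x * ((al1 x)\<^sup>2 + al1 x * (x * deriv be1 x) - be1 x * (x * deriv al1 x)) = (be1 x)\<^sup>2 * (A + x * b x)"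
        using x by simp
    qed
  qed
qed

text \<open>An invariant line would be a first-order factor of the operator, which the pole
  \<open>A/x\<close> of slope 1/2 forbids. Concretely, the descent step repeats for ever, so both
  entries are divisible by every power of \<open>x\<close>.\<close>

lemma no_invariant_line:
  fixes A :: complex
  assumes A: "A \<noteq> 0" and R: "0 < R" and b: "b holomorphic_on ball 0 R"
    and h: "al holomorphic_on ball 0 R" "be holomorphic_on ball 0 R"
    and eq: "\<And>x. x \<in> ball 0 R \<Longrightarrow> x * ((al x)\<^sup>2 + al x * (x * deriv be x) - be x * (x * deriv al x)) = (be x)\<^sup>2 * (A + x * b x)"
    and x: "x \<in> ball 0 R"
  shows "al x = 0" "be x = 0"
proof -
  have "\<exists>a1 b1. a1 holomorphic_on ball 0 R \<and> b1 holomorphic_on ball 0 R \<and>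
    (\<forall>x\<in>ball 0 R. al x = x^k * a1 x) \<and> (\<forall>x\<in>ball 0 R. be x = x^k * b1 x) \<and>
    (\<forall>x\<in>ball 0 R. x * ((a1 x)\<^sup>2 + a1 x * (x * deriv b1 x) - b1 x * (x * deriv a1 x)) = (b1 x)\<^sup>2 * (A + x * b x))" for k
  proof (induction k)
    case 0
    then show ?case using h eq by (intro exI[of _ al] exI[of _ be]) auto
  next
    case (Suc k)
    then obtain a1 b1 where ab: "a1 holomorphic_on ball 0 R" "b1 holomorphic_on ball 0 R"
      "\<And>x. x\<in>ball 0 R \<Longrightarrow> al x = x^k * a1 x" "\<And>x. x\<in>ball 0 R \<Longrightarrow> be x = x^k * b1 x"
      "\<And>x. x\<in>ball 0 R \<Longrightarrow> x * ((a1 x)\<^sup>2 + a1 x * (x * deriv b1 x) - b1 x * (x * deriv a1 x)) = (b1 x)\<^sup>2 * (A + x * b x)"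
      by blast
    obtain a2 b2 where "a2 holomorphic_on ball 0 R" "b2 holomorphic_on ball 0 R"
      "\<And>x. x \<in> ball 0 R \<Longrightarrow> a1 x = x * a2 x" "\<And>x. x \<in> ball 0 R \<Longrightarrow> b1 x = x * b2 x"
      "\<And>x. x \<in> ball 0 R \<Longrightarrow> x * ((a2 x)\<^sup>2 + a2 x * (x * deriv b2 x) - b2 x * (x * deriv a2 x)) = (b2 x)\<^sup>2 * (A + x * b x)"
      by (rule no_invariant_line_step[OF A R b ab(1,2,5)]) auto
    then show ?case using ab(3,4) by (intro exI[of _ a2] exI[of _ b2]) (auto simp: mult_ac)
  qed
  then obtain a1 b1 where ab: "\<And>k. a1 k holomorphic_on ball 0 R" "\<And>k. b1 k holomorphic_on ball 0 R"
    "\<And>k x. x\<in>ball 0 R \<Longrightarrow> al x = x^k * a1 k x" "\<And>k x. x\<in>ball 0 R \<Longrightarrow> be x = x^k * b1 k x" by metis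
  show "al x = 0" by (rule zero_of_infinite_order[OF h(1) ab(1,3) x])
  show "be x = 0" by (rule zero_of_infinite_order[OF h(2) ab(2,4) x])
qed

text \<open>The four equations say \<theta> G = M G - G L, where M has the rows (0, 1), (Q, 0) and L
  the rows (a, k / x^j), (0, - a). Thus \<open>G\<close> carries the given equation to a connection
  L that is holomorphic at infinity.\<close>

locale floquet_cocycle = cocycle r1 r2 G for r1 r2 G +
  fixes a k A :: complex and j :: nat and b Q :: "complex \<Rightarrow> complex"
  assumes dG: "\<And>x. r1 < norm x \<Longrightarrow> norm x < r2 \<Longrightarrow> (G False False has_field_derivative (G True False x - a * G False False x) / x) (at x)"
    "\<And>x. r1 < norm x \<Longrightarrow> norm x < r2 \<Longrightarrow> (G True False has_field_derivative (Q x * G False False x - a * G True False x) / x) (at x)"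
    "\<And>x. r1 < norm x \<Longrightarrow> norm x < r2 \<Longrightarrow> (G False True has_field_derivative (G True True x - k * (1/x)^j * G False False x + a * G False True x) / x) (at x)"
    "\<And>x. r1 < norm x \<Longrightarrow> norm x < r2 \<Longrightarrow> (G True True has_field_derivative (Q x * G False True x - k * (1/x)^j * G True False x + a * G True True x) / x) (at x)"
    and A: "A \<noteq> 0" and b: "b holomorphic_on ball 0 r2"
    and Q: "\<And>x. x \<in> ball 0 r2 - {0} \<Longrightarrow> Q x = A / x + b x"
begin

lemma r2: "0 < r2" using r by simp

text \<open>The derivative \<theta> s + s L of a row vector near infinity, where \<theta> = - u d/du
  and the off-diagonal entry of L is \<open>k * u^j\<close>.\<close>

definition next_s :: "(bool \<Rightarrow> complex \<Rightarrow> complex) \<Rightarrow> bool \<Rightarrow> complex \<Rightarrow> complex" where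
  "next_s s i u = (if i then - u * deriv (s True) u + k * u^j * s False u - a * s True u
                   else - u * deriv (s False) u + a * s False u)"

lemma next_s_holomorphic: "(\<And>i. s i holomorphic_on ball 0 (1/r1)) \<Longrightarrow> next_s s i holomorphic_on ball 0 (1/r1)"
  unfolding next_s_def by (cases i) (auto intro!: holomorphic_intros)

lemma inverse_in_ball: "r1 < norm x \<Longrightarrow> 1/x \<in> ball 0 (1/r1)" for x :: complex
  using r by (auto simp: norm_divide intro!: divide_strict_left_mono mult_pos_pos)

text \<open>Differentiating the gluing relation of a row (p, q) produces \<theta> (p, q) + (p, q) M
  on the left, as the term - G L of \<theta> G passes to the other side. It is applied to a section
  and then once more to its derivative.\<close>

lemma differentiate_glued:
  assumes s: "\<And>i. s i holomorphic_on ball 0 (1/r1)"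
    and eq: "\<And>i x. r1 < norm x \<Longrightarrow> norm x < r2 \<Longrightarrow> p x * G False i x + q x * G True i x = s i (1/x)"
    and x: "r1 < norm x" "norm x < r2"
    and d: "(p has_field_derivative p') (at x)" "(q has_field_derivative q') (at x)"
  shows "(x * p' + q x * Q x) * G False i x + (p x + x * q') * G True i x = next_s s i (1/x)"
proof -
  have x0: "x \<noteq> 0" using x r by auto
  have oA: "open {x::complex. r1 < norm x \<and> norm x < r2}" by (intro open_Collect_conj open_Collect_less continuous_intros)
  have ds: "((\<lambda>x. s i (1/x)) has_field_derivative deriv (s i) (1/x) * (- 1 / x\<^sup>2)) (at x)" for i
  proof (rule DERIV_chain2[where f="s i"])
    show "(s i has_field_derivative deriv (s i) (1/x)) (at (1/x))"
      by (rule holomorphic_derivI[OF s open_ball inverse_in_ball[OF x(1)]])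
    show "((\<lambda>x. 1/x) has_field_derivative - 1 / x\<^sup>2) (at x)"
      using x0 by (auto intro!: derivative_eq_intros simp: power2_eq_square)
  qed
  have L: "x * ((p' * G False i x + g1 * p x) + (q' * G True i x + g2 * q x)) = - (1/x) * deriv (s i) (1/x)"
    if "(G False i has_field_derivative g1) (at x)" "(G True i has_field_derivative g2) (at x)" for i g1 g2
  proof -
    have "((\<lambda>x. p x * G False i x + q x * G True i x) has_field_derivative (p' * G False i x + g1 * p x) + (q' * G True i x + g2 * q x)) (at x)"
      by (intro DERIV_add DERIV_mult d that)
    then have "((\<lambda>x. s i (1/x)) has_field_derivative (p' * G False i x + g1 * p x) + (q' * G True i x + g2 * q x)) (at x)"
      by (rule has_field_derivative_transform_within_open[OF _ oA]) (use eq x in auto)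
    then have "(p' * G False i x + g1 * p x) + (q' * G True i x + g2 * q x) = deriv (s i) (1/x) * (- 1 / x\<^sup>2)"
      using ds by (rule DERIV_unique)
    then show ?thesis using x0 by (simp add: power2_eq_square)
  qed
  show ?thesis
  proof (cases i)
    case False
    have "x * (p' * G False False x + (G True False x - a * G False False x) / x * p x + (q' * G True False x + (Q x * G False False x - a * G True False x) / x * q x))
       = (x * p' + q x * Q x) * G False False x + (p x + x * q') * G True False x - a * (p x * G False False x + q x * G True False x)"
      using x0 by (simp add: field_simps)
    then have "(x * p' + q x * Q x) * G False False x + (p x + x * q') * G True False x - a * s False (1/x) = - (1/x) * deriv (s False) (1/x)"
      unfolding L[OF dG(1,2)[OF x]] eq[OF x] by simp
    then show ?thesis using False unfolding diff_eq_eq by (simp add: next_s_def)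
  next
    case True
    have "x * (p' * G False True x + (G True True x - k * (1/x)^j * G False False x + a * G False True x) / x * p x + (q' * G True True x + (Q x * G False True x - k * (1/x)^j * G True False x + a * G True True x) / x * q x))
       = (x * p' + q x * Q x) * G False True x + (p x + x * q') * G True True x - k * (1/x)^j * (p x * G False False x + q x * G True False x) + a * (p x * G False True x + q x * G True True x)"
      using x0 by (simp add: field_simps)
    then have "(x * p' + q x * Q x) * G False True x + (p x + x * q') * G True True x - k * (1/x)^j * s False (1/x) + a * s True (1/x) = - (1/x) * deriv (s True) (1/x)"
      unfolding L[OF dG(3,4)[OF x]] eq[OF x] by simp
    then have "(x * p' + q x * Q x) * G False True x + (p x + x * q') * G True True x = - (1/x) * deriv (s True) (1/x) - a * s True (1/x) + k * (1/x)^j * s False (1/x)"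
      by (metis (no_types, lifting) add_diff_cancel_right' diff_eq_eq)
    then show ?thesis using True by (simp add: next_s_def)
  qed
qed

lemma det_transfer:
  assumes "r1 < norm x" "norm x < r2" "\<And>i. p * G False i x + q * G True i x = S i" "\<And>i. p' * G False i x + q' * G True i x = S' i"
  shows "p * q' - q * p' = S False * S' True - S True * S' False"
proof -
  have "p * q' - q * p' = (p * q' - q * p') * (G False False x * G True True x - G False True x * G True False x)"
    using Gdet assms by simp
  then show ?thesis unfolding assms(3,4)[symmetric] by (simp add: algebra_simps)
qed

lemma glued_derivative:
  assumes g: "glued 0 t s" and x: "r1 < norm x" "norm x < r2"
  shows "(x * deriv (t False) x + t True x * Q x) * G False i x + (t False x + x * deriv (t True) x) * G True i x = next_s s i (1/x)"
proof (rule differentiate_glued[OF gluedD(2)[OF g] _ x])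
  show "t False x * G False i x + t True x * G True i x = s i (1/x)" if "r1 < norm x" "norm x < r2" for i x
    using gluedD(3)[OF g that] by simp
  have "x \<in> ball 0 r2" using x by simp
  then show "(t False has_field_derivative deriv (t False) x) (at x)" "(t True has_field_derivative deriv (t True) x) (at x)"
    using holomorphic_derivI[OF gluedD(1)[OF g] open_ball] by blast+
qed

text \<open>The determinant of a section and its derivative becomes holomorphic at 0 after
  multiplication by \<open>x\<close>, since \<open>Q\<close> has a simple pole. At infinity both row
  vectors vanish, so the determinant vanishes to second order and still vanishes after the
  multiplication. By Liouville it is 0, that is, the section spans an invariant line.\<close>

lemma no_negative_degree:
  assumes g: "glued 0 t s" and s0: "\<And>i. s i 0 = 0" and x: "x \<in> ball 0 r2"
  shows "t i x = 0"
proof -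
  note D = gluedD[OF g]
  define al where "al = t False"
  define be where "be = t True"
  have h: "al holomorphic_on ball 0 r2" "be holomorphic_on ball 0 r2" using D by (auto simp: al_def be_def)
  define F where "F x = x * ((al x)\<^sup>2 + al x * (x * deriv be x) - be x * (x * deriv al x)) - (be x)\<^sup>2 * (A + x * b x)" for x
  have "\<exists>S. S holomorphic_on ball 0 (1/r1) \<and> (\<forall>u\<in>ball 0 (1/r1). s i u = (u - 0) * S u)" for i
    by (rule holomorphic_divide_root[of "s i" "ball 0 (1/r1)" 0]) (use D s0 in auto)
  then obtain S where S: "\<And>i. S i holomorphic_on ball 0 (1/r1)" "\<And>i u. u \<in> ball 0 (1/r1) \<Longrightarrow> s i u = u * S i u"
    by (metis diff_zero)
  have n0: "next_s s i 0 = 0" for i by (cases i) (auto simp: next_s_def s0)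
  have "\<exists>S. S holomorphic_on ball 0 (1/r1) \<and> (\<forall>u\<in>ball 0 (1/r1). next_s s i u = (u - 0) * S u)" for i
    by (rule holomorphic_divide_root[of "next_s s i" "ball 0 (1/r1)" 0]) (use next_s_holomorphic[OF D(2)] n0 in auto)
  then obtain S' where S': "\<And>i. S' i holomorphic_on ball 0 (1/r1)" "\<And>i u. u \<in> ball 0 (1/r1) \<Longrightarrow> next_s s i u = u * S' i u"
    by (metis diff_zero)
  have Fh: "F holomorphic_on ball 0 r2" unfolding F_def using h b by (intro holomorphic_intros) auto
  have Gh: "(\<lambda>u. u * (S False u * S' True u - S True u * S' False u)) holomorphic_on ball 0 (1/r1)"
    using S S' by (intro holomorphic_intros)
  have "F x = 0 * (S False 0 * S' True 0 - S True 0 * S' False 0)" if "x \<in> ball 0 r2" for x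
  proof (rule glued_constant(1)[OF Fh Gh _ that])
    fix x :: complex assume x: "r1 < norm x" "norm x < r2"
    then have x0: "x \<noteq> 0" using r by auto
    have "al x * (al x + x * deriv be x) - be x * (x * deriv al x + be x * Q x) = s False (1/x) * next_s s True (1/x) - s True (1/x) * next_s s False (1/x)"
    proof (rule det_transfer[OF x])
      show "al x * G False i x + be x * G True i x = s i (1/x)" for i using D(3)[OF x] by (simp add: al_def be_def)
      show "(x * deriv al x + be x * Q x) * G False i x + (al x + x * deriv be x) * G True i x = next_s s i (1/x)" for i
        using glued_derivative[OF g x] by (simp add: al_def be_def)
    qed
    also have "\<dots> = (1/x) * ((1/x) * (S False (1/x) * S' True (1/x) - S True (1/x) * S' False (1/x)))"
      unfolding S(2)[OF inverse_in_ball[OF x(1)]] S'(2)[OF inverse_in_ball[OF x(1)]] by (simp add: algebra_simps)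
    finally have "x * (al x * (al x + x * deriv be x) - be x * (x * deriv al x + be x * Q x)) = (1/x) * (S False (1/x) * S' True (1/x) - S True (1/x) * S' False (1/x))"
      using x0 by simp
    moreover have "F x = x * (al x * (al x + x * deriv be x) - be x * (x * deriv al x + be x * Q x))"
    proof -
      have "Q x = A / x + b x" using Q[of x] x x0 by simp
      then show ?thesis unfolding F_def \<open>Q x = A / x + b x\<close> using x0 by (simp add: field_simps power2_eq_square)
    qed
    ultimately show "F x = (1/x) * (S False (1/x) * S' True (1/x) - S True (1/x) * S' False (1/x))" by simp
  qed
  then have "x * ((al x)\<^sup>2 + al x * (x * deriv be x) - be x * (x * deriv al x)) = (be x)\<^sup>2 * (A + x * b x)" if "x \<in> ball 0 r2" for x
    using that by (simp add: F_def)
  then have "al x = 0" "be x = 0" using no_invariant_line[OF A r2 b h _ x] by blast+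
  then show ?thesis by (cases i) (auto simp: al_def be_def)
qed

text \<open>With \<open>\<gamma> = \<theta> al + be Q\<close> and \<open>\<delta> = al + \<theta> be\<close> for \<open>be = x B\<close>, the matrix with rows \<open>(al, be)\<close>, \<open>(\<gamma>, \<delta>)\<close> has determinant one
  and carries solutions \<open>(v, \<theta> v)\<close> to solutions of \<open>\<theta>\<^sup>2 y = (A/x + a\<^sup>2) y\<close>.\<close>
lemma gauge_transformation:
  assumes "glued n t s" "glued n t' s'" "y \<in> ball 0 r2" "wedge t t' y \<noteq> 0"
  obtains al B where "al holomorphic_on ball 0 r2" "B holomorphic_on ball 0 r2" "al 0 = 1"
    "\<And>x. x \<in> ball 0 r2 \<Longrightarrow> al x * (al x + x * (B x + x * deriv B x)) - x * B x * (x * deriv al x + B x * (A + x * b x)) = 1"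
    "\<And>x. x \<in> ball 0 r2 - {0} \<Longrightarrow>
       x * deriv (\<lambda>x. x * deriv al x + B x * (A + x * b x)) x + (al x + x * (B x + x * deriv B x)) * Q x = (A / x + a\<^sup>2) * al x"
    "\<And>x. x \<in> ball 0 r2 - {0} \<Longrightarrow>
       (x * deriv al x + B x * (A + x * b x)) + x * deriv (\<lambda>x. al x + x * (B x + x * deriv B x)) x = (A / x + a\<^sup>2) * (x * B x)"
proof -
  obtain t s t' s' y where g: "glued 0 t s" "glued 0 t' s'" and y: "y \<in> ball 0 r2" "wedge t t' y \<noteq> 0"
  proof -
    have "\<exists>t s t' s' x. glued 0 t s \<and> glued 0 t' s' \<and> x \<in> ball 0 r2 \<and> wedge t t' x \<noteq> 0"
      by (rule glued_basis_aux[OF _ assms]) (rule no_negative_degree)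
    then show ?thesis using that by blast
  qed
  \<comment> \<open>The freedom of a constant change of basis is spent on a section whose second
    entry vanishes at 0, so that \<open>be = x * B\<close> compensates the pole in
    \<open>be * Q\<close>.\<close>
  obtain c c' where cc: "(c, c') \<noteq> (0, 0)" "c * t True 0 + c' * t' True 0 = 0" "c * 0 + c' * 0 = (0::complex)"
    using linear_relation[of "t True 0" 0 0 "t' True 0"] by (metis mult_zero_left mult_zero_right diff_self)
  define T where "T i x = c * t i x + c' * t' i x" for i x
  define S where "S i u = c * u^(0-0) * s i u + c' * s' i u" for i u
  have gT: "glued 0 T S" unfolding T_def S_def by (rule glued_combine(1)[OF g order_refl])
  have Tnz: "\<exists>i. T i y \<noteq> 0"
  proof (rule ccontr)
    assume "\<not> ?thesis"
    then have z: "c * t i y + c' * t' i y = 0" for i by (auto simp: T_def)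
    have "c' * wedge t t' y = t False y * (c * t True y + c' * t' True y) - t True y * (c * t False y + c' * t' False y)"
      "c * wedge t t' y = t' True y * (c * t False y + c' * t' False y) - t' False y * (c * t True y + c' * t' True y)"
      by (auto simp: wedge_def algebra_simps)
    then show False using z cc(1) y(2) by auto
  qed
  have T0: "T True 0 = 0" using cc(2) by (simp add: T_def)
  \<comment> \<open>Otherwise the whole section would vanish at 0, and division by \<open>x\<close>
    would produce one that vanishes at infinity.\<close>
  have a0: "T False 0 \<noteq> 0"
  proof
    assume "T False 0 = 0"
    then have T00: "T i 0 = 0" for i using T0 by (cases i) auto
    have "\<And>i. r1 < norm (0::complex) \<Longrightarrow> S i (1/0) = 0" using r by simp
    then obtain T' S' where T': "\<And>i x. x \<in> ball 0 r2 \<Longrightarrow> T i x = (x - 0) * T' i x" "glued 0 T' (\<lambda>i u. u * S' i u)"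
      using glued_divide[OF gT T00] by metis
    have "T' i y = 0" for i by (rule no_negative_degree[OF T'(2) _ y(1)]) simp
    then show False using Tnz T'(1)[OF y(1)] by auto
  qed
  define U where "U i x = 1 / T False 0 * T i x + 0 * T i x" for i x
  define V where "V i u = 1 / T False 0 * u^(0-0) * S i u + 0 * S i u" for i u
  have gU: "glued 0 U V" unfolding U_def V_def by (rule glued_combine(1)[OF gT gT order_refl])
  note D = gluedD[OF gU]
  define al where "al = U False"
  have al0: "al 0 = 1" using a0 by (simp add: al_def U_def)
  have be0: "U True 0 = 0" using T0 by (simp add: U_def)
  obtain B where B: "B holomorphic_on ball 0 r2" "\<And>x. x \<in> ball 0 r2 \<Longrightarrow> U True x = (x - 0) * B x"
    by (rule holomorphic_divide_root[of "U True" "ball 0 r2" 0]) (use D be0 in auto)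
  have alh: "al holomorphic_on ball 0 r2" using D by (simp add: al_def)
  have dU: "deriv (U True) x = B x + x * deriv B x" if "x \<in> ball 0 r2" for x
  proof -
    have "((\<lambda>x. x * B x) has_field_derivative (1 * B x + deriv B x * x)) (at x)"
      by (rule DERIV_mult[OF DERIV_ident holomorphic_derivI[OF B(1) open_ball that]])
    then have "(U True has_field_derivative (1 * B x + deriv B x * x)) (at x)"
      by (rule has_field_derivative_transform_within_open[OF _ open_ball that]) (use B in auto)
    then show ?thesis by (simp add: DERIV_imp_deriv mult.commute)
  qed
  define ga where "ga = (\<lambda>x. x * deriv al x + B x * (A + x * b x))"
  define de where "de = (\<lambda>x. al x + x * (B x + x * deriv B x))"
  have gah: "ga holomorphic_on ball 0 r2" unfolding ga_def using alh B b by (intro holomorphic_intros) auto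
  have deh: "de holomorphic_on ball 0 r2" unfolding de_def using alh B b by (intro holomorphic_intros) auto
  have BQ: "x * B x * Q x = B x * (A + x * b x)" if "x \<in> ball 0 r2 - {0}" for x
    unfolding Q[OF that] using that by (simp add: field_simps)
  have e0: "al x * G False i x + (x * B x) * G True i x = V i (1/x)" if "r1 < norm x" "norm x < r2" for i x
    using D(3)[OF that, of i] B(2)[of x] that by (simp add: al_def)
  have e1: "ga x * G False i x + de x * G True i x = next_s V i (1/x)" if x: "r1 < norm x" "norm x < r2" for i x
  proof -
    have "x \<in> ball 0 r2 - {0}" using x r by auto
    then show ?thesis using glued_derivative[OF gU x, of i] dU[of x] B(2)[of x] BQ[of x]
      by (simp add: al_def ga_def de_def)
  qed
  have e2: "(x * deriv ga x + de x * Q x) * G False i x + (ga x + x * deriv de x) * G True i x = next_s (next_s V) i (1/x)"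
    if x: "r1 < norm x" "norm x < r2" for i x
  proof (rule differentiate_glued[OF next_s_holomorphic[OF D(2)] e1 x])
    have "x \<in> ball 0 r2" using x by simp
    then show "(ga has_field_derivative deriv ga x) (at x)" "(de has_field_derivative deriv de x) (at x)"
      by (auto intro: holomorphic_derivI[OF gah open_ball] holomorphic_derivI[OF deh open_ball])
  qed
  \<comment> \<open>The determinant of the gauge matrix as seen from infinity; Liouville makes it
    constant, with the value 1 taken at 0.\<close>
  define W where "W u = V False u * next_s V True u - V True u * next_s V False u" for u
  have Wh: "W holomorphic_on ball 0 (1/r1)" unfolding W_def by (intro holomorphic_intros D next_s_holomorphic)
  have dh: "(\<lambda>x. al x * de x - x * B x * ga x) holomorphic_on ball 0 r2" by (intro holomorphic_intros alh deh gah B)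
  have dW: "al x * de x - x * B x * ga x = W (1/x)" if x: "r1 < norm x" "norm x < r2" for x
    unfolding W_def by (rule det_transfer[OF x e0[OF x] e1[OF x]])
  have det_W0: "al x * de x - x * B x * ga x = W 0" if "x \<in> ball 0 r2" for x
    by (rule glued_constant(1)[OF dh Wh dW that])
  have W0: "W 0 = 1" using det_W0[of 0] r2 al0 by (simp add: de_def)
  have det: "al x * de x - x * B x * ga x = 1" if "x \<in> ball 0 r2" for x using det_W0[OF that] W0 by simp
  \<comment> \<open>Written without the pole of \<open>Q\<close>, this is \<open>x\<close> times the
    coefficient of (al, be) when the second derivative of the section is expanded in (al, be) and
    (ga, de), i.e. \<open>x\<close> times the new potential. Its value \<open>A\<close> at 0 is the
    residue, and \<open>H\<close> is the remaining part.\<close>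
  define F where "F x = (x * deriv ga x * de x) * x + de x * de x * (A + x * b x) - x * ga x * (ga x + x * deriv de x)" for x
  have Fh: "F holomorphic_on ball 0 r2" unfolding F_def using b by (intro holomorphic_intros gah deh) auto
  have F0: "F 0 = A" by (simp add: F_def de_def al0)
  have FQ: "F x = x * ((x * deriv ga x + de x * Q x) * de x - (ga x + x * deriv de x) * ga x)" if "x \<in> ball 0 r2 - {0}" for x
    unfolding Q[OF that] F_def using that by (simp add: field_simps)
  obtain H where H: "H holomorphic_on ball 0 r2" "\<And>x. x \<in> ball 0 r2 \<Longrightarrow> F x - A = (x - 0) * H x"
    by (rule holomorphic_divide_root[of "\<lambda>x. F x - A" "ball 0 r2" 0]) (use Fh F0 in \<open>auto intro!: holomorphic_intros\<close>)
  define Z where "Z u = next_s (next_s V) False u * next_s V True u - next_s (next_s V) True u * next_s V False u" for u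
  have Zh: "(\<lambda>u. Z u - A * u) holomorphic_on ball 0 (1/r1)" unfolding Z_def
    by (intro holomorphic_intros D next_s_holomorphic)
  have HZ: "H x = Z (1/x) - A * (1/x)" if x: "r1 < norm x" "norm x < r2" for x
  proof -
    have x': "x \<in> ball 0 r2 - {0}" using x r by auto
    have "(x * deriv ga x + de x * Q x) * de x - (ga x + x * deriv de x) * ga x = Z (1/x)"
      unfolding Z_def by (rule det_transfer[OF x e2[OF x] e1[OF x]])
    then have "x * H x = x * Z (1/x) - A" using FQ[OF x'] H(2)[of x] x' by (simp add: algebra_simps)
    then show ?thesis using x' by (simp add: field_simps)
  qed
  \<comment> \<open>At \<open>u = 0\<close> the map \<open>next_s\<close> is multiplication by a
    triangular matrix with diagonal \<open>a\<close>, \<open>- a\<close>, whose square is a^2 times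
    the identity.\<close>
  have "Z 0 = a\<^sup>2 * W 0" by (simp add: Z_def W_def next_s_def power2_eq_square algebra_simps)
  then have "H x = a\<^sup>2" if "x \<in> ball 0 r2" for x
    using glued_constant(1)[OF H(1) Zh HZ that] W0 by simp
  then have QQ: "(x * deriv ga x + de x * Q x) * de x - (ga x + x * deriv de x) * ga x = A / x + a\<^sup>2" if "x \<in> ball 0 r2 - {0}" for x
    using FQ[OF that] H(2)[of x] that by (simp add: field_simps)
  \<comment> \<open>The derivative of det = 1: the second derivative of the section has no component
    along (ga, de), so the new equation has no first-order term.\<close>
  have lin: "al x * (ga x + x * deriv de x) = x * B x * (x * deriv ga x + de x * Q x)" if x: "x \<in> ball 0 r2 - {0}" for x
  proof -
    have x': "x \<in> ball 0 r2" using x by simp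
    note d = holomorphic_derivI[OF alh open_ball x'] holomorphic_derivI[OF B(1) open_ball x']
       holomorphic_derivI[OF gah open_ball x'] holomorphic_derivI[OF deh open_ball x']
    have "((\<lambda>x. al x * de x - x * B x * ga x) has_field_derivative
       (deriv al x * de x + deriv de x * al x) - ((1 * B x + deriv B x * x) * ga x + deriv ga x * (x * B x))) (at x)"
      by (intro DERIV_diff DERIV_mult DERIV_ident d)
    then have "((\<lambda>x. 1) has_field_derivative
       (deriv al x * de x + deriv de x * al x) - ((1 * B x + deriv B x * x) * ga x + deriv ga x * (x * B x))) (at x)"
      by (rule has_field_derivative_transform_within_open[OF _ open_ball x']) (use det in auto)
    then have 0: "(deriv al x * de x + deriv de x * al x) - ((1 * B x + deriv B x * x) * ga x + deriv ga x * (x * B x)) = 0"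
      using DERIV_const DERIV_unique by blast
    have "x * deriv al x = ga x - x * B x * Q x" unfolding BQ[OF x] ga_def by simp
    moreover have "x * (B x + x * deriv B x) = de x - al x" by (simp add: de_def)
    moreover have "x * deriv al x * de x + al x * (x * deriv de x) - x * (B x + x * deriv B x) * ga x - x * B x * (x * deriv ga x) = 0"
      using arg_cong[OF 0, of "\<lambda>z. x * z"] by (simp add: algebra_simps)
    ultimately have "(ga x - x * B x * Q x) * de x + al x * (x * deriv de x) - (de x - al x) * ga x - x * B x * (x * deriv ga x) = 0" by simp
    then show ?thesis by (simp add: algebra_simps)
  qed
  show ?thesis
  proof (rule that[OF alh B(1) al0])
    show "al x * (al x + x * (B x + x * deriv B x)) - x * B x * (x * deriv al x + B x * (A + x * b x)) = 1" if "x \<in> ball 0 r2" for x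
      using det[OF that] by (simp add: de_def ga_def)
    fix x :: complex assume x: "x \<in> ball 0 r2 - {0}"
    then have x': "x \<in> ball 0 r2" by simp
    define g2 where "g2 = x * deriv ga x + de x * Q x"
    define d2 where "d2 = ga x + x * deriv de x"
    have 1: "al x * d2 = x * B x * g2" using lin[OF x] by (simp add: g2_def d2_def)
    have 2: "g2 * de x - d2 * ga x = A / x + a\<^sup>2" using QQ[OF x] by (simp add: g2_def d2_def)
    have "g2 = g2 * (al x * de x - x * B x * ga x)" using det[OF x'] by simp
    also have "\<dots> = al x * (g2 * de x) - ga x * (x * B x * g2)" by (simp add: algebra_simps)
    also have "\<dots> = (A / x + a\<^sup>2) * al x" unfolding 1[symmetric] 2[symmetric] by (simp add: algebra_simps)
    finally show "x * deriv (\<lambda>x. x * deriv al x + B x * (A + x * b x)) x + (al x + x * (B x + x * deriv B x)) * Q x = (A / x + a\<^sup>2) * al x"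
      by (simp add: g2_def ga_def de_def)
    have "d2 = d2 * (al x * de x - x * B x * ga x)" using det[OF x'] by simp
    also have "\<dots> = de x * (al x * d2) - x * B x * ga x * d2" by (simp add: algebra_simps)
    also have "\<dots> = (A / x + a\<^sup>2) * (x * B x)" unfolding 1 2[symmetric] by (simp add: algebra_simps)
    finally show "(x * deriv al x + B x * (A + x * b x)) + x * deriv (\<lambda>x. al x + x * (B x + x * deriv B x)) x = (A / x + a\<^sup>2) * (x * B x)"
      by (simp add: d2_def ga_def de_def)
  qed
qed

end

subsection \<open>From the gauge transformation to a point transformation\<close>

text \<open>Taylor coefficients, in the displacement \<open>\<eta>\<close> of \<open>1/x\<close>, of the solution of the normal form
  \<open>\<theta>\<^sup>2 y = (A/x + m) y\<close> with prescribed initial values \<open>- \<beta>\<close> and \<open>1\<close>.\<close>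
fun nf_coeff :: "complex \<Rightarrow> complex \<Rightarrow> complex \<Rightarrow> complex \<Rightarrow> nat \<Rightarrow> complex" where
  "nf_coeff A m \<beta> x 0 = - \<beta>"
| "nf_coeff A m \<beta> x (Suc 0) = 1"
| "nf_coeff A m \<beta> x (Suc (Suc n)) = x *
     (- (of_nat (Suc n) * of_nat (2 * n + 1)) * nf_coeff A m \<beta> x (Suc n)
      + (A + m * x - x * (of_nat n)\<^sup>2) * nf_coeff A m \<beta> x n
      + (case n of 0 \<Rightarrow> 0 | Suc l \<Rightarrow> A * x * nf_coeff A m \<beta> x l))
     / (of_nat (Suc (Suc n)) * of_nat (Suc n))"

definition nf_series :: "complex \<Rightarrow> complex \<Rightarrow> complex \<Rightarrow> complex \<Rightarrow> complex fps" where
  "nf_series A m \<beta> x = Abs_fps (nf_coeff A m \<beta> x)"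

text \<open>With z = x / (1 + x \<eta>) one has \<theta> = - ((1 + x \<eta>) / x) d/d\<eta>; the
  identity is \<theta>^2 y = (A/z + m) y multiplied by x^2. The square of \<open>L\<close> is kept
  as a repeated product so that a single shift rule yields all coefficients.\<close>

lemma nf_series_ode:
  fixes x A m \<beta> :: complex
  defines "F \<equiv> nf_series A m \<beta> x" and "L \<equiv> 1 + fps_const x * fps_X"
  shows "L * (L * fps_deriv (fps_deriv F)) + fps_const x * (L * fps_deriv F)
     = fps_const x * ((fps_const A * (L * F)) + fps_const (m * x) * F)"
proof (rule fps_ext)
  have Ln: "fps_nth (L * G) n = fps_nth G n + (case n of 0 \<Rightarrow> 0 | Suc l \<Rightarrow> x * fps_nth G l)" for G n
    by (cases n) (auto simp: L_def distrib_right mult.assoc)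
  have Fn: "fps_nth F n = nf_coeff A m \<beta> x n" for n by (simp add: F_def nf_series_def)
  fix n
  define D where "D = of_nat (Suc (Suc n)) * of_nat (Suc n) * nf_coeff A m \<beta> x (Suc (Suc n)) - x *
     (- (of_nat (Suc n) * of_nat (2 * n + 1)) * nf_coeff A m \<beta> x (Suc n)
      + (A + m * x - x * (of_nat n)\<^sup>2) * nf_coeff A m \<beta> x n
      + (case n of 0 \<Rightarrow> 0 | Suc l \<Rightarrow> A * x * nf_coeff A m \<beta> x l))"
  have "D = 0" by (simp add: D_def del: of_nat_Suc of_nat_add of_nat_mult)
  moreover have "fps_nth (L * (L * fps_deriv (fps_deriv F)) + fps_const x * (L * fps_deriv F)) n
     - fps_nth (fps_const x * ((fps_const A * (L * F)) + fps_const (m * x) * F)) n = D"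
    unfolding fps_add_nth fps_mult_left_const_nth Ln fps_deriv_nth Fn D_def
    by (cases n; cases "n - 1") (simp_all add: algebra_simps power2_eq_square del: nf_coeff.simps(3))
  ultimately show "fps_nth (L * (L * fps_deriv (fps_deriv F)) + fps_const x * (L * fps_deriv F)) n
     = fps_nth (fps_const x * ((fps_const A * (L * F)) + fps_const (m * x) * F)) n" by simp
qed

text \<open>Every term of the recursion carries a factor \<open>x\<close>, so the coefficients from
  index 2 on are O(|x|), and \<open>norm x * K \<le> 1\<close> closes the induction. The summands of
  \<open>K\<close> are the costs of going back one, two and three powers of \<open>s\<close>; the 2
  in \<open>2 / s\<close> stems from \<open>2 * n + 1 \<le> 2 * (n + 2)\<close>.\<close>

lemma nf_coeff_bound:
  fixes A m :: complex and s M :: real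
  assumes s: "0 < s" and M: "1 / s \<le> M" "0 \<le> M"
  defines "K \<equiv> 2 / s + (norm A + norm m + 1) / s\<^sup>2 + norm A / s^3"
  assumes x: "norm x \<le> 1" "norm x * K \<le> 1" and b: "norm \<beta> \<le> M"
  shows "norm (nf_coeff A m \<beta> x n) \<le> M * s ^ n" "norm (nf_coeff A m \<beta> x (Suc (Suc n))) \<le> norm x * (M * K) * s ^ Suc (Suc n)"
proof -
  have step: "norm (nf_coeff A m \<beta> x (Suc (Suc n))) \<le> norm x * (M * K) * s ^ Suc (Suc n)"
    if IH: "\<And>l. l \<le> Suc n \<Longrightarrow> norm (nf_coeff A m \<beta> x l) \<le> M * s ^ l" for n
  proof -
    let ?d = "real (Suc (Suc n)) * real (Suc n)"
    have d0: "?d > 0" by simp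
    define t1 where "t1 = - (of_nat (Suc n) * of_nat (2 * n + 1)) * nf_coeff A m \<beta> x (Suc n)"
    define t2 where "t2 = (A + m * x - x * (of_nat n)\<^sup>2) * nf_coeff A m \<beta> x n"
    define t3 where "t3 = (case n of 0 \<Rightarrow> 0 | Suc l \<Rightarrow> A * x * nf_coeff A m \<beta> x l)"
    have e1: "norm t1 \<le> ?d * (2 * (M * s ^ Suc n))"
    proof -
      have "norm t1 = (real (Suc n) * real (2*n+1)) * norm (nf_coeff A m \<beta> x (Suc n))"
        unfolding t1_def norm_mult norm_minus_cancel norm_of_nat by simp
      also have "\<dots> \<le> (real (Suc n) * (2 * real (Suc (Suc n)))) * (M * s ^ Suc n)"
        using IH[of "Suc n"] by (intro mult_mono) auto
      finally show ?thesis by (simp add: algebra_simps)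
    qed
    have e2: "norm t2 \<le> ?d * ((norm A + norm m + 1) * (M * s ^ n))"
    proof -
      have "norm (A + m * x - x * (of_nat n)\<^sup>2) \<le> norm A + norm m * norm x + norm x * (real n)\<^sup>2"
        using norm_triangle_ineq4[of "A + m * x" "x * (of_nat n)\<^sup>2"] norm_triangle_ineq[of A "m * x"]
        by (simp add: norm_mult norm_power)
      also have "\<dots> \<le> norm A + norm m * 1 + 1 * (real n)\<^sup>2" using x by (intro add_mono mult_mono) auto
      also have "\<dots> \<le> ?d * (norm A + norm m + 1)"
      proof -
        have "1 * (norm A + norm m) \<le> ?d * (norm A + norm m)" by (intro mult_right_mono) (auto simp: algebra_simps)
        moreover have "(real n)\<^sup>2 \<le> ?d" by (simp add: power2_eq_square algebra_simps)
        ultimately show ?thesis by (simp only: distrib_left mult_1_right)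
      qed
      finally have "norm t2 \<le> (?d * (norm A + norm m + 1)) * (M * s ^ n)"
        unfolding t2_def norm_mult using IH[of n] by (intro mult_mono) auto
      then show ?thesis by (simp add: mult.assoc)
    qed
    have e3: "norm t3 \<le> ?d * (norm A * (M * s ^ n / s))"
    proof (cases n)
      case 0
      then show ?thesis using s M by (simp add: t3_def)
    next
      case (Suc l)
      have "norm t3 \<le> norm A * 1 * (M * s ^ l)" unfolding t3_def Suc nat.case norm_mult
        using IH[of l] x Suc by (intro mult_mono) auto
      also have "\<dots> = 1 * (norm A * (M * s ^ n / s))" using s by (simp add: Suc)
      also have "\<dots> \<le> ?d * (norm A * (M * s ^ n / s))"
        by (intro mult_right_mono) (use s M in \<open>auto simp: algebra_simps\<close>)
      finally show ?thesis .
    qed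
    have "norm (nf_coeff A m \<beta> x (Suc (Suc n))) = norm x * norm (t1 + t2 + t3) / ?d"
      unfolding nf_coeff.simps(3) t1_def t2_def t3_def norm_divide norm_mult norm_of_nat by simp
    also have "\<dots> \<le> norm x * (?d * (2 * (M * s ^ Suc n)) + ?d * ((norm A + norm m + 1) * (M * s ^ n)) + ?d * (norm A * (M * s ^ n / s))) / ?d"
      using e1 e2 e3 norm_triangle_ineq[of "t1 + t2" t3] norm_triangle_ineq[of t1 t2]
      by (intro divide_right_mono mult_left_mono) auto
    also have "\<dots> = norm x * ((2 * (M * s ^ Suc n)) + ((norm A + norm m + 1) * (M * s ^ n)) + (norm A * (M * s ^ n / s)))"
      unfolding distrib_left[symmetric] using d0 by (simp del: of_nat_Suc)
    also have "\<dots> = norm x * (M * K) * s ^ Suc (Suc n)"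
      unfolding K_def using s by (simp add: field_simps power2_eq_square power3_eq_cube)
    finally show ?thesis .
  qed
  show main: "norm (nf_coeff A m \<beta> x n) \<le> M * s ^ n" for n
  proof (induction n rule: less_induct)
    case (less n)
    consider "n = 0" | "n = 1" | l where "n = Suc (Suc l)" by (metis One_nat_def not0_implies_Suc)
    then show ?case
    proof cases
      case 2
      then show ?thesis using M s by (simp add: field_simps)
    next
      case 3
      have "norm (nf_coeff A m \<beta> x n) \<le> norm x * (M * K) * s ^ n" unfolding 3 by (rule step) (use less.IH 3 in auto)
      also have "\<dots> = (norm x * K) * (M * s ^ n)" by (simp add: mult_ac)
      also have "\<dots> \<le> 1 * (M * s ^ n)" using x M s by (intro mult_right_mono) auto
      finally show ?thesis by simp
    qed (use b in auto)
  qed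
  show "norm (nf_coeff A m \<beta> x (Suc (Suc n))) \<le> norm x * (M * K) * s ^ Suc (Suc n)" by (rule step) (rule main)
qed

lemma nf_coeff_holomorphic:
  assumes "\<beta> holomorphic_on S" shows "(\<lambda>x. nf_coeff A m (\<beta> x) x n) holomorphic_on S"
proof (induction n rule: less_induct)
  case (less n)
  consider "n = 0" | "n = 1" | l where "n = Suc (Suc l)" by (metis One_nat_def not0_implies_Suc)
  then show ?case
  proof cases
    case 3
    have "(\<lambda>x. case l of 0 \<Rightarrow> 0 | Suc i \<Rightarrow> A * x * nf_coeff A m (\<beta> x) x i) holomorphic_on S"
      by (cases l) (use 3 in \<open>auto intro!: holomorphic_intros less.IH\<close>)
    then show ?thesis unfolding 3 nf_coeff.simps(3)
      by (intro holomorphic_intros less.IH) (use 3 in \<open>auto simp del: of_nat_Suc\<close>)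
  qed (use assms in \<open>auto intro!: holomorphic_intros\<close>)
qed

text \<open>The usual factor \<open>n\<close> is weakened to \<open>2 ^ n\<close> so that sums over
  \<open>n\<close> remain geometric.\<close>

lemma norm_power_diff_le:
  fixes z w :: complex
  assumes "norm z \<le> H" "norm w \<le> H" "0 < H"
  shows "norm (z ^ n - w ^ n) \<le> H ^ n * (2 ^ n * norm (z - w) / H)"
proof -
  have "norm ((z/of_real H)^n - (w/of_real H)^n) \<le> real n * norm (z/of_real H - w/of_real H)"
    by (rule norm_power_diff) (use assms in \<open>auto simp: norm_divide\<close>)
  also have "\<dots> \<le> 2 ^ n * norm (z/of_real H - w/of_real H)"
    using of_nat_less_two_power[of n] by (intro mult_right_mono) auto
  also have "norm (z/of_real H - w/of_real H) = norm (z - w) / H"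
    using assms by (simp add: diff_divide_distrib[symmetric] norm_divide)
  finally have "norm ((z/of_real H)^n - (w/of_real H)^n) \<le> 2 ^ n * (norm (z - w) / H)" .
  then have "H ^ n * norm ((z/of_real H)^n - (w/of_real H)^n) \<le> H ^ n * (2 ^ n * (norm (z - w) / H))"
    using assms by (intro mult_left_mono) auto
  moreover have "z^n - w^n = of_real H ^ n * ((z/of_real H)^n - (w/of_real H)^n)"
    using assms by (simp add: power_divide right_diff_distrib)
  then have "norm (z^n - w^n) = H ^ n * norm ((z/of_real H)^n - (w/of_real H)^n)"
    using assms by (metis abs_of_pos norm_mult norm_of_real norm_power)
  ultimately show ?thesis by simp
qed

text \<open>Banach iteration with contraction factor 1/2. The limit is written as a telescoping
  series, whose increments are bounded by \<open>(1/2)^k\<close> uniformly on \<open>U\<close>, so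
  that holomorphy survives.\<close>

lemma holomorphic_fixpoint:
  fixes S :: "complex \<Rightarrow> complex \<Rightarrow> complex"
  assumes S: "\<And>g. g holomorphic_on U \<Longrightarrow> (\<And>x. x \<in> U \<Longrightarrow> norm (g x) \<le> H) \<Longrightarrow> (\<lambda>x. S x (g x)) holomorphic_on U"
    and U: "open U" and beta: "\<beta> holomorphic_on U" "\<And>x. x \<in> U \<Longrightarrow> norm (\<beta> x) + 1 \<le> H"
    and bd: "\<And>x z. x \<in> U \<Longrightarrow> norm z \<le> H \<Longrightarrow> norm (S x z) \<le> 1"
    and lip: "\<And>x z w. x \<in> U \<Longrightarrow> norm z \<le> H \<Longrightarrow> norm w \<le> H \<Longrightarrow> norm (S x z - S x w) \<le> norm (z - w) / 2"
  obtains h where "h holomorphic_on U" "\<And>x. x \<in> U \<Longrightarrow> norm (h x) \<le> H" "\<And>x. x \<in> U \<Longrightarrow> h x = \<beta> x - S x (h x)"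
proof -
  define h where "h = rec_nat \<beta> (\<lambda>_ g x. \<beta> x - S x (g x))"
  have h0: "h 0 = \<beta>" and hS: "\<And>k. h (Suc k) = (\<lambda>x. \<beta> x - S x (h k x))" by (auto simp: h_def)
  have hH: "norm (h k x) \<le> H" if "x \<in> U" for k x
    using that
  proof (induction k)
    case (Suc k)
    then show ?case using beta(2)[OF Suc.prems] bd[OF Suc.prems, of "h k x"] norm_triangle_ineq4[of "\<beta> x" "S x (h k x)"] by (simp add: hS)
  qed (use beta(2) in \<open>force simp: h0\<close>)
  have hh: "h k holomorphic_on U" for k
  proof (induction k)
    case (Suc k) then show ?case unfolding hS using beta(1) hH by (intro holomorphic_on_diff S) auto
  qed (use beta in \<open>simp add: h0\<close>)
  have hd: "norm (h (Suc k) x - h k x) \<le> (1/2)^k" if x: "x \<in> U" for k x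
  proof (induction k)
    case 0 show ?case using bd[OF x, of "\<beta> x"] beta(2)[OF x] by (simp add: hS h0)
  next
    case (Suc k)
    have e: "h (Suc j) x = \<beta> x - S x (h j x)" for j by (simp add: hS)
    have "h (Suc (Suc k)) x - h (Suc k) x = S x (h k x) - S x (h (Suc k) x)" using e[of "Suc k"] e[of k] by algebra
    then have "norm (h (Suc (Suc k)) x - h (Suc k) x) = norm (S x (h (Suc k) x) - S x (h k x))"
      by (simp only: norm_minus_commute)
    also have "\<dots> \<le> norm (h (Suc k) x - h k x) / 2" by (rule lip[OF x hH[OF x] hH[OF x]])
    finally show ?case using Suc by simp
  qed
  have sm: "summable (\<lambda>k. (1/2::real)^k)" by (intro summable_geometric) auto
  define g where "g x = \<beta> x + (\<Sum>k. h (Suc k) x - h k x)" for x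
  have gh: "g holomorphic_on U" unfolding g_def
    by (intro holomorphic_on_add beta holomorphic_suminf[OF U _ _ sm] holomorphic_on_diff hh hd)
  have lim: "(\<lambda>n. h n x) \<longlonglongrightarrow> g x" if x: "x \<in> U" for x
  proof -
    have "summable (\<lambda>k. h (Suc k) x - h k x)" by (rule summable_comparison_test'[OF sm]) (rule hd[OF x])
    then have "(\<lambda>n. \<Sum>k<n. h (Suc k) x - h k x) \<longlonglongrightarrow> (\<Sum>k. h (Suc k) x - h k x)" by (rule summable_LIMSEQ)
    moreover have "(\<Sum>k<n. h (Suc k) x - h k x) = h n x - \<beta> x" for n
      using sum_lessThan_telescope[of "\<lambda>k. h k x" n] by (simp add: h0)
    ultimately have "(\<lambda>n. \<beta> x + (h n x - \<beta> x)) \<longlonglongrightarrow> g x" unfolding g_def by (intro tendsto_add tendsto_const) simp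
    then show ?thesis by simp
  qed
  have gH: "norm (g x) \<le> H" if x: "x \<in> U" for x
    by (rule LIMSEQ_le_const2[OF tendsto_norm[OF lim[OF x]]]) (use hH[OF x] in auto)
  show ?thesis
  proof (rule that[OF gh gH])
    fix x assume x: "x \<in> U"
    have "(\<lambda>n. S x (h n x) - S x (g x)) \<longlonglongrightarrow> 0"
    proof (rule Lim_null_comparison)
      show "eventually (\<lambda>n. norm (S x (h n x) - S x (g x)) \<le> norm (h n x - g x) / 2) sequentially"
        using lip[OF x hH[OF x] gH[OF x]] by simp
      have "(\<lambda>n. norm (h n x - g x) / 2) \<longlonglongrightarrow> norm (g x - g x) / 2" by (intro tendsto_intros lim[OF x]) auto
      then show "(\<lambda>n. norm (h n x - g x) / 2) \<longlonglongrightarrow> 0" by simp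
    qed
    then have "(\<lambda>n. S x (h n x)) \<longlonglongrightarrow> S x (g x)" by (rule LIM_zero_cancel)
    then have "(\<lambda>n. h (Suc n) x) \<longlonglongrightarrow> \<beta> x - S x (g x)" unfolding hS by (intro tendsto_intros)
    moreover have "(\<lambda>n. h (Suc n) x) \<longlonglongrightarrow> g x" using lim[OF x] by (rule LIMSEQ_Suc)
    ultimately show "g x = \<beta> x - S x (g x)" by (metis LIMSEQ_unique)
  qed
qed

text \<open>\<open>F x e\<close> is a solution of the normal form at the displaced point \<open>x / (1 + x e)\<close>; its zero \<open>h x\<close> gives the point
  transformation \<open>x / (1 + x h(x))\<close>.\<close>
lemma normal_form_displacement:
  fixes A m :: complex
  assumes beta: "\<beta> holomorphic_on ball 0 R" and R: "0 < R"
  obtains r H h F F1 F2 where "0 < r" "r \<le> R" "0 < H" "r * (4 * H) \<le> 1" "h holomorphic_on ball 0 r"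
    "\<And>x. x \<in> ball 0 r \<Longrightarrow> norm (h x) \<le> H"
    "\<And>x e. x \<in> ball 0 r \<Longrightarrow> e \<in> ball 0 (2*H) \<Longrightarrow> (F x has_field_derivative F1 x e) (at e)"
    "\<And>x e. x \<in> ball 0 r \<Longrightarrow> e \<in> ball 0 (2*H) \<Longrightarrow> (F1 x has_field_derivative F2 x e) (at e)"
    "\<And>x e. x \<in> ball 0 r \<Longrightarrow> e \<in> ball 0 (2*H) \<Longrightarrow>
       (1 + x * e)\<^sup>2 * F2 x e + x * (1 + x * e) * F1 x e = (A * x * (1 + x * e) + m * x\<^sup>2) * F x e"
    "\<And>x. F x 0 = - \<beta> x" "\<And>x. F1 x 0 = 1"
    "\<And>x. x \<in> ball 0 r \<Longrightarrow> F x (h x) = 0" "\<And>x. x \<in> ball 0 r \<Longrightarrow> F1 x (h x) \<noteq> 0"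
    "(\<lambda>x. F1 x (h x)) holomorphic_on ball 0 r"
proof -
  \<comment> \<open>One unit allows for the variation of \<open>\<beta>\<close> near 0, the other
    for the tail \<open>S\<close> of the series.\<close>
  define H where "H = norm (\<beta> 0) + 2"
  have H: "2 \<le> H" by (simp add: H_def)
  \<comment> \<open>\<open>s * H = 1/4\<close>: the series in \<eta> converges up to norm
    \<open>4 * H\<close> and has ratio 1/4 for norm at most \<open>H\<close>. The coefficient 1 of
    index one forces \<open>M * s \<ge> 1\<close>, whence \<open>M = 1 / s\<close>.\<close>
  define s where "s = 1 / (4 * H)"
  define M where "M = 4 * H"
  define K where "K = 2 / s + (norm A + norm m + 1) / s\<^sup>2 + norm A / s^3"
  have s: "0 < s" "1 / s \<le> M" "0 \<le> M" "s * H = 1/4" using H by (auto simp: s_def M_def)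
  have K0: "0 \<le> K" using s by (simp add: K_def)
  have "isCont \<beta> 0" using beta R holomorphic_on_imp_continuous_on continuous_on_interior by (metis centre_in_ball interior_ball)
  then obtain d where d: "d > 0" "\<And>x. norm (x - 0) < d \<Longrightarrow> norm (\<beta> x - \<beta> 0) < 1"
    unfolding continuous_at_eps_delta dist_norm by (metis zero_less_one)
  \<comment> \<open>In this order: the domain of \<open>\<beta>\<close>, its continuity at 0, and
    then \<open>norm x \<le> 1\<close>, \<open>norm x * K \<le> 1\<close>,
    \<open>norm x * (M * K) \<le> 1/4\<close> and \<open>r * (4 * H) \<le> 1\<close>.\<close>
  define r where "r = Min {R, d, 1, 1 / (K + 1), 1 / (4 * M * K + 1), 1 / (4 * H)}"
  have MK: "0 \<le> M * K" using s K0 by simp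
  have r: "0 < r" "r \<le> R" "r \<le> d" "r \<le> 1" "r \<le> 1 / (K + 1)" "r \<le> 1 / (4 * M * K + 1)" "r \<le> 1 / (4 * H)"
    unfolding r_def using R d K0 MK H by (auto simp: mult.assoc)
  have bH: "norm (\<beta> x) + 1 \<le> H" "norm (\<beta> x) \<le> M" if "x \<in> ball 0 r" for x
  proof -
    have "norm (\<beta> x - \<beta> 0) < 1" using d(2)[of x] that r by simp
    then show "norm (\<beta> x) + 1 \<le> H" using norm_triangle_ineq2[of "\<beta> x" "\<beta> 0"] by (simp add: H_def)
    then show "norm (\<beta> x) \<le> M" using H by (simp add: M_def)
  qed
  have xK: "norm x \<le> 1" "norm x * K \<le> 1" "norm x * (M * K) \<le> 1/4" if "x \<in> ball 0 r" for x
  proof -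
    have nx: "norm x \<le> r" using that by simp
    show "norm x \<le> 1" using nx r by simp
    have "norm x * K \<le> 1 / (K + 1) * K" using nx r K0 by (intro mult_right_mono) auto
    also have "\<dots> \<le> 1" using K0 by simp
    finally show "norm x * K \<le> 1" .
    have "norm x * (M * K) \<le> 1 / (4 * M * K + 1) * (M * K)" using nx r MK by (intro mult_right_mono) auto
    also have "\<dots> \<le> 1/4" using MK by (simp add: field_simps)
    finally show "norm x * (M * K) \<le> 1/4" .
  qed
  define c where "c x n = nf_coeff A m (\<beta> x) x n" for x n
  have c0: "norm (c x n) \<le> M * s ^ n" if "x \<in> ball 0 r" for x n
    unfolding c_def by (rule nf_coeff_bound(1)[OF s(1-3) xK(1)[OF that] xK(2)[OF that, unfolded K_def] bH(2)[OF that]])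
  have c2: "norm (c x (Suc (Suc n))) \<le> 1/4 * s ^ Suc (Suc n)" if "x \<in> ball 0 r" for x n
  proof -
    have "norm (c x (Suc (Suc n))) \<le> norm x * (M * K) * s ^ Suc (Suc n)"
      unfolding c_def K_def by (rule nf_coeff_bound(2)[OF s(1-3) xK(1)[OF that] xK(2)[OF that, unfolded K_def] bH(2)[OF that]])
    also have "\<dots> \<le> 1/4 * s ^ Suc (Suc n)" using xK(3)[OF that] s by (intro mult_right_mono) auto
    finally show ?thesis .
  qed
  have ch: "(\<lambda>x. c x n) holomorphic_on ball 0 r" for n
    unfolding c_def by (rule nf_coeff_holomorphic[OF holomorphic_on_subset[OF beta]]) (use r in auto)
  define P where "P x = nf_series A m (\<beta> x) x" for x
  have Pn: "fps_nth (P x) n = c x n" for x n by (simp add: P_def nf_series_def c_def)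
  have rad: "fps_conv_radius (P x) \<ge> ereal (4 * H)" if "x \<in> ball 0 r" for x
  proof (rule fps_conv_radius_ge_bound)
    fix n
    have "norm (c x n) * (4 * H) ^ n \<le> M * s ^ n * (4 * H) ^ n" using c0[OF that] H by (intro mult_right_mono) auto
    also have "\<dots> = M" using H by (simp add: s_def power_divide)
    finally show "norm (fps_nth (P x) n) * (4 * H) ^ n \<le> M" by (simp add: Pn)
  qed (use H in simp)
  have rad1: "fps_conv_radius (fps_deriv (P x)) \<ge> ereal (4 * H)" if "x \<in> ball 0 r" for x
    using rad[OF that] fps_conv_radius_deriv[of "P x"] order_trans by blast
  have rad2: "fps_conv_radius (fps_deriv (fps_deriv (P x))) \<ge> ereal (4 * H)" if "x \<in> ball 0 r" for x
    using rad1[OF that] fps_conv_radius_deriv[of "fps_deriv (P x)"] order_trans by blast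
  have lt: "ereal (norm e) < ereal (4 * H)" if "norm e < 2 * H" for e :: complex using that H by simp
  have sums: "summable (\<lambda>n. c x n * e ^ n)" if "x \<in> ball 0 r" "norm e \<le> H" for x e
  proof -
    have "ereal (norm e) < ereal (4 * H)" using that(2) H by simp
    then have "ereal (norm e) < fps_conv_radius (P x)" using rad[OF that(1)] less_le_trans by blast
    then show ?thesis using summable_fps[of e "P x"] by (simp add: Pn)
  qed
  \<comment> \<open>The series from its quadratic term on: it equals
    \<open>- \<beta> + \<eta> + S\<close>, so its zero is a fixed point of \<eta> \<mapsto> \<beta>
    - S.\<close>
  define S where "S x e = (\<Sum>n. c x (Suc (Suc n)) * e ^ Suc (Suc n))" for x e
  have FS: "eval_fps (P x) e = - \<beta> x + e + S x e" if "x \<in> ball 0 r" "norm e \<le> H" for x e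
  proof -
    have "(\<Sum>n. c x n * e ^ n) = (\<Sum>n. c x (n + 2) * e ^ (n + 2)) + (\<Sum>n<2. c x n * e ^ n)"
      by (rule suminf_split_initial_segment[OF sums[OF that]])
    then show ?thesis by (simp add: eval_fps_def Pn S_def c_def numeral_2_eq_2)
  qed
  have sH: "s ^ n * H ^ n = (1/4) ^ n" for n by (simp only: power_mult_distrib[symmetric] s(4))
  have p24: "2 ^ n * (1/4::real) ^ n = (1/2) ^ n" for n by (simp only: power_mult_distrib[symmetric]) simp
  have g4: "summable (\<lambda>n. (1/4) * (1/4::real) ^ Suc (Suc n))" "(\<Sum>n. (1/4) * (1/4::real) ^ Suc (Suc n)) \<le> 1"
  proof -
    have "(\<lambda>n. (1/64) * (1/4::real) ^ n) sums ((1/64) * (1 / (1 - 1/4)))" by (intro sums_mult geometric_sums) auto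
    then have "(\<lambda>n. (1/4) * (1/4::real) ^ Suc (Suc n)) sums ((1/64) * (1 / (1 - 1/4)))" by simp
    then show "summable (\<lambda>n. (1/4) * (1/4::real) ^ Suc (Suc n))" "(\<Sum>n. (1/4) * (1/4::real) ^ Suc (Suc n)) \<le> 1"
      by (auto simp: sums_iff)
  qed
  have g2: "(\<lambda>n. C * (1/2::real) ^ Suc (Suc n)) sums (C / 2)" for C
  proof -
    have "(\<lambda>n. (C/4) * (1/2::real) ^ n) sums ((C/4) * (1 / (1 - 1/2)))" by (intro sums_mult geometric_sums) auto
    then show ?thesis by simp
  qed
  have tb: "norm (c x (Suc (Suc n)) * e ^ Suc (Suc n)) \<le> (1/4) * (1/4) ^ Suc (Suc n)" if x: "x \<in> ball 0 r" and e: "norm e \<le> H" for x e n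
  proof -
    have "norm (c x (Suc (Suc n)) * e ^ Suc (Suc n)) \<le> (1/4 * s ^ Suc (Suc n)) * H ^ Suc (Suc n)"
      unfolding norm_mult norm_power using c2[OF x, of n] e s by (intro mult_mono power_mono) auto
    also have "\<dots> = (1/4) * (1/4) ^ Suc (Suc n)" using sH[of "Suc (Suc n)"] by (simp only: mult.assoc)
    finally show ?thesis .
  qed
  have Ssum: "summable (\<lambda>n. c x (Suc (Suc n)) * e ^ Suc (Suc n))" if "x \<in> ball 0 r" "norm e \<le> H" for x e
    by (rule summable_comparison_test'[OF g4(1)]) (rule tb[OF that])
  obtain h where h: "h holomorphic_on ball 0 r" "\<And>x. x \<in> ball 0 r \<Longrightarrow> norm (h x) \<le> H" "\<And>x. x \<in> ball 0 r \<Longrightarrow> h x = \<beta> x - S x (h x)"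
  proof (rule holomorphic_fixpoint[of "ball 0 r" H S \<beta>])
    fix g assume g: "g holomorphic_on ball 0 r" "\<And>x. x \<in> ball 0 r \<Longrightarrow> norm (g x) \<le> H"
    show "(\<lambda>x. S x (g x)) holomorphic_on ball 0 r" unfolding S_def
    proof (rule holomorphic_suminf[OF open_ball _ _ g4(1)])
      show "(\<lambda>x. c x (Suc (Suc n)) * g x ^ Suc (Suc n)) holomorphic_on ball 0 r" for n
        by (intro holomorphic_intros ch g)
    qed (rule tb, use g in auto)
  next
    fix x z :: complex assume x: "x \<in> ball 0 r" and z: "norm (z::complex) \<le> H"
    have "norm (S x z) \<le> (\<Sum>n. (1/4) * (1/4) ^ Suc (Suc n))" unfolding S_def
      by (rule norm_suminf_le[OF _ g4(1)]) (rule tb[OF x z])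
    then show "norm (S x z) \<le> 1" using g4(2) by linarith
  next
    fix x z w :: complex assume x: "x \<in> ball 0 r" and z: "norm (z::complex) \<le> H" and w: "norm (w::complex) \<le> H"
    have "S x z - S x w = (\<Sum>n. c x (Suc (Suc n)) * z ^ Suc (Suc n) - c x (Suc (Suc n)) * w ^ Suc (Suc n))"
      unfolding S_def by (rule suminf_diff[OF Ssum[OF x z] Ssum[OF x w]])
    also have "norm \<dots> \<le> (\<Sum>n. norm (z - w) * (1/2) ^ Suc (Suc n))"
    proof (rule norm_suminf_le)
      fix n
      have "norm (c x (Suc (Suc n)) * z ^ Suc (Suc n) - c x (Suc (Suc n)) * w ^ Suc (Suc n)) = norm (c x (Suc (Suc n))) * norm (z ^ Suc (Suc n) - w ^ Suc (Suc n))"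
        by (simp only: right_diff_distrib[symmetric] norm_mult)
      also have "\<dots> \<le> (1/4 * s ^ Suc (Suc n)) * (H ^ Suc (Suc n) * (2 ^ Suc (Suc n) * norm (z - w) / H))"
        by (intro mult_mono c2[OF x] norm_power_diff_le z w) (use H s in auto)
      also have "\<dots> = (s ^ Suc (Suc n) * H ^ Suc (Suc n)) * 2 ^ Suc (Suc n) * (norm (z - w) / (4 * H))"
        by (simp add: mult_ac)
      also have "\<dots> = (1/2) ^ Suc (Suc n) * (norm (z - w) / (4 * H))"
        unfolding sH by (simp only: power_mult_distrib[symmetric]) simp
      also have "\<dots> \<le> (1/2) ^ Suc (Suc n) * norm (z - w)"
      proof (intro mult_left_mono)
        have "norm (z - w) / (4 * H) \<le> norm (z - w) / 1" by (intro divide_left_mono) (use H in auto)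
        then show "norm (z - w) / (4 * H) \<le> norm (z - w)" by simp
      qed simp
      finally show "norm (c x (Suc (Suc n)) * z ^ Suc (Suc n) - c x (Suc (Suc n)) * w ^ Suc (Suc n)) \<le> norm (z - w) * (1/2) ^ Suc (Suc n)"
        by (simp only: mult.commute)
    qed (use g2[of "norm (z - w)"] in \<open>simp only: sums_iff\<close>)
    also have "\<dots> = norm (z - w) / 2" using g2[of "norm (z - w)"] by (simp only: sums_iff)
    finally show "norm (S x z - S x w) \<le> norm (z - w) / 2" .
  next
    show "\<beta> holomorphic_on ball 0 r" using beta r by (auto intro: holomorphic_on_subset)
  qed (use bH that in auto)
  have F1s: "eval_fps (fps_deriv (P x)) e = (\<Sum>n. of_nat (Suc n) * c x (Suc n) * e ^ n)" for x e
    by (simp add: eval_fps_def Pn)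
  have db: "norm (of_nat (Suc n) * c x (Suc n) * e ^ n) \<le> M / H * (1/2) ^ Suc n" if x: "x \<in> ball 0 r" and e: "norm e \<le> H" for x e n
  proof -
    have "norm (of_nat (Suc n) * c x (Suc n) * e ^ n) \<le> 2 ^ Suc n * (M * s ^ Suc n) * H ^ n"
      unfolding norm_mult norm_power norm_of_nat using c0[OF x, of "Suc n"] e s of_nat_less_two_power[of "Suc n", where 'a=real]
      by (intro mult_mono power_mono) auto
    also have "\<dots> = 2 ^ Suc n * (s ^ Suc n * H ^ Suc n) * (M / H)" using H by (simp add: field_simps)
    also have "\<dots> = M / H * (1/2) ^ Suc n" unfolding sH p24 by (rule mult.commute)
    finally show ?thesis .
  qed
  have gh: "summable (\<lambda>n. M / H * (1/2::real) ^ Suc n)" by (intro summable_mult summable_Suc_iff[THEN iffD2] summable_geometric) auto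
  have Dn: "norm (eval_fps (fps_deriv (P x)) e - 1) \<le> 1/2" if x: "x \<in> ball 0 r" and e: "norm e \<le> H" for x e
  proof -
    have sm: "summable (\<lambda>n. of_nat (Suc n) * c x (Suc n) * e ^ n)"
      by (rule summable_comparison_test'[OF gh]) (rule db[OF x e])
    have "(\<Sum>n. of_nat (Suc n) * c x (Suc n) * e ^ n) = (\<Sum>n. of_nat (Suc (Suc n)) * c x (Suc (Suc n)) * e ^ Suc n) + c x (Suc 0)"
      using suminf_split_head[OF sm] by (simp add: algebra_simps)
    then have "eval_fps (fps_deriv (P x)) e - 1 = (\<Sum>n. of_nat (Suc (Suc n)) * c x (Suc (Suc n)) * e ^ Suc n)"
      unfolding F1s by (simp add: c_def)
    also have "norm \<dots> \<le> (\<Sum>n. (1 / (4 * H)) * (1/2) ^ Suc (Suc n))"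
    proof (rule norm_suminf_le)
      fix n
      have "norm (of_nat (Suc (Suc n)) * c x (Suc (Suc n)) * e ^ Suc n) \<le> 2 ^ Suc (Suc n) * (1/4 * s ^ Suc (Suc n)) * H ^ Suc n"
        unfolding norm_mult norm_power norm_of_nat using c2[OF x, of n] e s of_nat_less_two_power[of "Suc (Suc n)", where 'a=real]
        by (intro mult_mono power_mono) auto
      also have "\<dots> = 2 ^ Suc (Suc n) * (s ^ Suc (Suc n) * H ^ Suc (Suc n)) * (1 / (4 * H))" using H by (simp add: field_simps)
      also have "\<dots> = (1 / (4 * H)) * (1/2) ^ Suc (Suc n)" unfolding sH p24 by (rule mult.commute)
      finally show "norm (of_nat (Suc (Suc n)) * c x (Suc (Suc n)) * e ^ Suc n) \<le> (1 / (4 * H)) * (1/2) ^ Suc (Suc n)" .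
    qed (use g2[of "1 / (4 * H)"] in \<open>simp only: sums_iff\<close>)
    also have "\<dots> = 1 / (4 * H) / 2" using g2[of "1 / (4 * H)"] by (simp only: sums_iff)
    also have "\<dots> \<le> 1/2" using H by (simp add: field_simps)
    finally show ?thesis .
  qed
  show ?thesis
  proof (rule that[of r H h "\<lambda>x. eval_fps (P x)" "\<lambda>x. eval_fps (fps_deriv (P x))" "\<lambda>x. eval_fps (fps_deriv (fps_deriv (P x)))"])
    show "r * (4 * H) \<le> 1" using r(7) H by (simp add: field_simps)
    show "(eval_fps (P x) has_field_derivative eval_fps (fps_deriv (P x)) e) (at e)" if "x \<in> ball 0 r" "e \<in> ball 0 (2*H)" for x e
      by (rule has_field_derivative_eval_fps) (use less_le_trans[OF lt rad[OF that(1)]] that(2) in auto)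
    show "(eval_fps (fps_deriv (P x)) has_field_derivative eval_fps (fps_deriv (fps_deriv (P x))) e) (at e)" if "x \<in> ball 0 r" "e \<in> ball 0 (2*H)" for x e
      by (rule has_field_derivative_eval_fps) (use less_le_trans[OF lt rad1[OF that(1)]] that(2) in auto)
    show "(1 + x * e)\<^sup>2 * eval_fps (fps_deriv (fps_deriv (P x))) e + x * (1 + x * e) * eval_fps (fps_deriv (P x)) e
        = (A * x * (1 + x * e) + m * x\<^sup>2) * eval_fps (P x) e" if x: "x \<in> ball 0 r" and e: "e \<in> ball 0 (2*H)" for x e
    proof -
      have ne: "norm e < 2 * H" using e by simp
      define L where "L = 1 + fps_const x * fps_X"
      have L: "eval_fps L e = 1 + x * e" "fps_conv_radius L = \<infinity>"
      proof -
        have r1: "fps_conv_radius (fps_const x * fps_X) = \<infinity>" using fps_conv_radius_mult[of "fps_const x" fps_X] by simp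
        then show "fps_conv_radius L = \<infinity>" unfolding L_def using fps_conv_radius_add[of 1 "fps_const x * fps_X"] by simp
        show "eval_fps L e = 1 + x * e" unfolding L_def using r1 by (simp add: eval_fps_add eval_fps_mult)
      qed
      have E: "eval_fps (L * G) e = (1 + x * e) * eval_fps G e \<and> ereal (norm e) < fps_conv_radius (L * G)"
        if "ereal (norm e) < fps_conv_radius G" for G
      proof
        show "eval_fps (L * G) e = (1 + x * e) * eval_fps G e" using eval_fps_mult[of e L G] L that by simp
        show "ereal (norm e) < fps_conv_radius (L * G)" using less_le_trans[OF _ fps_conv_radius_mult[of L G]] that L by simp
      qed
      have Cc: "eval_fps (fps_const q * G) e = q * eval_fps G e \<and> ereal (norm e) < fps_conv_radius (fps_const q * G)"
        if "ereal (norm e) < fps_conv_radius G" for G q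
      proof
        show "eval_fps (fps_const q * G) e = q * eval_fps G e" using eval_fps_mult[of e "fps_const q" G] that by simp
        show "ereal (norm e) < fps_conv_radius (fps_const q * G)" using less_le_trans[OF _ fps_conv_radius_mult[of "fps_const q" G]] that by simp
      qed
      note R = less_le_trans[OF lt[OF ne] rad[OF x]] less_le_trans[OF lt[OF ne] rad1[OF x]] less_le_trans[OF lt[OF ne] rad2[OF x]]
      let ?F = "P x" let ?D = "fps_deriv (P x)" let ?DD = "fps_deriv (fps_deriv (P x))"
      have d1: "eval_fps (L * (L * ?DD) + fps_const x * (L * ?D)) e = (1 + x*e) * ((1 + x*e) * eval_fps ?DD e) + x * ((1 + x*e) * eval_fps ?D e)"
        using eval_fps_add[of e "L * (L * ?DD)" "fps_const x * (L * ?D)"] E[OF R(3)] E[OF R(2)] E[of "L * ?DD"] Cc[of "L * ?D" x] by simp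
      have AL: "ereal (norm e) < fps_conv_radius (fps_const A * (L * ?F) + fps_const (m * x) * ?F)"
        using less_le_trans[OF _ fps_conv_radius_add[of "fps_const A * (L * ?F)" "fps_const (m * x) * ?F"]] Cc[OF R(1), of "m * x"] Cc[of "L * ?F" A] E[OF R(1)] by simp
      have d2: "eval_fps (fps_const x * (fps_const A * (L * ?F) + fps_const (m * x) * ?F)) e = x * (A * ((1 + x * e) * eval_fps ?F e) + m * x * eval_fps ?F e)"
        using Cc[OF AL, of x] eval_fps_add[of e "fps_const A * (L * ?F)" "fps_const (m * x) * ?F"] Cc[OF R(1), of "m * x"] Cc[of "L * ?F" A] E[OF R(1)] by simp
      have "L * (L * ?DD) + fps_const x * (L * ?D) = fps_const x * (fps_const A * (L * ?F) + fps_const (m * x) * ?F)"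
        unfolding L_def P_def by (rule nf_series_ode)
      then show ?thesis using d1 d2 by (simp add: power2_eq_square algebra_simps)
    qed
    show "eval_fps (P x) 0 = - \<beta> x" "eval_fps (fps_deriv (P x)) 0 = 1" for x by (auto simp: eval_fps_at_0 Pn c_def)
    show "eval_fps (P x) (h x) = 0" if "x \<in> ball 0 r" for x
    proof -
      have "- \<beta> x + h x + S x (h x) = 0" using h(3)[OF that] by algebra
      then show ?thesis using FS[OF that h(2)[OF that]] by simp
    qed
    show "eval_fps (fps_deriv (P x)) (h x) \<noteq> 0" if "x \<in> ball 0 r" for x
      using Dn[OF that h(2)[OF that]] by auto
    show "(\<lambda>x. eval_fps (fps_deriv (P x)) (h x)) holomorphic_on ball 0 r"
      unfolding F1s by (rule holomorphic_suminf[OF open_ball _ _ gh]) (use db h(2) in \<open>auto intro!: holomorphic_intros ch h(1) simp del: of_nat_Suc\<close>)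
  qed (use r H h in auto)
qed

lemma nonvanishing_ball:
  assumes f: "f holomorphic_on ball 0 R" and R: "0 < R" and nz: "f (0::complex) \<noteq> 0"
  obtains r where "0 < r" "r \<le> R" "\<And>x. x \<in> ball 0 r \<Longrightarrow> f x \<noteq> 0"
proof -
  have "isCont f 0" using f R holomorphic_on_imp_continuous_on continuous_on_interior by (metis centre_in_ball interior_ball)
  then have "eventually (\<lambda>x. f x \<noteq> 0) (nhds 0)"
    using nz by (simp add: isCont_def tendsto_imp_eventually_ne tendsto_at_iff_tendsto_nhds)
  then obtain d where "d > 0" "\<And>x. dist x 0 < d \<Longrightarrow> f x \<noteq> 0" unfolding eventually_nhds_metric by blast
  then show ?thesis using R by (intro that[of "min d R"]) auto
qed

lemma DERIV_comp_exp:
  assumes "f holomorphic_on ball 0 R" "exp w \<in> ball 0 R"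
  shows "((\<lambda>w. f (exp w)) has_field_derivative exp w * deriv f (exp w)) (at w)"
proof -
  have "((\<lambda>w. f (exp w)) has_field_derivative deriv f (exp w) * exp w) (at w)"
    by (rule DERIV_chain2[OF holomorphic_derivI[OF assms(1) open_ball assms(2)] DERIV_exp])
  then show ?thesis by (simp add: mult.commute)
qed

text \<open>\<open>e\<close> is the logarithmic derivative of the point transformation, \<open>\<theta> \<phi> = e \<phi>\<close>, and \<open>k\<close> is the factor with
  \<open>y \<circ> \<phi> = k v\<close>, a constant multiple of \<open>sqrt e\<close>.\<close>
lemma point_transformation:
  fixes A m :: complex
  assumes R: "0 < R" and b: "b holomorphic_on ball 0 R"
    and Q: "\<And>x. x \<in> ball 0 R - {0} \<Longrightarrow> Q x = A / x + b x"
    and h: "al holomorphic_on ball 0 R" "B holomorphic_on ball 0 R" "al 0 = 1"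
    and det: "\<And>x. x \<in> ball 0 R \<Longrightarrow> al x * (al x + x * (B x + x * deriv B x)) - x * B x * (x * deriv al x + B x * (A + x * b x)) = 1"
    and rel1: "\<And>x. x \<in> ball 0 R - {0} \<Longrightarrow>
       x * deriv (\<lambda>x. x * deriv al x + B x * (A + x * b x)) x + (al x + x * (B x + x * deriv B x)) * Q x = (A / x + m) * al x"
    and rel2: "\<And>x. x \<in> ball 0 R - {0} \<Longrightarrow>
       (x * deriv al x + B x * (A + x * b x)) + x * deriv (\<lambda>x. al x + x * (B x + x * deriv B x)) x = (A / x + m) * (x * B x)"
  obtains r h k e where "0 < r" "r \<le> R" "h holomorphic_on ball 0 r" "k holomorphic_on ball 0 r" "e holomorphic_on ball 0 r"
    "\<And>x. x \<in> ball 0 r \<Longrightarrow> e x = 1 - x * deriv (\<lambda>x. x * h x) x / (1 + x * h x)"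
    "\<And>x. x \<in> ball 0 r \<Longrightarrow> k x \<noteq> 0" "\<And>x. x \<in> ball 0 r \<Longrightarrow> e x \<noteq> 0" "\<And>x. x \<in> ball 0 r \<Longrightarrow> norm (x * h x) < 1"
    "\<And>x. x \<in> ball 0 r - {0} \<Longrightarrow> 2 * (x * deriv k x) = k x * (x * deriv e x) / e x"
    "\<And>x. x \<in> ball 0 r - {0} \<Longrightarrow> (A * (1 + x * h x) / x + m) * (e x)\<^sup>2 * k x + (x * deriv k x) * (x * deriv e x) / e x
         = x * deriv (\<lambda>x. x * deriv k x) x + k x * Q x"
proof -
  define ga where "ga = (\<lambda>x. x * deriv al x + B x * (A + x * b x))"
  define de where "de = (\<lambda>x. al x + x * (B x + x * deriv B x))"
  have gah: "ga holomorphic_on ball 0 R" unfolding ga_def using h b by (intro holomorphic_intros) auto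
  have deh: "de holomorphic_on ball 0 R" unfolding de_def using h b by (intro holomorphic_intros) auto
  obtain r0 where r0: "0 < r0" "r0 \<le> R" "\<And>x. x \<in> ball 0 r0 \<Longrightarrow> de x \<noteq> 0"
    by (rule nonvanishing_ball[OF deh R]) (use h in \<open>auto simp: de_def\<close>)
  have "B holomorphic_on ball 0 r0" "de holomorphic_on ball 0 r0"
    using h(2) deh r0 by (auto elim!: holomorphic_on_subset)
  then have "(\<lambda>x. B x / de x) holomorphic_on ball 0 r0" using r0 by (intro holomorphic_intros) auto
  then obtain r1 H h F F1 F2 where r1: "0 < r1" "r1 \<le> r0" "0 < H" "r1 * (4 * H) \<le> 1" and hh: "h holomorphic_on ball 0 r1"
    and hH: "\<And>x. x \<in> ball 0 r1 \<Longrightarrow> norm (h x) \<le> H"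
    and dF: "\<And>x e. x \<in> ball 0 r1 \<Longrightarrow> e \<in> ball 0 (2*H) \<Longrightarrow> (F x has_field_derivative F1 x e) (at e)"
    and dF1: "\<And>x e. x \<in> ball 0 r1 \<Longrightarrow> e \<in> ball 0 (2*H) \<Longrightarrow> (F1 x has_field_derivative F2 x e) (at e)"
    and ode: "\<And>x e. x \<in> ball 0 r1 \<Longrightarrow> e \<in> ball 0 (2*H) \<Longrightarrow>
       (1 + x * e)\<^sup>2 * F2 x e + x * (1 + x * e) * F1 x e = (A * x * (1 + x * e) + m * x\<^sup>2) * F x e"
    and F0: "\<And>x. F x 0 = - (B x / de x)" and F10: "\<And>x. F1 x 0 = 1"
    and Fh: "\<And>x. x \<in> ball 0 r1 \<Longrightarrow> F x (h x) = 0" and F1h: "\<And>x. x \<in> ball 0 r1 \<Longrightarrow> F1 x (h x) \<noteq> 0"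
    and F1hol: "(\<lambda>x. F1 x (h x)) holomorphic_on ball 0 r1"
    by (rule normal_form_displacement[of "\<lambda>x. B x / de x" r0 A m, OF _ r0(1)]) (rule that; assumption)
  have small: "norm (x * e) \<le> 1/2" if "x \<in> ball 0 r1" "norm e \<le> 2 * H" for x e :: complex
  proof -
    have "norm x * norm e \<le> r1 * (2 * H)" using that r1 by (intro mult_mono) auto
    also have "\<dots> \<le> 1/2" using r1(4) by simp
    finally show ?thesis by (simp add: norm_mult)
  qed
  have xh: "norm (x * h x) \<le> 1/2" if "x \<in> ball 0 r1" for x
    by (rule small[OF that]) (use hH[OF that] r1 in simp)
  have one: "1 + z \<noteq> 0 \<and> 1 + z \<notin> \<real>\<^sub>\<le>\<^sub>0 \<and> 1/2 \<le> norm (1 + z)" if "norm z \<le> 1/2" for z :: complex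
  proof -
    have n: "1/2 \<le> norm (1 + z)" using norm_triangle_ineq2[of 1 "- z"] that by simp
    have "\<bar>Re z\<bar> \<le> 1/2" using abs_Re_le_cmod[of z] that by linarith
    then have "Re (1 + z) > 0" by simp
    then show ?thesis using n by (auto simp: complex_nonpos_Reals_iff)
  qed
  define e where "e = (\<lambda>x. 1 - x * deriv (\<lambda>x. x * h x) x / (1 + x * h x))"
  have xhh: "(\<lambda>x. x * h x) holomorphic_on ball 0 r1" by (intro holomorphic_intros hh)
  have eh: "e holomorphic_on ball 0 r1" unfolding e_def using one[OF xh] xhh by (intro holomorphic_intros hh) auto
  obtain r2 where r2: "0 < r2" "r2 \<le> r1" "\<And>x. x \<in> ball 0 r2 \<Longrightarrow> e x \<noteq> 0"
    by (rule nonvanishing_ball[OF eh r1(1)]) (simp add: e_def, (rule that; assumption))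
  \<comment> \<open>\<open>x / (1 + x * t)\<close> is at most twice as large as \<open>x\<close>
    when \<open>x * t\<close> has norm at most 1/2; \<open>R/2\<close> keeps it in the disc.\<close>
  define r where "r = min r2 (R/2)"
  have r: "0 < r" "r \<le> r2" "r \<le> r1" "r \<le> r0" "r \<le> R/2" "r \<le> R" using r2 R r0 r1 by (auto simp: r_def)
  have sub: "ball 0 r \<subseteq> ball (0::complex) r1" "ball 0 r \<subseteq> ball (0::complex) R" using r by auto
  define k where "k = (\<lambda>x. 1 / (de x * (1 + x * h x) * F1 x (h x)))"
  have kh: "k holomorphic_on ball 0 r" unfolding k_def
    using one[OF xh] r0(3) F1h r
    by (intro holomorphic_intros holomorphic_on_subset[OF deh sub(2)] holomorphic_on_subset[OF hh sub(1)] holomorphic_on_subset[OF F1hol sub(1)]) auto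
  have k1h: "(\<lambda>x. x * deriv k x) holomorphic_on ball 0 r" using kh by (intro holomorphic_intros) auto
  have ehr: "e holomorphic_on ball 0 r" by (rule holomorphic_on_subset[OF eh sub(1)])
  let ?H = "{w. Re w < ln R}"
  have qh: "(\<lambda>w. Q (exp w)) holomorphic_on ?H"
  proof -
    have "(\<lambda>x. A / x + b x) holomorphic_on ball 0 R - {0}"
      by (intro holomorphic_intros holomorphic_on_subset[OF b]) auto
    then have Qh: "Q holomorphic_on ball 0 R - {0}" by (rule holomorphic_transform) (use Q in auto)
    have "exp ` ?H \<subseteq> ball 0 R - {0}" by (rule image_subsetI) (simp only: exp_in_punctured_ball[OF R] mem_Collect_eq)
    then show ?thesis using holomorphic_on_compose_gen[OF holomorphic_on_exp Qh, of ?H] by (simp add: o_def)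
  qed
  \<comment> \<open>A relation linear in \<open>(v, d)\<close> valid for every solution; the initial
    values (1, 0) and (0, 1) at \<open>w\<close> later separate it into the two claimed
    identities.\<close>
  have main: "v w * ((A * (1 + x * h x) / x + m) * (e x)\<^sup>2 * k x - x * deriv (\<lambda>x. x * deriv k x) x - k x * Q x + (x * deriv k x) * (x * deriv e x) / e x)
      + d w * (k x * (x * deriv e x) / e x - 2 * (x * deriv k x)) = 0"
    if v: "solution_on ?H (\<lambda>w. Q (exp w)) v d" and w: "Re w < ln r" "x = exp w" for v d w x
  proof -
    define Y where "Y w = al (exp w) * v w + (exp w * B (exp w)) * d w" for w
    define Z where "Z w = ga (exp w) * v w + de (exp w) * d w" for w
    have YZ: "(Y has_field_derivative Z w) (at w)" "(Z has_field_derivative (A / exp w + m) * Y w) (at w)" if w: "Re w < ln R" for w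
    proof -
      have x: "exp w \<in> ball 0 R - {0}" using w exp_in_punctured_ball[OF R] by blast
      then have x': "exp w \<in> ball 0 R" by simp
      have wH: "w \<in> ?H" using w by simp
      note D = solution_onD[OF v wH]
      have "((\<lambda>w. al (exp w) * v w + (exp w * B (exp w)) * d w) has_field_derivative
        ((exp w * deriv al (exp w)) * v w + d w * al (exp w)) +
        ((exp w * B (exp w) + (exp w * deriv B (exp w)) * exp w) * d w + (Q (exp w) * v w) * (exp w * B (exp w)))) (at w)"
        by (intro DERIV_add DERIV_mult D DERIV_comp_exp[OF h(1) x'] DERIV_comp_exp[OF h(2) x'] DERIV_exp)
      moreover have "((exp w * deriv al (exp w)) * v w + d w * al (exp w)) +
        ((exp w * B (exp w) + (exp w * deriv B (exp w)) * exp w) * d w + (Q (exp w) * v w) * (exp w * B (exp w))) = Z w"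
        unfolding Z_def ga_def de_def Q[OF x] by (simp add: algebra_simps)
      ultimately show "(Y has_field_derivative Z w) (at w)" unfolding Y_def by simp
      have "((\<lambda>w. ga (exp w) * v w + de (exp w) * d w) has_field_derivative
        ((exp w * deriv ga (exp w)) * v w + d w * ga (exp w)) + ((exp w * deriv de (exp w)) * d w + (Q (exp w) * v w) * de (exp w))) (at w)"
        by (intro DERIV_add DERIV_mult D DERIV_comp_exp[OF gah x'] DERIV_comp_exp[OF deh x'])
      moreover have "((exp w * deriv ga (exp w)) * v w + d w * ga (exp w)) + ((exp w * deriv de (exp w)) * d w + (Q (exp w) * v w) * de (exp w))
         = (A / exp w + m) * Y w"
      proof -
        have 1: "exp w * deriv ga (exp w) + de (exp w) * Q (exp w) = (A / exp w + m) * al (exp w)"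
          using rel1[OF x] by (simp add: ga_def de_def)
        have 2: "ga (exp w) + exp w * deriv de (exp w) = (A / exp w + m) * (exp w * B (exp w))"
          using rel2[OF x] by (simp add: ga_def de_def)
        have "((exp w * deriv ga (exp w)) * v w + d w * ga (exp w)) + ((exp w * deriv de (exp w)) * d w + (Q (exp w) * v w) * de (exp w))
          = (exp w * deriv ga (exp w) + de (exp w) * Q (exp w)) * v w + (ga (exp w) + exp w * deriv de (exp w)) * d w"
          by (simp add: algebra_simps)
        then show ?thesis unfolding 1 2 Y_def by (simp only: distrib_left mult.assoc)
      qed
      ultimately show "(Z has_field_derivative (A / exp w + m) * Y w) (at w)" unfolding Z_def[abs_def] by (simp only:)
    qed
    define om where "om w = w - Ln (1 + exp w * h (exp w))" for w
    have omR: "Re (w - Ln (1 + x * t)) < ln R \<and> exp (w - Ln (1 + x * t)) = x / (1 + x * t)"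
      if w: "Re w < ln r" "x = exp w" and t: "norm t \<le> 2 * H" for w x t
    proof -
      have x: "x \<in> ball 0 r" using exp_in_punctured_ball[OF r(1), of w] w by simp
      have o: "1 + x * t \<noteq> 0" "1/2 \<le> norm (1 + x * t)" using one[OF small[of x t]] x sub t by auto
      have ex: "exp (w - Ln (1 + x * t)) = x / (1 + x * t)" using o w by (simp add: exp_diff)
      have "norm (x / (1 + x * t)) \<le> norm x / (1/2)" unfolding norm_divide using o by (intro divide_left_mono) auto
      also have "\<dots> < R" using x r by simp
      finally have "exp (w - Ln (1 + x * t)) \<in> ball 0 R - {0}" using ex o(1) w by simp
      then show ?thesis using exp_in_punctured_ball[OF R] ex by blast
    qed
    have key: "Y (om w) = k (exp w) * v w" if w: "Re w < ln r" for w
    proof -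
      define x where "x = exp w"
      have xr: "x \<in> ball 0 r - {0}" using exp_in_punctured_ball[OF r(1), of w] w by (simp add: x_def)
      have x1: "x \<in> ball 0 r1" "x \<in> ball 0 R" "de x \<noteq> 0" using xr sub r r0(3) by auto
      \<comment> \<open>Up to a factor \<open>x\<close>, the Wronskian of two solutions of the
        normal form along the displaced points, the transform \<open>Y\<close> and the series
        \<open>F\<close>; hence constant in \<open>t\<close>. At \<open>t = 0\<close> it is
        \<open>v / de\<close>, and at \<open>t = h x\<close>, where \<open>F\<close> vanishes, it is
        a multiple of \<open>Y\<close> at the new point.\<close>
      define g where "g t = (1 + x * t) * (Y (w - Ln (1 + x * t)) * F1 x t) + x * (Z (w - Ln (1 + x * t)) * F x t)" for t
      have "\<exists>C. \<forall>t\<in>ball 0 (2*H). g t = C"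
      proof (rule has_field_derivative_zero_constant[OF convex_ball])
        fix t :: complex assume t: "t \<in> ball 0 (2*H)"
        then have t': "norm t \<le> 2*H" by simp
        note o = one[OF small[OF x1(1) t']]
        note W = omR[OF w x_def t']
        let ?w = "w - Ln (1 + x * t)"
        have dw: "((\<lambda>t. w - Ln (1 + x * t)) has_field_derivative - (x / (1 + x * t))) (at t)"
          using o by (auto intro!: derivative_eq_intros simp: field_simps)
        have dY: "((\<lambda>t. Y (w - Ln (1 + x * t))) has_field_derivative Z ?w * - (x / (1 + x * t))) (at t)"
          by (rule DERIV_chain2[OF YZ(1) dw]) (use W in simp)
        have dZ: "((\<lambda>t. Z (w - Ln (1 + x * t))) has_field_derivative ((A / exp ?w + m) * Y ?w) * - (x / (1 + x * t))) (at t)"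
          by (rule DERIV_chain2[OF YZ(2) dw]) (use W in simp)
        have dl: "((\<lambda>t. 1 + x * t) has_field_derivative x) (at t)" by (auto intro!: derivative_eq_intros)
        have "(g has_field_derivative (x * (Y ?w * F1 x t) + ((Z ?w * - (x / (1 + x * t))) * F1 x t + F2 x t * Y ?w) * (1 + x * t))
            + x * (((A / exp ?w + m) * Y ?w) * - (x / (1 + x * t)) * F x t + F1 x t * Z ?w)) (at t)"
          unfolding g_def by (intro DERIV_add DERIV_mult[OF dl] DERIV_mult[OF dY dF1[OF x1(1) t]] DERIV_cmult DERIV_mult[OF dZ dF[OF x1(1) t]])
        moreover have "(x * (Y ?w * F1 x t) + ((Z ?w * - (x / (1 + x * t))) * F1 x t + F2 x t * Y ?w) * (1 + x * t))
            + x * (((A / exp ?w + m) * Y ?w) * - (x / (1 + x * t)) * F x t + F1 x t * Z ?w) = 0" (is "?D = 0")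
        proof -
          have AQ: "A / exp ?w = A * (1 + x * t) / x" using W by (simp add: field_simps)
          define l where "l = 1 + x * t"
          have l: "l \<noteq> 0" "x \<noteq> 0" using o xr by (auto simp: l_def)
          have ode': "l\<^sup>2 * F2 x t + x * l * F1 x t - (A * x * l + m * x\<^sup>2) * F x t = 0"
            using ode[OF x1(1) t] by (simp add: l_def)
          have "l * ?D = Y ?w * (l\<^sup>2 * F2 x t + x * l * F1 x t - (A * x * l + m * x\<^sup>2) * F x t)"
            unfolding AQ unfolding l_def[symmetric] using l by (simp add: field_simps power2_eq_square)
          then show ?thesis unfolding ode' using l by simp
        qed
        ultimately show "(g has_field_derivative 0) (at t within ball 0 (2*H))"
          by (metis has_field_derivative_at_within)
      qed
      then have "g (h x) = g 0" using hH[OF x1(1)] r1(3) by auto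
      moreover have "g 0 = Y w - x * Z w * (B x / de x)" by (simp add: g_def F0 F10)
      moreover have "\<dots> = v w / de x"
      proof -
        have "de x * (Y w - x * Z w * (B x / de x)) = v w * (al x * de x - x * B x * ga x)"
          using x1(3) by (simp add: Y_def Z_def x_def[symmetric] field_simps)
        also have "\<dots> = v w" using det[OF x1(2)] by (simp add: ga_def de_def)
        finally have "de x * (Y w - x * Z w * (B x / de x)) = v w" .
        then have "(Y w - x * Z w * (B x / de x)) * de x = v w" by (simp only: mult.commute)
        then show ?thesis unfolding nonzero_eq_divide_eq[OF x1(3)] .
      qed
      moreover have "g (h x) = (1 + x * h x) * F1 x (h x) * Y (om w)"
        by (simp add: g_def Fh[OF x1(1)] om_def x_def[symmetric])
      ultimately have "(1 + x * h x) * F1 x (h x) * Y (om w) = v w / de x" by simp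
      moreover define l f where "l = 1 + x * h x" and "f = F1 x (h x)"
      ultimately have *: "l * f * Y (om w) = v w / de x" by simp
      have "l \<noteq> 0" "f \<noteq> 0" using F1h[OF x1(1)] one[OF xh[OF x1(1)]] by (auto simp: l_def f_def)
      then have "Y (om w) = 1 / (de x * l * f) * v w" using * x1(3) by (simp add: field_simps)
      then show ?thesis by (simp add: k_def x_def[symmetric] l_def f_def)
    qed
    have oH: "open {w. Re w < ln r}" by (rule open_halfspace_Re_lt)
    have HR: "Re w < ln R" if "Re w < ln r" for w using that r by (meson ln_le_cancel_iff less_le_trans R)
    have dom: "(om has_field_derivative e (exp w)) (at w)" if w: "Re w < ln r" for w
    proof -
      have x: "exp w \<in> ball 0 r1" using exp_in_punctured_ball[OF r(1), of w] w sub by blast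
      note o = one[OF xh[OF x]]
      have "((\<lambda>w. 1 + exp w * h (exp w)) has_field_derivative 0 + exp w * deriv (\<lambda>x. x * h x) (exp w)) (at w)"
        by (intro DERIV_add DERIV_const DERIV_comp_exp[OF xhh x])
      then have "((\<lambda>w. Ln (1 + exp w * h (exp w))) has_field_derivative inverse (1 + exp w * h (exp w)) * (0 + exp w * deriv (\<lambda>x. x * h x) (exp w))) (at w)"
        by (rule DERIV_chain2[OF has_field_derivative_Ln, rotated]) (use o in auto)
      then have "((\<lambda>w. w - Ln (1 + exp w * h (exp w))) has_field_derivative 1 - inverse (1 + exp w * h (exp w)) * (0 + exp w * deriv (\<lambda>x. x * h x) (exp w))) (at w)"
        by (intro DERIV_diff DERIV_ident)
      then show ?thesis by (simp add: om_def[abs_def] e_def field_simps)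
    qed
    \<comment> \<open>Differentiating \<open>Y (om w) = k v\<close> brings in the factor
      \<open>e\<close>; differentiating the result once more yields the relation sought.\<close>
    have k1: "Z (om w) = ((exp w * deriv k (exp w)) * v w + k (exp w) * d w) / e (exp w)" if w: "Re w < ln r" for w
    proof -
      have x: "exp w \<in> ball 0 r" using exp_in_punctured_ball[OF r(1), of w] w by blast
      have "exp w \<in> ball 0 r1" using x sub by blast
      then have hx: "norm (h (exp w)) \<le> 2 * H" using hH[of "exp w"] r1(3) by linarith
      have "((\<lambda>w. Y (om w)) has_field_derivative Z (om w) * e (exp w)) (at w)"
        by (rule DERIV_chain2[OF YZ(1) dom[OF w]])
           (use omR[OF w refl hx] in \<open>simp add: om_def\<close>)
      then have "((\<lambda>w. k (exp w) * v w) has_field_derivative Z (om w) * e (exp w)) (at w)"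
        by (rule has_field_derivative_transform_within_open[OF _ oH]) (use key w in auto)
      moreover have "((\<lambda>w. k (exp w) * v w) has_field_derivative (exp w * deriv k (exp w)) * v w + d w * k (exp w)) (at w)"
        by (intro DERIV_mult DERIV_comp_exp[OF kh x] solution_onD(1)[OF v]) (use HR w in auto)
      ultimately have "Z (om w) * e (exp w) = (exp w * deriv k (exp w)) * v w + d w * k (exp w)" by (rule DERIV_unique)
      then show ?thesis using r2(3)[of "exp w"] x r by (auto simp: field_simps)
    qed
    have x: "x \<in> ball 0 r - {0}" unfolding w(2) using exp_in_punctured_ball[OF r(1), of w] w(1) by blast
    then have x': "exp w \<in> ball 0 r" using w by auto
    have e0: "e x \<noteq> 0" using r2(3)[of x] x r by auto
    have Wo: "Re (om w) < ln R" "exp (om w) = x / (1 + x * h x)"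
    proof -
      have "x \<in> ball 0 r1" using x sub by blast
      then have "norm (h x) \<le> 2 * H" using hH[of x] r1(3) by linarith
      then show "Re (om w) < ln R" "exp (om w) = x / (1 + x * h x)"
        using omR[OF w, of "h x"] by (simp_all add: om_def w(2))
    qed
    have "((\<lambda>w. Z (om w)) has_field_derivative ((A / exp (om w) + m) * Y (om w)) * e (exp w)) (at w)"
      by (rule DERIV_chain2[OF YZ(2) dom[OF w(1)]]) (rule Wo)
    then have "((\<lambda>w. ((exp w * deriv k (exp w)) * v w + k (exp w) * d w) / e (exp w)) has_field_derivative ((A / exp (om w) + m) * Y (om w)) * e (exp w)) (at w)"
      by (rule has_field_derivative_transform_within_open[OF _ oH]) (use k1 w in auto)
    moreover have "((\<lambda>w. ((exp w * deriv k (exp w)) * v w + k (exp w) * d w) / e (exp w)) has_field_derivative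
       ((((exp w * deriv (\<lambda>x. x * deriv k x) (exp w)) * v w + d w * (exp w * deriv k (exp w))) + ((exp w * deriv k (exp w)) * d w + (Q (exp w) * v w) * k (exp w))) * e (exp w)
        - ((exp w * deriv k (exp w)) * v w + k (exp w) * d w) * (exp w * deriv e (exp w))) / (e (exp w) * e (exp w))) (at w)"
      by (intro DERIV_divide DERIV_add DERIV_mult DERIV_comp_exp[OF kh x'] DERIV_comp_exp[OF k1h x'] DERIV_comp_exp[OF ehr x'] solution_onD[OF v])
         (use HR w e0 in auto)
    ultimately have "((A / exp (om w) + m) * Y (om w)) * e (exp w) =
       ((((exp w * deriv (\<lambda>x. x * deriv k x) (exp w)) * v w + d w * (exp w * deriv k (exp w))) + ((exp w * deriv k (exp w)) * d w + (Q (exp w) * v w) * k (exp w))) * e (exp w)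
        - ((exp w * deriv k (exp w)) * v w + k (exp w) * d w) * (exp w * deriv e (exp w))) / (e (exp w) * e (exp w))" (is "?L = ?N / _")
      by (rule DERIV_unique)
    then have "?L * (e x * e x) = ?N" using e0 w(2) by (simp add: field_simps)
    moreover have "A / exp (om w) = A * (1 + x * h x) / x" using Wo by simp
    ultimately have eq: "(A * (1 + x * h x) / x + m) * (k x * v w) * e x * (e x * e x) =
       ((x * deriv (\<lambda>x. x * deriv k x) x * v w + d w * (x * deriv k x)) + ((x * deriv k x) * d w + (Q x * v w) * k x)) * e x
        - ((x * deriv k x) * v w + k x * d w) * (x * deriv e x)"
      using key[OF w(1)] w(2) by simp
    define q where "q = A * (1 + x * h x) / x + m"
    define p1 where "p1 = x * deriv k x"
    define p2 where "p2 = x * deriv (\<lambda>x. x * deriv k x) x"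
    define e1 where "e1 = x * deriv e x"
    have "e x * (v w * (q * (e x)\<^sup>2 * k x - p2 - k x * Q x + p1 * e1 / e x) + d w * (k x * e1 / e x - 2 * p1))
       = q * (k x * v w) * e x * (e x * e x) - (((p2 * v w + d w * p1) + (p1 * d w + (Q x * v w) * k x)) * e x - (p1 * v w + k x * d w) * e1)"
      using e0 by (simp add: field_simps power2_eq_square)
    also have "\<dots> = 0" using eq unfolding q_def p1_def p2_def e1_def by simp
    finally show ?thesis using e0 unfolding q_def p1_def p2_def e1_def by simp
  qed
  have both: "2 * (x * deriv k x) = k x * (x * deriv e x) / e x"
     "(A * (1 + x * h x) / x + m) * (e x)\<^sup>2 * k x + (x * deriv k x) * (x * deriv e x) / e x = x * deriv (\<lambda>x. x * deriv k x) x + k x * Q x"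
    if x: "x \<in> ball 0 r - {0}" for x
  proof -
    obtain w where w: "x = exp w" "Re w < ln r" using punctured_ball_cases[OF r(1) x] by blast
    have wR: "Re w < ln R" using w(2) r by (meson ln_le_cancel_iff less_le_trans R)
    obtain v1 d1 where v1: "solution_on ?H (\<lambda>w. Q (exp w)) v1 d1" "v1 w = 1" "d1 w = 0"
      using linear_ode_exists_halfplane[OF qh wR] by metis
    obtain v2 d2 where v2: "solution_on ?H (\<lambda>w. Q (exp w)) v2 d2" "v2 w = 0" "d2 w = 1"
      using linear_ode_exists_halfplane[OF qh wR] by metis
    show "(A * (1 + x * h x) / x + m) * (e x)\<^sup>2 * k x + (x * deriv k x) * (x * deriv e x) / e x = x * deriv (\<lambda>x. x * deriv k x) x + k x * Q x"
      using main[OF v1(1) w(2,1)] v1 by (simp add: algebra_simps)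
    show "2 * (x * deriv k x) = k x * (x * deriv e x) / e x"
      using main[OF v2(1) w(2,1)] v2 by simp
  qed
  show ?thesis
  proof (rule that[of r h k e, OF r(1) r(6) holomorphic_on_subset[OF hh sub(1)] kh ehr])
    show "e x = 1 - x * deriv (\<lambda>x. x * h x) x / (1 + x * h x)" for x by (simp add: e_def)
    fix x :: complex assume x: "x \<in> ball 0 r"
    then have x1: "x \<in> ball 0 r1" "x \<in> ball 0 r2" "x \<in> ball 0 r0" using r by auto
    show "k x \<noteq> 0" using F1h[OF x1(1)] one[OF xh[OF x1(1)]] r0(3)[OF x1(3)] by (simp add: k_def)
    show "e x \<noteq> 0" by (rule r2(3)[OF x1(2)])
    show "norm (x * h x) < 1" using xh[OF x1(1)] by simp
  qed (use both in auto)
qed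

subsection \<open>Reduction to the normal form\<close>

text \<open>The factor \<open>x^2\<close> of \<open>delta1\<close> makes the condition at 0 empty
  for such coefficients, so only points \<open>x \<noteq> 0\<close> require work.\<close>

lemma solves_at_0:
  assumes "p 0 = 0" "q 0 = 0"
  shows "delta1 (delta1 y) 0 - p 0 * delta1 y 0 - q 0 * y 0 = 0"
  using assms by (simp add: delta1_def)

text \<open>\<open>delta1\<close> is x \<theta>, and its square is x^2 (\<theta>^2 +
  \<theta>).\<close>

lemma theta_operator_form:
  assumes y: "y holomorphic_on U" and U: "open U" and x: "x \<in> U" "x \<noteq> 0"
  shows "delta1 (delta1 y) x - p x * delta1 y x - q x * y x
    = x\<^sup>2 * (x * deriv (\<lambda>x. x * deriv y x) x + x * deriv y x - p x / x * (x * deriv y x) - q x / x\<^sup>2 * y x)"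
proof -
  have dy: "deriv y holomorphic_on U" by (rule holomorphic_deriv[OF y U])
  note d = holomorphic_derivI[OF dy U x(1)]
  have 1: "((\<lambda>x. x * deriv y x) has_field_derivative 1 * deriv y x + deriv (deriv y) x * x) (at x)"
    by (intro DERIV_mult DERIV_ident d)
  have 2: "((\<lambda>x. x\<^sup>2 * deriv y x) has_field_derivative (2 * x) * deriv y x + deriv (deriv y) x * x\<^sup>2) (at x)"
    by (rule DERIV_mult[OF _ d]) (auto intro!: derivative_eq_intros)
  show ?thesis unfolding delta1_def DERIV_imp_deriv[OF 1] DERIV_imp_deriv[OF 2]
    using x(2) by (simp add: field_simps power2_eq_square)
qed

lemma theta_chain:
  fixes ph Y f :: "complex \<Rightarrow> complex"
  assumes V: "open V" "Y holomorphic_on V" and U: "open U" "x \<in> U" "\<And>x. x \<in> U \<Longrightarrow> ph x \<in> V"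
    and ph: "ph holomorphic_on U" "ph x \<noteq> 0" "x \<noteq> 0"
    and e: "x * deriv ph x = e * ph x" "e \<noteq> 0"
    and eq: "\<And>x. x \<in> U \<Longrightarrow> Y (ph x) = f x" and f: "(f has_field_derivative f') (at x)"
  shows "ph x * deriv Y (ph x) = x * f' / e"
proof -
  have "((\<lambda>x. Y (ph x)) has_field_derivative deriv Y (ph x) * deriv ph x) (at x)"
    by (rule DERIV_chain2[OF holomorphic_derivI[OF V(2,1) U(3)[OF U(2)]] holomorphic_derivI[OF ph(1) U(1,2)]])
  then have "(f has_field_derivative deriv Y (ph x) * deriv ph x) (at x)"
    by (rule has_field_derivative_transform_within_open[OF _ U(1,2)]) (rule eq)
  then have "f' = deriv Y (ph x) * deriv ph x" using f DERIV_unique by blast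
  then have "x * f' = deriv Y (ph x) * (x * deriv ph x)" by (simp add: mult_ac)
  then show ?thesis unfolding e(1) using e(2) by (simp add: mult_ac)
qed

text \<open>The target operator applied to \<open>t * y\<close> is expanded in \<theta>^2 y,
  \<theta> y and y. After division by \<open>t / e^2\<close>, \<open>C1\<close> matches the
  coefficient of \<theta> y and \<open>C2\<close> that of y, so at every \<open>x \<noteq> 0\<close>
  the two operators differ by a nonzero factor for arbitrary holomorphic \<open>y\<close>.\<close>

lemma analytically_equivalent_nfI:
  fixes ph t e :: "complex \<Rightarrow> complex"
  assumes r: "0 < r" and ph: "ph holomorphic_on ball 0 r" "inj_on ph (ball 0 r)" "ph 0 = 0"
    and t: "t holomorphic_on ball 0 r" "\<And>x. x \<in> ball 0 r \<Longrightarrow> t x \<noteq> 0"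
    and e: "e holomorphic_on ball 0 r" "\<And>x. x \<in> ball 0 r \<Longrightarrow> e x \<noteq> 0"
    and pq: "p 0 = 0" "q 0 = 0"
    and eph: "\<And>x. x \<in> ball 0 r - {0} \<Longrightarrow> x * deriv ph x = e x * ph x"
    and C1: "\<And>x. x \<in> ball 0 r - {0} \<Longrightarrow> 2 * (x * deriv t x) = t x * ((p1 - 1) * e x + x * deriv e x / e x - p x / x + 1)"
    and C2: "\<And>x. x \<in> ball 0 r - {0} \<Longrightarrow> t x * ((e x)\<^sup>2 * (1 / (4 * ph x) + q2)) + (p1 - 1) * e x * (x * deriv t x)
        + (x * deriv e x / e x) * (x * deriv t x) - x * deriv (\<lambda>x. x * deriv t x) x = t x * (q x / x\<^sup>2)"
  shows "analytically_equivalent p q (nf_p p1) (nf_q q2)"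
  unfolding analytically_equivalent_def
proof (rule exI[of _ ph], rule exI[of _ t], rule exI[of _ r], intro conjI ballI allI impI)
  fix U :: "complex set" and y :: "complex \<Rightarrow> complex" assume U: "open U" "U \<subseteq> ball 0 r"
  define ps where "ps = inv_into (ball 0 r) ph"
  define Y where "Y z = t (ps z) * y (ps z)" for z
  have ps: "ps (ph x) = x" if "x \<in> U" for x :: complex unfolding ps_def using that U ph(2) by (intro inv_into_f_f) auto
  have Yph: "Y (ph x) = t x * y x" if "x \<in> U" for x :: complex using ps[OF that] by (simp add: Y_def)
  have phU: "ph holomorphic_on U" "inj_on ph U" using ph U by (auto intro: holomorphic_on_subset inj_on_subset)
  have oV: "open (ph ` U)" by (rule open_mapping_thm3[OF phU(1) U(1) phU(2)])
  have tU: "t holomorphic_on U" using t U by (auto intro: holomorphic_on_subset)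
  have hol: "Y holomorphic_on ph ` U \<longleftrightarrow> y holomorphic_on U"
  proof
    assume "Y holomorphic_on ph ` U"
    then have "(\<lambda>x. Y (ph x)) holomorphic_on U"
      using holomorphic_on_compose_gen[OF phU(1)] by (auto simp: o_def)
    then have "(\<lambda>x. Y (ph x) / t x) holomorphic_on U" using tU t(2) U by (intro holomorphic_intros) auto
    then show "y holomorphic_on U" by (rule holomorphic_transform) (use Yph t(2) U in auto)
  next
    assume y: "y holomorphic_on U"
    obtain g where g: "g holomorphic_on ph ` U" "\<And>z. z \<in> U \<Longrightarrow> g (ph z) = z"
      using holomorphic_has_inverse[OF phU(1) U(1) phU(2)] by metis
    have "(\<lambda>x. t x * y x) holomorphic_on U" by (intro holomorphic_intros tU y)
    moreover have "g ` ph ` U \<subseteq> U" using g(2) by auto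
    ultimately have "(\<lambda>z. t (g z) * y (g z)) holomorphic_on ph ` U"
      using holomorphic_on_compose_gen[OF g(1), of "\<lambda>x. t x * y x" U] g(2) by (auto simp: o_def)
    then show "Y holomorphic_on ph ` U" by (rule holomorphic_transform) (use g(2) ps in \<open>auto simp: Y_def\<close>)
  qed
  have ode: "delta1 (delta1 Y) (ph x) - nf_p p1 (ph x) * delta1 Y (ph x) - nf_q q2 (ph x) * Y (ph x) = 0 \<longleftrightarrow>
      delta1 (delta1 y) x - p x * delta1 y x - q x * y x = 0"
    if y: "y holomorphic_on U" and Yh: "Y holomorphic_on ph ` U" and x: "x \<in> U" for x
  proof (cases "x = 0")
    case True
    then show ?thesis using solves_at_0[of p q y, OF pq] solves_at_0[of "nf_p p1" "nf_q q2" Y] ph(3) by (simp add: nf_p_def nf_q_def)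
  next
    case False
    define W where "W = U - {0}"
    have W: "open W" "x \<in> W" using U x False by (auto simp: W_def)
    have WU: "z \<in> U" "z \<in> ball 0 r - {0}" "z \<noteq> 0" "ph z \<noteq> 0" "e z \<noteq> 0" "t z \<noteq> 0" if "z \<in> W" for z
    proof -
      show "z \<in> U" "z \<in> ball 0 r - {0}" "z \<noteq> 0" using that U by (auto simp: W_def)
      then show "ph z \<noteq> 0" using inj_onD[OF ph(2), of z 0] ph(3) r by auto
      show "e z \<noteq> 0" "t z \<noteq> 0" using \<open>z \<in> ball 0 r - {0}\<close> e(2) t(2) by auto
    qed
    have WWU: "W \<subseteq> U" "W \<subseteq> ball 0 r" using U by (auto simp: W_def)
    have hW: "y holomorphic_on W" "ph holomorphic_on W" "t holomorphic_on W" "e holomorphic_on W"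
      using y phU(1) tU e(1) WWU by (auto intro: holomorphic_on_subset)
    define f where "f z = t z * y z" for z
    have fh: "f holomorphic_on W" unfolding f_def by (intro holomorphic_intros hW)
    define Tf where "Tf z = z * deriv f z" for z
    have Tfh: "Tf holomorphic_on W" unfolding Tf_def by (intro holomorphic_intros holomorphic_deriv fh W)
    have dY: "ph z * deriv Y (ph z) = Tf z / e z" if z: "z \<in> W" for z
      unfolding Tf_def
      by (rule theta_chain[OF oV Yh W(1) z _ hW(2) WU(4,3)[OF z] eph[OF WU(2)[OF z]] WU(5)[OF z] _ holomorphic_derivI[OF fh W(1) z]])
         (use WU Yph in \<open>auto simp: f_def\<close>)
    define YY where "YY z = z * deriv Y z" for z
    have YYh: "YY holomorphic_on ph ` U" unfolding YY_def by (intro holomorphic_intros holomorphic_deriv Yh oV)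
    have dTe: "((\<lambda>z. Tf z / e z) has_field_derivative (deriv Tf x * e x - Tf x * deriv e x) / (e x * e x)) (at x)"
      by (intro DERIV_divide holomorphic_derivI[OF Tfh W] holomorphic_derivI[OF hW(4) W] WU(5)[OF W(2)])
    have dYY: "ph x * deriv YY (ph x) = x * ((deriv Tf x * e x - Tf x * deriv e x) / (e x * e x)) / e x"
      by (rule theta_chain[OF oV YYh W _ hW(2) WU(4,3)[OF W(2)] eph[OF WU(2)[OF W(2)]] WU(5)[OF W(2)] _ dTe])
         (use WU dY in \<open>auto simp: YY_def\<close>)
    have df: "deriv f z = deriv t z * y z + t z * deriv y z" if "z \<in> W" for z
      using DERIV_imp_deriv[OF DERIV_mult[OF holomorphic_derivI[OF hW(3) W(1) that] holomorphic_derivI[OF hW(1) W(1) that]]]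
      by (simp add: f_def[abs_def] mult.commute)
    define t1 where "t1 z = z * deriv t z" for z
    define y1 where "y1 z = z * deriv y z" for z
    have t1h: "t1 holomorphic_on W" "y1 holomorphic_on W" unfolding t1_def y1_def by (intro holomorphic_intros holomorphic_deriv hW W)+
    have Tf: "Tf z = t1 z * y z + t z * y1 z" if "z \<in> W" for z
      using df[OF that] by (simp add: Tf_def t1_def y1_def algebra_simps)
    have "((\<lambda>z. t1 z * y z + t z * y1 z) has_field_derivative (deriv t1 x * y x + deriv y x * t1 x) + (deriv t x * y1 x + deriv y1 x * t x)) (at x)"
      by (intro DERIV_add DERIV_mult holomorphic_derivI[OF hW(3) W] holomorphic_derivI[OF hW(1) W] holomorphic_derivI[OF t1h(1) W] holomorphic_derivI[OF t1h(2) W])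
    then have "(Tf has_field_derivative (deriv t1 x * y x + deriv y x * t1 x) + (deriv t x * y1 x + deriv y1 x * t x)) (at x)"
      by (rule has_field_derivative_transform_within_open[OF _ W]) (use Tf in auto)
    then have dTf: "x * deriv Tf x = (x * deriv t1 x) * y x + 2 * t1 x * y1 x + t x * (x * deriv y1 x)"
      by (simp add: DERIV_imp_deriv t1_def y1_def algebra_simps)
    have L1: "delta1 (delta1 y) x - p x * delta1 y x - q x * y x
       = x\<^sup>2 * (x * deriv y1 x + y1 x - p x / x * y1 x - q x / x\<^sup>2 * y x)"
      using theta_operator_form[OF hW(1) W WU(3)[OF W(2)], of p q] by (simp add: y1_def[abs_def])
    have pV: "ph x \<in> ph ` U" using x by auto
    have YYx: "ph x * deriv Y (ph x) = Tf x / e x" by (rule dY[OF W(2)])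
    have L2: "delta1 (delta1 Y) (ph x) - nf_p p1 (ph x) * delta1 Y (ph x) - nf_q q2 (ph x) * Y (ph x)
       = (ph x)\<^sup>2 * (x * ((deriv Tf x * e x - Tf x * deriv e x) / (e x * e x)) / e x + Tf x / e x - p1 * (Tf x / e x) - (1 / (4 * ph x) + q2) * (t x * y x))"
    proof -
      have "delta1 (delta1 Y) (ph x) - nf_p p1 (ph x) * delta1 Y (ph x) - nf_q q2 (ph x) * Y (ph x)
        = (ph x)\<^sup>2 * (ph x * deriv YY (ph x) + ph x * deriv Y (ph x) - nf_p p1 (ph x) / ph x * (ph x * deriv Y (ph x)) - nf_q q2 (ph x) / (ph x)\<^sup>2 * Y (ph x))"
        using theta_operator_form[OF Yh oV pV WU(4)[OF W(2)], of "nf_p p1" "nf_q q2"] by (simp add: YY_def[abs_def])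
      moreover have "nf_p p1 (ph x) / ph x = p1" "nf_q q2 (ph x) / (ph x)\<^sup>2 = 1 / (4 * ph x) + q2"
        using WU(4)[OF W(2)] by (auto simp: nf_p_def nf_q_def field_simps power2_eq_square)
      ultimately show ?thesis unfolding dYY YYx Yph[OF x] by simp
    qed
    define E where "E = e x" define e1 where "e1 = x * deriv e x" define T2 where "T2 = x * deriv t1 x" define c where "c = 1 / (4 * ph x) + q2"
    have E0: "E \<noteq> 0" using WU(5)[OF W(2)] by (simp add: E_def)
    have c1: "2 * t1 x = t x * ((p1 - 1) * E + e1 / E - p x / x + 1)"
      using C1[OF WU(2)[OF W(2)]] by (simp add: t1_def E_def e1_def)
    have c2: "t x * (E\<^sup>2 * c) + (p1 - 1) * E * t1 x + e1 / E * t1 x - T2 = t x * (q x / x\<^sup>2)"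
      using C2[OF WU(2)[OF W(2)]] by (simp add: t1_def[abs_def] E_def e1_def c_def T2_def)
    have "x * ((deriv Tf x * e x - Tf x * deriv e x) / (e x * e x)) / e x = ((x * deriv Tf x) * E - Tf x * e1) / (E * E * E)"
      by (simp add: E_def e1_def algebra_simps)
    also have "\<dots> + Tf x / E - p1 * (Tf x / E) - c * (t x * y x) =
       (t x * (x * deriv y1 x) + y1 x * (2 * t1 x - t x * ((p1 - 1) * E + e1 / E)) - y x * (t x * (E\<^sup>2 * c) + (p1 - 1) * E * t1 x + e1 / E * t1 x - T2)) / E\<^sup>2"
      unfolding dTf Tf[OF W(2)] T2_def[symmetric] using E0 by (simp add: field_simps power2_eq_square)
    also have "\<dots> = t x / E\<^sup>2 * (x * deriv y1 x + y1 x - p x / x * y1 x - q x / x\<^sup>2 * y x)"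
      unfolding c1 c2 by (simp add: algebra_simps add_divide_distrib diff_divide_distrib)
    finally have "delta1 (delta1 Y) (ph x) - nf_p p1 (ph x) * delta1 Y (ph x) - nf_q q2 (ph x) * Y (ph x)
      = (ph x)\<^sup>2 * (t x / E\<^sup>2) * (x * deriv y1 x + y1 x - p x / x * y1 x - q x / x\<^sup>2 * y x)"
      unfolding L2 by (simp add: E_def c_def mult.assoc)
    then show ?thesis unfolding L1 using WU[OF W(2)] E0 by simp
  qed
  show "solves p q U y \<longleftrightarrow> solves (nf_p p1) (nf_q q2) (ph ` U) (\<lambda>z. t (inv_into (ball 0 r) ph z) * y (inv_into (ball 0 r) ph z))"
    unfolding solves_def Y_def[abs_def, unfolded ps_def, symmetric] using hol ode by auto
qed (use r ph t in auto)

lemma floquet_gauge: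
  fixes A a :: complex
  assumes R: "0 < R" and b: "b holomorphic_on ball 0 R" and A: "A \<noteq> 0" and a: "Re a \<le> 0"
    and Q: "\<And>x. x \<in> ball 0 R - {0} \<Longrightarrow> Q x = A / x + b x"
    and v: "solution_on {w. Re w < ln R} (\<lambda>w. Q (exp w)) v d"
    and vper: "\<And>w. Re w < ln R \<Longrightarrow> v (w + 2 * of_real pi * \<i>) = exp (2 * of_real pi * \<i> * a) * v w"
    and nz: "Re w1 < ln R" "v w1 \<noteq> 0"
  obtains r al B where "0 < r" "r \<le> R" "al holomorphic_on ball 0 r" "B holomorphic_on ball 0 r" "al 0 = 1"
    "\<And>x. x \<in> ball 0 r \<Longrightarrow> al x * (al x + x * (B x + x * deriv B x)) - x * B x * (x * deriv al x + B x * (A + x * b x)) = 1"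
    "\<And>x. x \<in> ball 0 r - {0} \<Longrightarrow>
       x * deriv (\<lambda>x. x * deriv al x + B x * (A + x * b x)) x + (al x + x * (B x + x * deriv B x)) * Q x = (A / x + a\<^sup>2) * al x"
    "\<And>x. x \<in> ball 0 r - {0} \<Longrightarrow>
       (x * deriv al x + B x * (A + x * b x)) + x * deriv (\<lambda>x. al x + x * (B x + x * deriv B x)) x = (A / x + a\<^sup>2) * (x * B x)"
proof -
  have "(\<lambda>x. A / x + b x) holomorphic_on ball 0 R - {0}" by (intro holomorphic_intros holomorphic_on_subset[OF b]) auto
  then have Qh: "Q holomorphic_on ball 0 R - {0}" by (rule holomorphic_transform) (use Q in auto)
  obtain G11 G12 G21 G22 k and j :: nat where G:
    "\<And>x. x \<in> ball 0 R - {0} \<Longrightarrow> G11 x * G22 x - G12 x * G21 x = 1"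
    "\<And>x. x \<in> ball 0 R - {0} \<Longrightarrow> (G11 has_field_derivative (G21 x - a * G11 x) / x) (at x)"
    "\<And>x. x \<in> ball 0 R - {0} \<Longrightarrow> (G21 has_field_derivative (Q x * G11 x - a * G21 x) / x) (at x)"
    "\<And>x. x \<in> ball 0 R - {0} \<Longrightarrow> (G12 has_field_derivative (G22 x - k * (1/x)^j * G11 x + a * G12 x) / x) (at x)"
    "\<And>x. x \<in> ball 0 R - {0} \<Longrightarrow> (G22 has_field_derivative (Q x * G12 x - k * (1/x)^j * G21 x + a * G22 x) / x) (at x)"
    by (rule floquet_normalisation[OF R Qh a v vper nz]) (assumption | (rule that; assumption))+
  define G where "G i j = (if i then (if j then G22 else G21) else (if j then G12 else G11))" for i j
  have o: "open (ball (0::complex) R - {0})" by auto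
  have hol: "G i j holomorphic_on ball 0 R - {0}" for i j
  proof -
    have "G11 holomorphic_on ball 0 R - {0}" using G(2) unfolding holomorphic_on_open[OF o] by blast
    moreover have "G21 holomorphic_on ball 0 R - {0}" using G(3) unfolding holomorphic_on_open[OF o] by blast
    moreover have "G12 holomorphic_on ball 0 R - {0}" using G(4) unfolding holomorphic_on_open[OF o] by blast
    moreover have "G22 holomorphic_on ball 0 R - {0}" using G(5) unfolding holomorphic_on_open[OF o] by blast
    ultimately show ?thesis by (simp add: G_def)
  qed
  have det: "G False False x * G True True x - G False True x * G True False x = 1" if "x \<in> ball 0 R - {0}" for x
    using G(1)[OF that] by (simp add: G_def)
  obtain r1 r2 n t t' s s' y where rr: "cocycle r1 r2 G" "r2 < R"
    and g: "cocycle.glued r1 r2 G n t s" "cocycle.glued r1 r2 G n t' s'"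
    and y: "y \<in> ball 0 r2" "cocycle.wedge t t' y \<noteq> 0"
    by (rule glued_pair_exists[OF R hol det]) (assumption | (rule that; assumption))+
  interpret C: cocycle r1 r2 G by (rule rr)
  have sub: "x \<in> ball 0 R - {0}" if "r1 < norm x" "norm x < r2" for x :: complex using that C.r rr(2) by auto
  interpret F: floquet_cocycle r1 r2 G a k A j b Q
  proof unfold_locales
    fix x :: complex assume x: "r1 < norm x" "norm x < r2"
    show "(G False False has_field_derivative (G True False x - a * G False False x) / x) (at x)" using G(2)[OF sub[OF x]] by (simp add: G_def)
    show "(G True False has_field_derivative (Q x * G False False x - a * G True False x) / x) (at x)" using G(3)[OF sub[OF x]] by (simp add: G_def)
    show "(G False True has_field_derivative (G True True x - k * (1/x)^j * G False False x + a * G False True x) / x) (at x)"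
      using G(4)[OF sub[OF x]] by (simp add: G_def)
    show "(G True True has_field_derivative (Q x * G False True x - k * (1/x)^j * G True False x + a * G True True x) / x) (at x)"
      using G(5)[OF sub[OF x]] by (simp add: G_def)
  next
    show "A \<noteq> 0" by (rule A)
    show "b holomorphic_on ball 0 r2" by (rule holomorphic_on_subset[OF b]) (use rr in auto)
    show "\<And>x. x \<in> ball 0 r2 - {0} \<Longrightarrow> Q x = A / x + b x" using Q rr by auto
  qed
  show ?thesis
    by (rule F.gauge_transformation[OF g y]) (rule that[OF F.r2 less_imp_le[OF rr(2)]]; assumption)
qed

text \<open>The potential required of \<open>v\<close> is what the substitution y = exp (1/2
  \<integral> (pa - 1) dw) v leaves of the equation: q / x^2 + (pa - 1)^2 / 4 - \<theta> pa / 2. The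
  target coefficient is the same formula read backwards for constant \<open>pa\<close> and the
  potential 1/(4 x) + a^2.\<close>

lemma floquet_equivalence:
  fixes a :: complex
  assumes R: "0 < R" and pa: "pa holomorphic_on ball 0 R" and qb: "qb holomorphic_on ball 0 R" and A: "A \<noteq> 0" and a: "Re a \<le> 0"
    and p: "\<And>x. x \<in> ball 0 R \<Longrightarrow> p x = x * pa x" and q: "\<And>x. x \<in> ball 0 R \<Longrightarrow> q x = x * (A + x * qb x)"
    and v: "solution_on {w. Re w < ln R} (\<lambda>w. A / exp w + (qb (exp w) + (pa (exp w) - 1)\<^sup>2 / 4 - exp w * deriv pa (exp w) / 2)) v d"
    and vper: "\<And>w. Re w < ln R \<Longrightarrow> v (w + 2 * of_real pi * \<i>) = exp (2 * of_real pi * \<i> * a) * v w"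
    and nz: "Re w1 < ln R" "v w1 \<noteq> 0"
  shows "analytically_equivalent p q (nf_p (pa 0)) (nf_q (a\<^sup>2 - (pa 0 - 1)\<^sup>2 / 4))"
proof -
  define b where "b x = qb x + (pa x - 1)\<^sup>2 / 4 - x * deriv pa x / 2" for x
  define Q where "Q x = A / x + b x" for x
  have bh: "b holomorphic_on ball 0 R" unfolding b_def by (intro holomorphic_intros holomorphic_deriv pa qb open_ball) auto
  have v': "solution_on {w. Re w < ln R} (\<lambda>w. Q (exp w)) v d" using v unfolding Q_def b_def .
  have QA: "Q x = A / x + b x" if "x \<in> ball 0 R - {0}" for x by (simp add: Q_def)
  obtain r0 al B where r0: "0 < r0" "r0 \<le> R" and g: "al holomorphic_on ball 0 r0" "B holomorphic_on ball 0 r0" "al 0 = 1"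
    "\<And>x. x \<in> ball 0 r0 \<Longrightarrow> al x * (al x + x * (B x + x * deriv B x)) - x * B x * (x * deriv al x + B x * (A + x * b x)) = 1"
    "\<And>x. x \<in> ball 0 r0 - {0} \<Longrightarrow>
       x * deriv (\<lambda>x. x * deriv al x + B x * (A + x * b x)) x + (al x + x * (B x + x * deriv B x)) * Q x = (A / x + a\<^sup>2) * al x"
    "\<And>x. x \<in> ball 0 r0 - {0} \<Longrightarrow>
       (x * deriv al x + B x * (A + x * b x)) + x * deriv (\<lambda>x. al x + x * (B x + x * deriv B x)) x = (A / x + a\<^sup>2) * (x * B x)"
    by (rule floquet_gauge[OF R bh A a QA v' vper nz]) (assumption | (rule that; assumption))+
  have bh0: "b holomorphic_on ball 0 r0" by (rule holomorphic_on_subset[OF bh]) (use r0 in auto)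
  have QA0: "Q x = A / x + b x" if "x \<in> ball 0 r0 - {0}" for x by (simp add: Q_def)
  obtain r1 h k e where r1: "0 < r1" "r1 \<le> r0" and hke: "h holomorphic_on ball 0 r1" "k holomorphic_on ball 0 r1" "e holomorphic_on ball 0 r1"
    and ee: "\<And>x. x \<in> ball 0 r1 \<Longrightarrow> e x = 1 - x * deriv (\<lambda>x. x * h x) x / (1 + x * h x)"
    and knz: "\<And>x. x \<in> ball 0 r1 \<Longrightarrow> k x \<noteq> 0" and enz: "\<And>x. x \<in> ball 0 r1 \<Longrightarrow> e x \<noteq> 0" and xh: "\<And>x. x \<in> ball 0 r1 \<Longrightarrow> norm (x * h x) < 1"
    and E1: "\<And>x. x \<in> ball 0 r1 - {0} \<Longrightarrow> 2 * (x * deriv k x) = k x * (x * deriv e x) / e x"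
    and E2: "\<And>x. x \<in> ball 0 r1 - {0} \<Longrightarrow> (A * (1 + x * h x) / x + a\<^sup>2) * (e x)\<^sup>2 * k x + (x * deriv k x) * (x * deriv e x) / e x
         = x * deriv (\<lambda>x. x * deriv k x) x + k x * Q x"
    by (rule point_transformation[OF r0(1) bh0 QA0 g]) (assumption | (rule that; assumption))+
  have sub: "ball 0 r1 \<subseteq> ball (0::complex) R" using r0 r1 by auto
  define l where "l x = 1 + x * h x" for x
  have lh: "l holomorphic_on ball 0 r1" unfolding l_def by (intro holomorphic_intros hke)
  have l: "l x \<noteq> 0" "l x \<notin> \<real>\<^sub>\<le>\<^sub>0" if "x \<in> ball 0 r1" for x
  proof -
    have "\<bar>Re (x * h x)\<bar> < 1" using abs_Re_le_cmod[of "x * h x"] xh[OF that] by linarith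
    then have "Re (l x) > 0" by (simp add: l_def)
    then show "l x \<noteq> 0" "l x \<notin> \<real>\<^sub>\<le>\<^sub>0" by (auto simp: complex_nonpos_Reals_iff)
  qed
  have dl: "x * deriv l x = (1 - e x) * l x" if "x \<in> ball 0 r1" for x
  proof -
    have "(\<lambda>x. x * h x) field_differentiable (at x)"
      using that hke by (auto intro!: holomorphic_on_imp_differentiable_at[OF _ open_ball] holomorphic_intros)
    then have "deriv l x = deriv (\<lambda>x. x * h x) x" unfolding l_def[abs_def] by simp
    then show ?thesis using ee[OF that] l[OF that] by (simp add: l_def[symmetric] field_simps)
  qed
  \<comment> \<open>The displaced point, divided by \<open>4 * A\<close> so that the residue
    \<open>A\<close> becomes 1/4.\<close>
  define ph where "ph x = x / (4 * A * l x)" for x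
  have phh: "ph holomorphic_on ball 0 r1" unfolding ph_def using l A by (intro holomorphic_intros lh) auto
  have dph: "((ph) has_field_derivative (l x - x * deriv l x) / (4 * A * (l x)\<^sup>2)) (at x)" if x: "x \<in> ball 0 r1" for x
  proof -
    have "((\<lambda>x. x / (4 * A * l x)) has_field_derivative (1 * (4 * A * l x) - x * (4 * A * deriv l x)) / ((4 * A * l x) * (4 * A * l x))) (at x)"
      by (intro DERIV_divide DERIV_ident DERIV_cmult holomorphic_derivI[OF lh open_ball x]) (use l[OF x] A in auto)
    moreover have "(1 * (4 * A * l x) - x * (4 * A * deriv l x)) / ((4 * A * l x) * (4 * A * l x)) = (l x - x * deriv l x) / (4 * A * (l x)\<^sup>2)"
      using l[OF x] A by (simp add: field_simps power2_eq_square)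
    ultimately show ?thesis unfolding ph_def by simp
  qed
  have eph: "x * deriv ph x = e x * ph x" if x: "x \<in> ball 0 r1" for x
  proof -
    have "l x - x * deriv l x = e x * l x" using dl[OF x] by (simp add: algebra_simps)
    then have "deriv ph x = e x * l x / (4 * A * (l x)\<^sup>2)" using DERIV_imp_deriv[OF dph[OF x]] by simp
    then show ?thesis using l[OF x] A by (simp add: ph_def field_simps power2_eq_square)
  qed
  have dp: "deriv ph 0 \<noteq> 0" using DERIV_imp_deriv[OF dph[of 0]] r1 A by (simp add: l_def)
  have zero: "0 \<in> ball (0::complex) r1" using r1 by simp
  have "\<exists>r2>0. ball 0 r2 \<subseteq> ball (0::complex) r1 \<and> inj_on ph (ball 0 r2)"
    by (rule has_complex_derivative_locally_injective[OF phh zero open_ball dp]) blast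
  then obtain r2 where r2: "0 < r2" "ball 0 r2 \<subseteq> ball (0::complex) r1" "inj_on ph (ball 0 r2)" by blast
  define p1 where "p1 = pa 0"
  have "(\<lambda>x. pa x - p1) holomorphic_on ball 0 R" by (intro holomorphic_intros pa)
  then obtain pb where pb: "pb holomorphic_on ball 0 R" "\<And>x. x \<in> ball 0 R \<Longrightarrow> pa x - p1 = (x - 0) * pb x"
    by (rule holomorphic_divide_root[OF _ open_ball, of _ 0 R 0]) (auto simp: p1_def)
  \<comment> \<open>A primitive of \<open>(pa - p1) / x\<close>, the part of the twist that is not a
    power of \<open>x\<close>.\<close>
  obtain Pi where Pi: "\<And>x. x \<in> ball 0 R \<Longrightarrow> (Pi has_field_derivative pb x) (at x within ball 0 R)"
    using holomorphic_convex_primitive'[OF convex_ball open_ball pb(1)] by blast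
  have dPi: "(Pi has_field_derivative pb x) (at x)" if "x \<in> ball 0 R" for x
    using Pi[OF that] at_within_open[OF that open_ball] by simp
  define P where "P = p1 - 1"
  \<comment> \<open>The old twist is undone and the new one applied: the powers of \<open>x\<close>
    and \<open>ph x\<close> with exponents \<open>- P/2\<close> and \<open>P/2\<close> combine, up
    to a constant, to the power \<open>- P/2\<close> of \<open>l\<close>; \<open>k\<close> comes
    from the point transformation. \<open>ta\<close> is the logarithmic derivative of
    \<open>t\<close>.\<close>
  define t where "t x = exp (- (P/2) * Ln (l x) - Pi x / 2) * k x" for x
  define ta where "ta x = P / 2 * (e x - 1) - (pa x - p1) / 2 + (x * deriv e x) / (2 * e x)" for x
  have dt: "(t has_field_derivative t x * ta x / x) (at x)" if x: "x \<in> ball 0 r1 - {0}" for x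
  proof -
    have x1: "x \<in> ball 0 r1" "x \<noteq> 0" "x \<in> ball 0 R" using x sub by auto
    have dLn: "((\<lambda>x. Ln (l x)) has_field_derivative inverse (l x) * deriv l x) (at x)"
      by (rule DERIV_chain2[OF has_field_derivative_Ln[OF l(2)[OF x1(1)]] holomorphic_derivI[OF lh open_ball x1(1)]])
    have "(t has_field_derivative (exp (- (P/2) * Ln (l x) - Pi x / 2) * (- (P/2) * (inverse (l x) * deriv l x) - pb x / 2)) * k x
        + deriv k x * exp (- (P/2) * Ln (l x) - Pi x / 2)) (at x)"
      unfolding t_def
      by (intro DERIV_mult DERIV_chain2[OF DERIV_exp] DERIV_diff DERIV_cmult dLn DERIV_cdivide dPi x1 holomorphic_derivI[OF hke(2) open_ball])
    moreover have "(exp (- (P/2) * Ln (l x) - Pi x / 2) * (- (P/2) * (inverse (l x) * deriv l x) - pb x / 2)) * k x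
        + deriv k x * exp (- (P/2) * Ln (l x) - Pi x / 2) = t x * ta x / x"
    proof -
      define E where "E = exp (- (P/2) * Ln (l x) - Pi x / 2)"
      have il: "inverse (l x) * deriv l x = (1 - e x) / x" using dl[OF x1(1)] l[OF x1(1)] x1 by (simp add: field_simps)
      have "2 * (x * deriv k x) * e x = k x * (x * deriv e x)" unfolding E1[OF x] using enz[OF x1(1)] by simp
      then have "x * (2 * deriv k x * e x) = x * (k x * deriv e x)" by (simp only: mult_ac)
      then have "2 * deriv k x * e x = k x * deriv e x" using x1(2) by (simp only: mult_cancel_left) simp
      then have dk: "deriv k x = k x * (x * deriv e x) / (2 * e x) / x" using x1 enz[OF x1(1)] by (simp add: field_simps)
      have pbx: "pb x = (pa x - p1) / x" using pb(2)[OF x1(3)] x1 by simp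
      show ?thesis unfolding t_def E_def[symmetric] il dk pbx ta_def using x1 enz[OF x1(1)] by (simp add: field_simps)
    qed
    ultimately show ?thesis by simp
  qed
  have th: "t holomorphic_on ball 0 r1"
  proof -
    have "Pi holomorphic_on ball 0 r1" using dPi sub unfolding holomorphic_on_open[OF open_ball] by blast
    then show ?thesis unfolding t_def using l by (intro holomorphic_intros hke lh) auto
  qed
  have tah: "ta holomorphic_on ball 0 r1" unfolding ta_def using enz
    by (intro holomorphic_intros hke holomorphic_deriv open_ball holomorphic_on_subset[OF pa sub]) auto
  have D1: "x * deriv t x = t x * ta x" if "x \<in> ball 0 r1 - {0}" for x
    using DERIV_imp_deriv[OF dt[OF that]] that by simp
  have D2: "x * deriv (\<lambda>x. x * deriv t x) x = t x * ((ta x)\<^sup>2 + x * deriv ta x)" if x: "x \<in> ball 0 r1 - {0}" for x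
  proof -
    have x1: "x \<in> ball 0 r1" "x \<noteq> 0" using x by auto
    have o: "open (ball (0::complex) r1 - {0})" by auto
    have "((\<lambda>x. t x * ta x) has_field_derivative (t x * ta x / x) * ta x + deriv ta x * t x) (at x)"
      by (intro DERIV_mult dt x holomorphic_derivI[OF tah open_ball x1(1)])
    then have "((\<lambda>x. x * deriv t x) has_field_derivative (t x * ta x / x) * ta x + deriv ta x * t x) (at x)"
      by (rule has_field_derivative_transform_within_open[OF _ o x]) (use D1 in auto)
    then show ?thesis using x1 by (simp add: DERIV_imp_deriv field_simps power2_eq_square)
  qed
  define ka where "ka x = (x * deriv e x) / (2 * e x)" for x
  have kah: "ka holomorphic_on ball 0 r1" unfolding ka_def using enz by (intro holomorphic_intros hke holomorphic_deriv open_ball) auto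
  have K1: "x * deriv k x = k x * ka x" if "x \<in> ball 0 r1 - {0}" for x
    using E1[OF that] enz[of x] that by (simp add: ka_def field_simps)
  have K2: "x * deriv (\<lambda>x. x * deriv k x) x = k x * ((ka x)\<^sup>2 + x * deriv ka x)" if x: "x \<in> ball 0 r1 - {0}" for x
  proof -
    have x1: "x \<in> ball 0 r1" "x \<noteq> 0" using x by auto
    have o: "open (ball (0::complex) r1 - {0})" by auto
    have "((\<lambda>x. k x * ka x) has_field_derivative deriv k x * ka x + deriv ka x * k x) (at x)"
      by (intro DERIV_mult holomorphic_derivI[OF hke(2) open_ball x1(1)] holomorphic_derivI[OF kah open_ball x1(1)])
    then have "((\<lambda>x. x * deriv k x) has_field_derivative deriv k x * ka x + deriv ka x * k x) (at x)"
      by (rule has_field_derivative_transform_within_open[OF _ o x]) (use K1 in auto)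
    then have "x * deriv (\<lambda>x. x * deriv k x) x = (x * deriv k x) * ka x + x * deriv ka x * k x"
      by (simp add: DERIV_imp_deriv algebra_simps)
    then show ?thesis unfolding K1[OF x] by (simp add: algebra_simps power2_eq_square)
  qed
  have dta: "deriv ta x = P / 2 * deriv e x - deriv pa x / 2 + deriv ka x" if x: "x \<in> ball 0 r1" for x
  proof -
    have "(ta has_field_derivative P / 2 * (deriv e x - 0) - (deriv pa x - 0) / 2 + deriv ka x) (at x)"
      unfolding ta_def ka_def[symmetric]
      by (intro DERIV_add DERIV_diff DERIV_cmult DERIV_cdivide DERIV_const holomorphic_derivI[OF kah open_ball x] holomorphic_derivI[OF hke(3) open_ball x]
          holomorphic_derivI[OF pa open_ball]) (use x sub in auto)
    then show ?thesis by (simp add: DERIV_imp_deriv)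
  qed
  have sub2: "x \<in> ball 0 r1 - {0}" if "x \<in> ball 0 r2 - {0}" for x :: complex using that r2(2) by blast
  have "analytically_equivalent p q (nf_p p1) (nf_q (a\<^sup>2 - P\<^sup>2 / 4))"
  proof (rule analytically_equivalent_nfI[OF r2(1) holomorphic_on_subset[OF phh r2(2)] r2(3)])
    show "ph 0 = 0" by (simp add: ph_def)
    show "t holomorphic_on ball 0 r2" "e holomorphic_on ball 0 r2" using th hke(3) r2(2) by (auto intro: holomorphic_on_subset)
    show "p 0 = 0" "q 0 = 0" using p[of 0] q[of 0] R by auto
    show "t x \<noteq> 0" "e x \<noteq> 0" if "x \<in> ball 0 r2" for x using that r2(2) knz enz by (auto simp: t_def)
    fix x :: complex assume "x \<in> ball 0 r2 - {0}"
    then have x: "x \<in> ball 0 r1 - {0}" by (rule sub2)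
    then have x1: "x \<in> ball 0 r1" "x \<noteq> 0" "x \<in> ball 0 R" using sub by auto
    show "x * deriv ph x = e x * ph x" by (rule eph[OF x1(1)])
    have px: "p x / x = pa x" using p[OF x1(3)] x1 by simp
    show "2 * (x * deriv t x) = t x * ((p1 - 1) * e x + x * deriv e x / e x - p x / x + 1)"
      unfolding D1[OF x] px ta_def P_def using enz[OF x1(1)] by (simp add: field_simps)
    define E where "E = e x" define e1 where "e1 = x * deriv e x"
    define K where "K = ka x" define Kd where "Kd = x * deriv ka x" define pd where "pd = x * deriv pa x"
    define w where "w = pa x - p1"
    have E0: "E \<noteq> 0" using enz[OF x1(1)] by (simp add: E_def)
    have e1K: "e1 = 2 * E * K" using E0 by (simp add: e1_def K_def ka_def E_def)
    have iph: "1 / (4 * ph x) = A * l x / x" using x1 A l[OF x1(1)] by (simp add: ph_def field_simps)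
    define c where "c = A * l x / x"
    have "(c + a\<^sup>2) * E\<^sup>2 * k x + (k x * K) * e1 / E = k x * (K\<^sup>2 + Kd) + k x * Q x"
      using E2[OF x] unfolding K2[OF x] K1[OF x] by (simp add: c_def l_def E_def e1_def K_def Kd_def)
    then have "k x * ((c + a\<^sup>2) * E\<^sup>2 + 2 * K\<^sup>2) = k x * (K\<^sup>2 + Kd + Q x)"
      unfolding e1K using E0 by (simp add: algebra_simps power2_eq_square)
    then have "(c + a\<^sup>2) * E\<^sup>2 + 2 * K\<^sup>2 = K\<^sup>2 + Kd + Q x" using mult_left_cancel[OF knz[OF x1(1)]] by blast
    then have cE: "c * E\<^sup>2 = Kd - K\<^sup>2 + Q x - a\<^sup>2 * E\<^sup>2" by algebra
    have tax: "ta x = P / 2 * (E - 1) - w / 2 + K" by (simp add: ta_def ka_def E_def w_def K_def)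
    have dtax: "x * deriv ta x = P / 2 * e1 - pd / 2 + Kd" unfolding dta[OF x1(1)] e1_def pd_def Kd_def by (simp add: algebra_simps)
    have Qx: "Q x = q x / x\<^sup>2 + (P + w)\<^sup>2 / 4 - pd / 2"
      using q[OF x1(3)] x1(2) by (simp add: Q_def b_def P_def w_def pd_def field_simps power2_eq_square)
    have F: "E\<^sup>2 * (c + (a\<^sup>2 - P\<^sup>2 / 4)) + P * E * ta x + 2 * K * ta x - ((ta x)\<^sup>2 + x * deriv ta x) = q x / x\<^sup>2"
    proof -
      have *: "E\<^sup>2 * (c + (a\<^sup>2 - P\<^sup>2 / 4)) = Kd - K\<^sup>2 + Q x - P\<^sup>2 / 4 * E\<^sup>2" using cE by algebra
      define qq where "qq = q x / x\<^sup>2"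
      show ?thesis unfolding * tax dtax Qx e1K qq_def[symmetric] by (simp add: field_simps power2_eq_square)
    qed
    have G: "x * deriv e x / E = 2 * K" using e1K E0 by (simp add: e1_def E_def field_simps)
    show "t x * ((e x)\<^sup>2 * (1 / (4 * ph x) + (a\<^sup>2 - P\<^sup>2 / 4))) + (p1 - 1) * e x * (x * deriv t x)
        + (x * deriv e x / e x) * (x * deriv t x) - x * deriv (\<lambda>x. x * deriv t x) x = t x * (q x / x\<^sup>2)"
      unfolding D2[OF x] D1[OF x] iph c_def[symmetric] E_def[symmetric] P_def[symmetric] G F[symmetric] by (simp add: algebra_simps)
  qed
  then show ?thesis by (simp add: p1_def P_def)
qed

subsection \<open>Invariants of the normal form\<close>

fun frobenius_coeff :: "complex \<Rightarrow> complex \<Rightarrow> nat \<Rightarrow> complex" where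
  "frobenius_coeff A \<rho> 0 = 1"
| "frobenius_coeff A \<rho> (Suc n) = A * frobenius_coeff A \<rho> n / (of_nat (Suc n) * (of_nat (Suc n) + 2 * \<rho>))"

lemma frobenius_denominator:
  assumes "0 \<le> Re \<rho>" shows "1 \<le> norm (of_nat (Suc n) + 2 * \<rho>)"
proof -
  have "1 \<le> Re (of_nat (Suc n) + 2 * \<rho>)" using assms by simp
  then show ?thesis using complex_Re_le_cmod[of "of_nat (Suc n) + 2 * \<rho>"] by linarith
qed

text \<open>\<open>Re \<rho> \<ge> 0\<close> keeps each factor \<open>n + 2 * \<rho>\<close> with n
  \<ge> 1 at norm at least 1, so the series of exp (|A| r) dominates.\<close>

lemma frobenius_radius:
  fixes u :: complex
  assumes \<rho>: "0 \<le> Re \<rho>"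
  shows "ereal (norm u) < fps_conv_radius (Abs_fps (frobenius_coeff A \<rho>))"
proof -
  define r where "r = norm u + 1"
  have r: "0 < r" by (simp add: r_def add_nonneg_pos)
  have b: "norm (frobenius_coeff A \<rho> n) \<le> norm A ^ n / fact n" for n
  proof (induction n)
    case (Suc n)
    have "norm (frobenius_coeff A \<rho> (Suc n)) = norm A * norm (frobenius_coeff A \<rho> n) / (real (Suc n) * norm (of_nat (Suc n) + 2 * \<rho>))"
      by (simp add: norm_mult norm_divide del: of_nat_Suc)
    also have "\<dots> \<le> norm A * (norm A ^ n / fact n) / (real (Suc n) * 1)"
      using Suc frobenius_denominator[OF \<rho>, of n] by (intro frac_le mult_mono) auto
    finally show ?case by (simp add: mult.commute del: frobenius_coeff.simps)
  qed simp
  have "fps_conv_radius (Abs_fps (frobenius_coeff A \<rho>)) \<ge> ereal r"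
  proof (rule fps_conv_radius_ge_bound[OF r])
    fix n
    have "norm (frobenius_coeff A \<rho> n) * r ^ n \<le> norm A ^ n / fact n * r ^ n" using b r by (intro mult_right_mono) auto
    also have "\<dots> = (norm A * r) ^ n / fact n" by (simp add: power_mult_distrib)
    also have "\<dots> \<le> exp (norm A * r)"
    proof -
      have "(\<lambda>n. (norm A * r) ^ n / fact n) sums exp (norm A * r)" using exp_converges[of "norm A * r"] by (simp add: field_simps)
      then show ?thesis using sum_le_suminf[OF sums_summable, of _ _ "{n}"] sums_unique r by fastforce
    qed
    finally show "norm (fps_nth (Abs_fps (frobenius_coeff A \<rho>)) n) * r ^ n \<le> exp (norm A * r)" by simp
  qed
  moreover have "ereal (norm u) < ereal r" by (simp add: r_def)
  ultimately show ?thesis by (rule less_le_trans[rotated])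
qed

text \<open>Infinity is a regular singular point with exponents \<rho> and - \<rho>. The ansatz
  x^(-\<rho>) f(u) with u = 1/x leads to u f'' + (1 + 2 \<rho>) f' = A f, and
  \<open>Re \<rho> \<ge> 0\<close> selects the exponent without resonance. The series is entire in
  u, so the solution lives on the whole logarithmic plane.\<close>

lemma frobenius_solution:
  fixes A \<rho> :: complex
  assumes \<rho>: "0 \<le> Re \<rho>"
  obtains v d where "solution_on UNIV (\<lambda>w. A / exp w + \<rho>\<^sup>2) v d"
    "\<And>w. v (w + 2 * of_real pi * \<i>) = exp (2 * of_real pi * \<i> * (- \<rho>)) * v w"
    "\<And>c. \<exists>w. Re w < c \<and> v w \<noteq> 0"
proof -
  define F where "F = Abs_fps (frobenius_coeff A \<rho>)"
  have rad: "ereal (norm u) < fps_conv_radius F" for u :: complex unfolding F_def by (rule frobenius_radius[OF \<rho>])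
  have rad1: "ereal (norm u) < fps_conv_radius (fps_deriv F)" for u :: complex
    using less_le_trans[OF rad fps_conv_radius_deriv] .
  have rad2: "ereal (norm u) < fps_conv_radius (fps_deriv (fps_deriv F))" for u :: complex
    using less_le_trans[OF rad1 fps_conv_radius_deriv] .
  have fpsode: "fps_X * fps_deriv (fps_deriv F) + fps_const (1 + 2 * \<rho>) * fps_deriv F = fps_const A * F"
  proof (rule fps_ext)
    fix n
    have "of_nat (Suc n) + 2 * \<rho> \<noteq> 0" using frobenius_denominator[OF \<rho>, of n] by auto
    then have "of_nat (Suc n) * (of_nat (Suc n) + 2 * \<rho>) * frobenius_coeff A \<rho> (Suc n) = A * frobenius_coeff A \<rho> n"
      by (simp del: of_nat_Suc)
    then show "fps_nth (fps_X * fps_deriv (fps_deriv F) + fps_const (1 + 2 * \<rho>) * fps_deriv F) n = fps_nth (fps_const A * F) n"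
      by (cases n) (simp_all add: F_def algebra_simps del: frobenius_coeff.simps(2))
  qed
  define f where "f u = eval_fps F u" for u
  define f1 where "f1 u = eval_fps (fps_deriv F) u" for u
  define f2 where "f2 u = eval_fps (fps_deriv (fps_deriv F)) u" for u
  have df: "(f has_field_derivative f1 u) (at u)" for u unfolding f_def f1_def by (rule has_field_derivative_eval_fps[OF rad])
  have df1: "(f1 has_field_derivative f2 u) (at u)" for u unfolding f1_def f2_def by (rule has_field_derivative_eval_fps[OF rad1])
  have ode: "u * f2 u + (1 + 2 * \<rho>) * f1 u = A * f u" for u
  proof -
    have r: "ereal (norm u) < fps_conv_radius (fps_X * fps_deriv (fps_deriv F))" "ereal (norm u) < fps_conv_radius (fps_const (1 + 2 * \<rho>) * fps_deriv F)"
      using less_le_trans[OF _ fps_conv_radius_mult[of fps_X "fps_deriv (fps_deriv F)"]]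
        less_le_trans[OF _ fps_conv_radius_mult[of "fps_const (1 + 2 * \<rho>)" "fps_deriv F"]] rad1[of u] rad2[of u] by simp_all
    have "eval_fps (fps_X * fps_deriv (fps_deriv F) + fps_const (1 + 2 * \<rho>) * fps_deriv F) u = u * f2 u + (1 + 2 * \<rho>) * f1 u"
      using eval_fps_add[OF r] eval_fps_mult[of u fps_X "fps_deriv (fps_deriv F)"] eval_fps_mult[of u "fps_const (1 + 2 * \<rho>)" "fps_deriv F"] rad1 rad2
      by (simp add: f1_def f2_def)
    moreover have "eval_fps (fps_const A * F) u = A * f u" using eval_fps_mult[of u "fps_const A" F] rad by (simp add: f_def)
    ultimately show ?thesis unfolding fpsode by simp
  qed
  define v where "v w = exp (- \<rho> * w) * f (exp (- w))" for w
  define d where "d w = - \<rho> * (exp (- \<rho> * w) * f (exp (- w))) - exp (- \<rho> * w) * (exp (- w) * f1 (exp (- w)))" for w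
  have ex: "((\<lambda>w. exp (b * w)) has_field_derivative exp (b * w) * b) (at w)" for b w :: complex by (auto intro!: derivative_eq_intros)
  have em: "((\<lambda>w. exp (- w)) has_field_derivative - exp (- w)) (at w)" for w :: complex by (auto intro!: derivative_eq_intros)
  have vd: "solution_on UNIV (\<lambda>w. A / exp w + \<rho>\<^sup>2) v d" unfolding solution_on_def
  proof (intro ballI conjI)
    fix w
    have cf: "((\<lambda>w. f (exp (- w))) has_field_derivative f1 (exp (- w)) * - exp (- w)) (at w)" by (rule DERIV_chain2[OF df em])
    have cf1: "((\<lambda>w. f1 (exp (- w))) has_field_derivative f2 (exp (- w)) * - exp (- w)) (at w)" by (rule DERIV_chain2[OF df1 em])
    have dv: "((\<lambda>w. exp (- \<rho> * w) * f (exp (- w))) has_field_derivative (exp (- \<rho> * w) * - \<rho>) * f (exp (- w)) + (f1 (exp (- w)) * - exp (- w)) * exp (- \<rho> * w)) (at w)"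
      by (rule DERIV_mult[OF ex cf])
    then show "(v has_field_derivative d w) (at w)" unfolding v_def[abs_def] d_def by (simp add: algebra_simps)
    have "((\<lambda>w. - \<rho> * (exp (- \<rho> * w) * f (exp (- w))) - exp (- \<rho> * w) * (exp (- w) * f1 (exp (- w)))) has_field_derivative
       - \<rho> * ((exp (- \<rho> * w) * - \<rho>) * f (exp (- w)) + (f1 (exp (- w)) * - exp (- w)) * exp (- \<rho> * w))
        - ((exp (- \<rho> * w) * - \<rho>) * (exp (- w) * f1 (exp (- w))) + ((- exp (- w)) * f1 (exp (- w)) + (f2 (exp (- w)) * - exp (- w)) * exp (- w)) * exp (- \<rho> * w))) (at w)"
      by (intro DERIV_diff DERIV_cmult dv DERIV_mult ex em cf1)
    moreover have "- \<rho> * ((exp (- \<rho> * w) * - \<rho>) * f (exp (- w)) + (f1 (exp (- w)) * - exp (- w)) * exp (- \<rho> * w))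
        - ((exp (- \<rho> * w) * - \<rho>) * (exp (- w) * f1 (exp (- w))) + ((- exp (- w)) * f1 (exp (- w)) + (f2 (exp (- w)) * - exp (- w)) * exp (- w)) * exp (- \<rho> * w))
       = exp (- \<rho> * w) * (\<rho>\<^sup>2 * f (exp (- w)) + exp (- w) * (exp (- w) * f2 (exp (- w)) + (1 + 2 * \<rho>) * f1 (exp (- w))))"
      by (simp add: algebra_simps power2_eq_square)
    moreover have "\<dots> = (A / exp w + \<rho>\<^sup>2) * v w"
      unfolding ode v_def by (simp add: exp_minus field_simps)
    ultimately show "(d has_field_derivative (A / exp w + \<rho>\<^sup>2) * v w) (at w)" unfolding d_def[abs_def] by (simp only:)
  qed
  have vh: "v holomorphic_on UNIV" using solution_onD(1)[OF vd] by (auto simp: holomorphic_on_open)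
  show ?thesis
  proof (rule that[OF vd])
    fix w
    have "exp (- (w + 2 * of_real pi * \<i>)) = exp (- w)" unfolding exp_minus by (simp add: exp_add)
    moreover have "- \<rho> * (w + 2 * of_real pi * \<i>) = - \<rho> * w + 2 * of_real pi * \<i> * (- \<rho>)" by (simp add: algebra_simps)
    ultimately show "v (w + 2 * of_real pi * \<i>) = exp (2 * of_real pi * \<i> * (- \<rho>)) * v w"
      by (simp only: v_def exp_add mult_ac)
  next
    fix c
    \<comment> \<open>Vanishing on a half-plane would spread by analytic continuation and give f(0)
      = 0, whereas the series starts with 1.\<close>
    show "\<exists>w. Re w < c \<and> v w \<noteq> 0"
    proof (rule ccontr)
      assume *: "\<nexists>w. Re w < c \<and> v w \<noteq> 0"
      have v0: "v w = 0" for w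
      proof (rule analytic_continuation_open[of "{w. Re w < c}" UNIV v "\<lambda>_. 0" w])
        show "{w. Re w < c} \<noteq> {}" by (rule ex_in_conv[THEN iffD1]) (auto intro!: exI[of _ "of_real (c - 1)"])
      qed (use * vh in \<open>auto intro: open_halfspace_Re_lt\<close>)
      have f0: "f u = 0" if "u \<noteq> 0" for u using v0[of "- Ln u"] that by (simp add: v_def)
      have "isCont f 0" using df DERIV_isCont by blast
      then have "(f \<longlongrightarrow> f 0) (at 0)" by (simp add: isCont_def)
      moreover have "(f \<longlongrightarrow> 0) (at 0)"
        by (rule tendsto_eventually) (auto simp: eventually_at_filter f0)
      ultimately have "f 0 = 0" by (metis LIM_unique)
      then show False by (simp add: f_def F_def eval_fps_at_0)
    qed
  qed
qed

text \<open>An equivalence speaks of single-valued solutions on open sets, while monodromy needs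
  solutions on the logarithmic half-plane. A disc around \<open>exp w\<close> that misses 0 carries
  a branch \<open>L\<close> of the logarithm; there the solution is single-valued, is transported,
  and the target equation is rewritten in \<open>w\<close>.\<close>

lemma transported_solution:
  fixes ph t e :: "complex \<Rightarrow> complex"
  assumes r: "0 < r" and ph: "ph holomorphic_on ball 0 r" "inj_on ph (ball 0 r)" "ph 0 = 0"
    and t: "t holomorphic_on ball 0 r"
    and e: "e holomorphic_on ball 0 r" "\<forall>x\<in>ball 0 r. e x \<noteq> 0" "\<forall>x\<in>ball 0 r - {0}. x * deriv ph x = e x * ph x"
    and equiv: "\<forall>U y. open U \<longrightarrow> U \<subseteq> ball 0 r \<longrightarrow> solves (nf_p p1) (nf_q q2) U y \<longrightarrow>
       solves (nf_p p1') (nf_q q2') (ph ` U) (\<lambda>z. t (inv_into (ball 0 r) ph z) * y (inv_into (ball 0 r) ph z))"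
    and y': "\<forall>w. Re w < ln r \<longrightarrow> (y has_field_derivative y1 w) (at w)"
      "\<forall>w. Re w < ln r \<longrightarrow> (y1 has_field_derivative (p1 - 1) * y1 w + (1 / (4 * exp w) + q2) * y w) (at w)"
    and w: "Re w < ln r" and x: "x = exp w"
  defines "Z \<equiv> \<lambda>w. t (exp w) * y w" and "Z1 \<equiv> \<lambda>w. exp w * deriv t (exp w) * y w + t (exp w) * y1 w"
  shows "(Z has_field_derivative Z1 w) (at w)"
    "(Z1 has_field_derivative (x * deriv e x / e x + (p1' - 1) * e x) * Z1 w + (e x)\<^sup>2 * (1 / (4 * ph x) + q2') * Z w) (at w)"
proof -
  note y = y'[rule_format]
  define t1 where "t1 = (\<lambda>x. x * deriv t x)"
  have t1h: "t1 holomorphic_on ball 0 r" unfolding t1_def by (intro holomorphic_intros holomorphic_deriv t open_ball)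
  have xr: "x \<in> ball 0 r - {0}" unfolding x using exp_in_punctured_ball[OF r, of w] w by blast
  then have xb: "exp w \<in> ball 0 r" using x by simp
  have Z1t: "Z1 = (\<lambda>w. t1 (exp w) * y w + t (exp w) * y1 w)" by (simp add: Z1_def t1_def)
  have "(Z has_field_derivative (exp w * deriv t (exp w)) * y w + y1 w * t (exp w)) (at w)"
    unfolding Z_def by (rule DERIV_mult[OF DERIV_comp_exp[OF t xb] y(1)[OF w]])
  then show dZ: "(Z has_field_derivative Z1 w) (at w)" by (simp add: Z1_def mult.commute)
  have "(Z1 has_field_derivative ((exp w * deriv t1 (exp w)) * y w + y1 w * t1 (exp w))
      + ((exp w * deriv t (exp w)) * y1 w + ((p1 - 1) * y1 w + (1 / (4 * exp w) + q2) * y w) * t (exp w))) (at w)"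
    unfolding Z1t by (intro DERIV_add DERIV_mult DERIV_comp_exp[OF t xb] DERIV_comp_exp[OF t1h xb] y w)
  \<comment> \<open>Only the existence of the second derivative is kept; its value will be
    determined by the target equation.\<close>
  then obtain D where D: "(Z1 has_field_derivative D) (at w)" by blast
  \<comment> \<open>The bound \<open>norm x\<close> excludes 0 and gives \<open>z / x\<close> a
    positive real part, so that \<open>Ln (z / x)\<close> is holomorphic.\<close>
  define s where "s = min (norm x) (r - norm x)"
  define U where "U = ball x s"
  have s: "0 < s" using xr by (auto simp: s_def)
  have U: "open U" "x \<in> U" "U \<subseteq> ball 0 r" "0 \<notin> U"
  proof -
    show "U \<subseteq> ball 0 r"
    proof
      fix z assume "z \<in> U"
      then have "norm (z - x) < r - norm x" by (auto simp: U_def s_def dist_norm norm_minus_commute)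
      then show "z \<in> ball 0 r" using norm_triangle_sub[of z x] by simp
    qed
  qed (use s in \<open>auto simp: U_def s_def\<close>)
  define L where "L z = w + Ln (z / x)" for z
  have L: "exp (L z) = z" "Re (L z) < ln r" "z \<noteq> 0" "(L has_field_derivative 1 / z) (at z)" if z: "z \<in> U" for z
  proof -
    show z0: "z \<noteq> 0" using that U by auto
    then show ez: "exp (L z) = z" using xr by (simp add: L_def exp_add x)
    show "Re (L z) < ln r" using exp_in_punctured_ball[OF r, of "L z"] z0 z U(3) unfolding ez by blast
    have "norm (z / x - 1) < 1"
    proof -
      have "norm (z - x) < norm x" using z by (auto simp: U_def s_def dist_norm norm_minus_commute)
      moreover have "z / x - 1 = (z - x) / x" using xr by (simp add: field_simps)
      ultimately show ?thesis using xr by (simp add: norm_divide)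
    qed
    then have "\<bar>Re (z / x - 1)\<bar> < 1" using abs_Re_le_cmod[of "z / x - 1"] by linarith
    then have "0 < Re (z / x)" by simp
    then have nz: "z / x \<notin> \<real>\<^sub>\<le>\<^sub>0" by (auto simp: complex_nonpos_Reals_iff)
    show "(L has_field_derivative 1 / z) (at z)" unfolding L_def
      using nz xr z0 by (auto intro!: derivative_eq_intros simp: field_simps)
  qed
  have Lx: "L x = w" using xr by (simp add: L_def)
  define yy where "yy z = y (L z)" for z
  have dyy: "(yy has_field_derivative y1 (L z) / z) (at z)" if "z \<in> U" for z
    using DERIV_chain2[OF y(1)[OF L(2)[OF that]] L(4)[OF that]] by (simp add: yy_def[abs_def])
  have yyh: "yy holomorphic_on U" using dyy by (auto simp: holomorphic_on_open[OF U(1)])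
  have th1: "z * deriv yy z = y1 (L z)" if "z \<in> U" for z using DERIV_imp_deriv[OF dyy[OF that]] L(3)[OF that] by simp
  have th2: "z * deriv (\<lambda>z. z * deriv yy z) z = (p1 - 1) * y1 (L z) + (1 / (4 * z) + q2) * yy z" if z: "z \<in> U" for z
  proof -
    have "((\<lambda>z. y1 (L z)) has_field_derivative ((p1 - 1) * y1 (L z) + (1 / (4 * exp (L z)) + q2) * y (L z)) * (1 / z)) (at z)"
      by (rule DERIV_chain2[OF y(2)[OF L(2)[OF z]] L(4)[OF z]])
    then have "((\<lambda>z. z * deriv yy z) has_field_derivative ((p1 - 1) * y1 (L z) + (1 / (4 * exp (L z)) + q2) * y (L z)) * (1 / z)) (at z)"
      by (rule has_field_derivative_transform_within_open[OF _ U(1) z]) (use th1 in auto)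
    then show ?thesis using L[OF z] by (simp add: DERIV_imp_deriv yy_def)
  qed
  have "solves (nf_p p1) (nf_q q2) U yy" unfolding solves_def
  proof (intro conjI ballI yyh)
    fix z assume z: "z \<in> U"
    have nn: "nf_p p1 z / z = p1" "nf_q q2 z / z\<^sup>2 = 1 / (4 * z) + q2" using L(3)[OF z] by (auto simp: nf_p_def nf_q_def field_simps power2_eq_square)
    show "delta1 (delta1 yy) z - nf_p p1 z * delta1 yy z - nf_q q2 z * yy z = 0"
      unfolding theta_operator_form[OF yyh U(1) z L(3)[OF z]] th2[OF z] th1[OF z] nn by (simp add: algebra_simps)
  qed
  define Y where "Y = (\<lambda>z. t (inv_into (ball 0 r) ph z) * yy (inv_into (ball 0 r) ph z))"
  from equiv[rule_format, OF U(1,3) \<open>solves (nf_p p1) (nf_q q2) U yy\<close>]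
  have Yh: "Y holomorphic_on ph ` U"
    and Yode: "\<And>z. z \<in> U \<Longrightarrow> delta1 (delta1 Y) (ph z) - nf_p p1' (ph z) * delta1 Y (ph z) - nf_q q2' (ph z) * Y (ph z) = 0"
    unfolding solves_def Y_def by auto
  have Yph: "Y (ph z) = t z * yy z" if "z \<in> U" for z
    using that U(3) ph(2) by (simp add: Y_def inv_into_f_f subset_iff)
  have phU: "ph holomorphic_on U" "inj_on ph U" using ph U by (auto intro: holomorphic_on_subset inj_on_subset)
  have oV: "open (ph ` U)" by (rule open_mapping_thm3[OF phU(1) U(1) phU(2)])
  have zz: "z \<in> ball 0 r - {0}" "ph z \<noteq> 0" "e z \<noteq> 0" if "z \<in> U" for z
  proof -
    show zb: "z \<in> ball 0 r - {0}" using that U by auto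
    then show "ph z \<noteq> 0" using inj_onD[OF ph(2), of z 0] ph(3) r by auto
    show "e z \<noteq> 0" using e(2) zb by auto
  qed
  have eU: "e holomorphic_on U" "t holomorphic_on U" using e(1) t U(3) by (auto intro: holomorphic_on_subset)
  have dty: "((\<lambda>z. t z * yy z) has_field_derivative Z1 (L z) / z) (at z)" if z: "z \<in> U" for z
  proof -
    have "((\<lambda>z. t z * yy z) has_field_derivative deriv t z * yy z + y1 (L z) / z * t z) (at z)"
      by (rule DERIV_mult[OF holomorphic_derivI[OF eU(2) U(1) z] dyy[OF z]])
    then show ?thesis using L[OF z] by (simp add: Z1_def yy_def field_simps)
  qed
  have dY: "ph z * deriv Y (ph z) = Z1 (L z) / e z" if z: "z \<in> U" for z
    using theta_chain[OF oV Yh U(1) z _ phU(1) zz(2)[OF z] L(3)[OF z] e(3)[rule_format, OF zz(1)[OF z]] zz(3)[OF z] Yph dty[OF z]] L(3)[OF z] by simp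
  define YY where "YY z = z * deriv Y z" for z
  have YYh: "YY holomorphic_on ph ` U" unfolding YY_def by (intro holomorphic_intros holomorphic_deriv Yh oV)
  have dZL: "((\<lambda>z. Z1 (L z)) has_field_derivative D * (1 / x)) (at x)"
    by (rule DERIV_chain2[where f=Z1]) (use D L(4)[OF U(2)] Lx in auto)
  have dZe: "((\<lambda>z. Z1 (L z) / e z) has_field_derivative (D * (1 / x) * e x - Z1 (L x) * deriv e x) / (e x * e x)) (at x)"
    by (intro DERIV_divide dZL holomorphic_derivI[OF eU(1) U(1,2)] zz(3)[OF U(2)])
  have dYY: "ph x * deriv YY (ph x) = x * ((D * (1 / x) * e x - Z1 (L x) * deriv e x) / (e x * e x)) / e x"
    by (rule theta_chain[OF oV YYh U(1,2) _ phU(1) zz(2)[OF U(2)] L(3)[OF U(2)] e(3)[rule_format, OF zz(1)[OF U(2)]] zz(3)[OF U(2)] _ dZe])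
       (use dY in \<open>auto simp: YY_def\<close>)
  have pV: "ph x \<in> ph ` U" using U by auto
  have nn: "nf_p p1' (ph x) / ph x = p1'" "nf_q q2' (ph x) / (ph x)\<^sup>2 = 1 / (4 * ph x) + q2'"
    using zz(2)[OF U(2)] by (auto simp: nf_p_def nf_q_def field_simps power2_eq_square)
  have "(ph x)\<^sup>2 * (ph x * deriv YY (ph x) + ph x * deriv Y (ph x) - nf_p p1' (ph x) / ph x * (ph x * deriv Y (ph x)) - nf_q q2' (ph x) / (ph x)\<^sup>2 * Y (ph x)) = 0"
    using Yode[OF U(2)] theta_operator_form[OF Yh oV pV zz(2)[OF U(2)], of "nf_p p1'" "nf_q q2'"] by (simp add: YY_def[abs_def])
  then have pre: "ph x * deriv YY (ph x) + ph x * deriv Y (ph x) - p1' * (ph x * deriv Y (ph x)) - (1 / (4 * ph x) + q2') * Y (ph x) = 0"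
    unfolding nn using zz(2)[OF U(2)] by simp
  have Zw: "t x * yy x = Z w" by (simp only: yy_def Lx Z_def x[symmetric])
  from pre have eq: "x * ((D * (1 / x) * e x - Z1 w * deriv e x) / (e x * e x)) / e x + Z1 w / e x - p1' * (Z1 w / e x) - (1 / (4 * ph x) + q2') * Z w = 0"
    unfolding dYY dY[OF U(2)] Yph[OF U(2)] Zw Lx .
  define c where "c = 1 / (4 * ph x) + q2'"
  define E where "E = e x"
  have E: "E \<noteq> 0" "x \<noteq> 0" using zz(3)[OF U(2)] xr by (auto simp: E_def)
  define T where "T = x * ((D * (1 / x) * E - Z1 w * deriv e x) / (E * E)) / E"
  have T: "T = D / E\<^sup>2 - Z1 w * (x * deriv e x) / E^3"
    unfolding T_def using E by (simp add: field_simps power2_eq_square power3_eq_cube)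
  have "T + Z1 w / E - p1' * (Z1 w / E) - c * Z w = 0"
    using eq unfolding T_def c_def E_def .
  then have "D / E\<^sup>2 - Z1 w * (x * deriv e x) / E^3 = (p1' - 1) * (Z1 w / E) + c * Z w"
    unfolding T by algebra
  then have "E^3 * (D / E\<^sup>2 - Z1 w * (x * deriv e x) / E^3) = E^3 * ((p1' - 1) * (Z1 w / E) + c * Z w)" by (rule arg_cong)
  moreover have "E^3 * (D / E\<^sup>2 - Z1 w * (x * deriv e x) / E^3) = E * D - Z1 w * (x * deriv e x)"
    using E(1) by (simp add: field_simps power2_eq_square power3_eq_cube)
  moreover have "E^3 * ((p1' - 1) * (Z1 w / E) + c * Z w) = E * (E * (p1' - 1) * Z1 w + E\<^sup>2 * c * Z w)"
    using E(1) by (simp add: field_simps power2_eq_square power3_eq_cube)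
  ultimately have "E * D = Z1 w * (x * deriv e x) + E * (E * (p1' - 1) * Z1 w + E\<^sup>2 * c * Z w)"
    by (metis diff_add_cancel add.commute)
  then have "D = (Z1 w * (x * deriv e x) + E * (E * (p1' - 1) * Z1 w + E\<^sup>2 * c * Z w)) / E"
    using E(1) by (metis nonzero_mult_div_cancel_left)
  also have "\<dots> = (x * deriv e x / E + (p1' - 1) * E) * Z1 w + E\<^sup>2 * c * Z w"
    using E(1) by (simp add: field_simps power2_eq_square power3_eq_cube)
  finally have "D = (x * deriv e x / E + (p1' - 1) * E) * Z1 w + E\<^sup>2 * c * Z w" .
  then show "(Z1 has_field_derivative (x * deriv e x / e x + (p1' - 1) * e x) * Z1 w + (e x)\<^sup>2 * (1 / (4 * ph x) + q2') * Z w) (at w)"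
    using D unfolding c_def E_def by simp
qed

lemma derivative_multiplier:
  assumes f: "\<And>w. Re w < c \<Longrightarrow> (f has_field_derivative f1 w) (at w)" and per: "\<And>w. Re w < c \<Longrightarrow> f (w + 2 * of_real pi * \<i>) = l * f w"
    and w: "Re w < c"
  shows "f1 (w + 2 * of_real pi * \<i>) = l * f1 w"
proof -
  have "((\<lambda>w. f (w + 2 * of_real pi * \<i>)) has_field_derivative f1 (w + 2 * of_real pi * \<i>)) (at w)"
    using f[of "w + 2 * of_real pi * \<i>"] w by (simp add: DERIV_shift)
  then have "((\<lambda>w. l * f w) has_field_derivative f1 (w + 2 * of_real pi * \<i>)) (at w)"
    by (rule has_field_derivative_transform_within_open[OF _ open_halfspace_Re_lt[of c]]) (use per w in auto)
  moreover have "((\<lambda>w. l * f w) has_field_derivative l * f1 w) (at w)" by (rule DERIV_cmult[OF f[OF w]])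
  ultimately show ?thesis by (rule DERIV_unique)
qed

text \<open>The factor x^(P/2), written \<open>exp (P / 2 * w)\<close>, restores the first-order
  coefficient of the normal form.\<close>

lemma untwist_solution:
  fixes P q \<rho> :: complex
  assumes v: "solution_on S (\<lambda>w. 1/4 / exp w + \<rho>\<^sup>2) v d" and q: "\<rho>\<^sup>2 = q + P\<^sup>2 / 4" and w: "w \<in> S"
  defines "y \<equiv> \<lambda>w. exp (P / 2 * w) * v w" and "y1 \<equiv> \<lambda>w. exp (P / 2 * w) * (P / 2 * v w + d w)"
  shows "(y has_field_derivative y1 w) (at w)" "(y1 has_field_derivative P * y1 w + (1 / (4 * exp w) + q) * y w) (at w)"
proof -
  note D = solution_onD[OF v w]
  have e: "((\<lambda>w. exp (P / 2 * w)) has_field_derivative P / 2 * exp (P / 2 * w)) (at w)" by (auto intro!: derivative_eq_intros)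
  have "(y has_field_derivative P / 2 * exp (P / 2 * w) * v w + d w * exp (P / 2 * w)) (at w)"
    unfolding y_def by (rule DERIV_mult[OF e D(1)])
  then show "(y has_field_derivative y1 w) (at w)" by (simp add: y1_def algebra_simps)
  have "(y1 has_field_derivative P / 2 * exp (P / 2 * w) * (P / 2 * v w + d w) + (P / 2 * d w + (1/4 / exp w + \<rho>\<^sup>2) * v w) * exp (P / 2 * w)) (at w)"
    unfolding y1_def by (intro DERIV_mult e DERIV_add DERIV_cmult D)
  moreover have "P / 2 * exp (P / 2 * w) * (P / 2 * v w + d w) + (P / 2 * d w + (1/4 / exp w + \<rho>\<^sup>2) * v w) * exp (P / 2 * w)
     = P * y1 w + (1 / (4 * exp w) + q) * y w"
    unfolding q y_def y1_def by (simp add: field_simps power2_eq_square)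
  ultimately show "(y1 has_field_derivative P * y1 w + (1 / (4 * exp w) + q) * y w) (at w)" by (simp only:)
qed

lemma nf_equivalent_imp:
  fixes p1 q2 p1' q2' \<rho> \<rho>' :: complex
  assumes eqv: "analytically_equivalent (nf_p p1) (nf_q q2) (nf_p p1') (nf_q q2')"
    and rho: "\<rho>\<^sup>2 = q2 + (p1 - 1)\<^sup>2 / 4" "0 \<le> Re \<rho>" and rho': "\<rho>'\<^sup>2 = q2' + (p1' - 1)\<^sup>2 / 4" "0 \<le> Re \<rho>'"
  shows "p1 = p1'" "exp (2 * of_real pi * \<i> * \<rho>) = exp (2 * of_real pi * \<i> * \<rho>') \<or> exp (2 * of_real pi * \<i> * \<rho>) * exp (2 * of_real pi * \<i> * \<rho>') = 1"
proof -
  obtain ph t r where r: "0 < r" and ph: "ph holomorphic_on ball 0 r" "inj_on ph (ball 0 r)" "ph 0 = 0"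
    and t: "t holomorphic_on ball 0 r" "\<And>x. x \<in> ball 0 r \<Longrightarrow> t x \<noteq> 0"
    and eqv': "\<forall>U y. open U \<longrightarrow> U \<subseteq> ball 0 r \<longrightarrow> (solves (nf_p p1) (nf_q q2) U y \<longleftrightarrow>
       solves (nf_p p1') (nf_q q2') (ph ` U) (\<lambda>z. t (inv_into (ball 0 r) ph z) * y (inv_into (ball 0 r) ph z)))"
    using eqv unfolding analytically_equivalent_def by (elim exE conjE) (rule that, auto)
  let ?H = "{w. Re w < ln r}" let ?p = "2 * of_real pi * \<i>"
  obtain p where p: "p holomorphic_on ball 0 r" "\<And>x. x \<in> ball 0 r \<Longrightarrow> ph x = (x - 0) * p x"
    by (rule holomorphic_divide_root[of ph "ball 0 r" 0]) (use ph in auto)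
  have dph: "deriv ph x = p x + x * deriv p x" if "x \<in> ball 0 r" for x
  proof -
    have "((\<lambda>x. x * p x) has_field_derivative (1 * p x + deriv p x * x)) (at x)"
      by (rule DERIV_mult[OF DERIV_ident holomorphic_derivI[OF p(1) open_ball that]])
    then have "(ph has_field_derivative (1 * p x + deriv p x * x)) (at x)"
      by (rule has_field_derivative_transform_within_open[OF _ open_ball that]) (use p in auto)
    then show ?thesis by (simp add: DERIV_imp_deriv mult.commute)
  qed
  have dph0: "deriv ph x \<noteq> 0" if "x \<in> ball 0 r" for x by (rule holomorphic_injective_imp_regular[OF ph(1) open_ball ph(2) that])
  have pnz: "p x \<noteq> 0" if "x \<in> ball 0 r" for x
  proof (cases "x = 0")
    case True then show ?thesis using dph[OF that] dph0[OF that] by auto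
  next
    case False
    then have "ph x \<noteq> 0" using inj_onD[OF ph(2), of x 0] ph(3) that r by auto
    then show ?thesis using p(2)[OF that] by auto
  qed
  \<comment> \<open>A logarithm of \<open>ph x / x\<close>. It provides the logarithmic derivative
    \<open>e\<close> of \<open>ph\<close> and, below, a lift \<open>om\<close> of \<open>ph\<close>
    to the variable \<open>w\<close> that commutes with the shift by \<open>?p\<close>.\<close>
  obtain l where l: "l holomorphic_on ball 0 r" "\<And>x. x \<in> ball 0 r \<Longrightarrow> exp (l x) = p x"
    using holomorphic_logarithm_exists[OF convex_ball open_ball p(1) pnz, of 0] r by auto
  define e where "e x = 1 + x * deriv l x" for x
  have eh: "e holomorphic_on ball 0 r" unfolding e_def by (intro holomorphic_intros holomorphic_deriv l open_ball)
  have dp: "deriv p x = deriv l x * p x" if x: "x \<in> ball 0 r" for x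
  proof -
    have "((\<lambda>x. exp (l x)) has_field_derivative exp (l x) * deriv l x) (at x)"
      by (rule DERIV_chain2[OF DERIV_exp holomorphic_derivI[OF l(1) open_ball x]])
    then have "(p has_field_derivative exp (l x) * deriv l x) (at x)"
      by (rule has_field_derivative_transform_within_open[OF _ open_ball x]) (use l in auto)
    then show ?thesis using l(2)[OF x] by (simp add: DERIV_imp_deriv mult.commute)
  qed
  have eph: "x * deriv ph x = e x * ph x" if "x \<in> ball 0 r" for x
    unfolding dph[OF that] dp[OF that] using p(2)[OF that] by (simp add: e_def algebra_simps)
  have enz: "e x \<noteq> 0" if "x \<in> ball 0 r" for x
  proof (cases "x = 0")
    case False
    then show ?thesis using eph[OF that] dph0[OF that] by auto
  qed (simp add: e_def)
  have eph': "x * deriv ph x = e x * ph x" if "x \<in> ball 0 r - {0}" for x using eph[of x] that by simp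
  have enA: "\<forall>x\<in>ball 0 r. e x \<noteq> 0" using enz by blast
  have ephA: "\<forall>x\<in>ball 0 r - {0}. x * deriv ph x = e x * ph x" using eph' by blast
  have equivA: "\<forall>U y. open U \<longrightarrow> U \<subseteq> ball 0 r \<longrightarrow> solves (nf_p p1) (nf_q q2) U y \<longrightarrow>
       solves (nf_p p1') (nf_q q2') (ph ` U) (\<lambda>z. t (inv_into (ball 0 r) ph z) * y (inv_into (ball 0 r) ph z))"
    using eqv' by blast
  note tr = transported_solution[OF r ph t(1) eh enA ephA equivA]
  have xw: "exp w \<in> ball 0 r - {0}" if "Re w < ln r" for w using exp_in_punctured_ball[OF r, of w] that by blast
  have xw': "exp w \<in> ball 0 r" if "Re w < ln r" for w using xw[OF that] by blast
  have qh: "(\<lambda>w. 1/4 / exp w + \<rho>\<^sup>2) holomorphic_on {w. Re w < c}" for c \<rho> by (intro holomorphic_intros) auto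
  \<comment> \<open>Left: the logarithmic derivative of the Wronskian of two transported solutions
    according to the target equation. Right: the same from its explicit value
    \<open>t^2 * x^(p1 - 1)\<close>. At 0 all \<theta>-terms vanish and \<open>e 0 = 1\<close>,
    which compares \<open>p1'\<close> with \<open>p1\<close>.\<close>
  have "x * deriv e x / e x + (p1' - 1) * e x = 2 * (x * deriv t x) / t x + (p1 - 1)" if x: "x \<in> ball 0 r" for x
  proof (rule continuous_eq_at_0[OF _ _ r _ x])
    show "(\<lambda>x. x * deriv e x / e x + (p1' - 1) * e x) holomorphic_on ball 0 r" using enz by (intro holomorphic_intros holomorphic_deriv eh open_ball) auto
    show "(\<lambda>x. 2 * (x * deriv t x) / t x + (p1 - 1)) holomorphic_on ball 0 r" using t(2) by (intro holomorphic_intros holomorphic_deriv t(1) open_ball) auto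
    fix x :: complex assume x: "x \<in> ball 0 r" "x \<noteq> 0"
    obtain w where w: "x = exp w" "Re w < ln r" using punctured_ball_cases[OF r, of x] x by blast
    obtain v d where v: "solution_on ?H (\<lambda>w. 1/4 / exp w + \<rho>\<^sup>2) v d" "v w = 1" "d w = 0" using linear_ode_exists_halfplane[OF qh w(2)] by metis
    obtain v' d' where v': "solution_on ?H (\<lambda>w. 1/4 / exp w + \<rho>\<^sup>2) v' d'" "v' w = 0" "d' w = 1" using linear_ode_exists_halfplane[OF qh w(2)] by metis
    have wr: "v z * d' z - v' z * d z = 1" if "Re z < ln r" for z
      using wronskian_constant[OF v(1) v'(1) convex_halfspace_Re_lt, of z w] that w v v' by simp
    define y where "y = (\<lambda>w. exp ((p1 - 1) / 2 * w) * v w)"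
    define y1 where "y1 = (\<lambda>w. exp ((p1 - 1) / 2 * w) * ((p1 - 1) / 2 * v w + d w))"
    define y' where "y' = (\<lambda>w. exp ((p1 - 1) / 2 * w) * v' w)"
    define y1' where "y1' = (\<lambda>w. exp ((p1 - 1) / 2 * w) * ((p1 - 1) / 2 * v' w + d' w))"
    have Dy: "(y has_field_derivative y1 z) (at z)" "(y1 has_field_derivative (p1 - 1) * y1 z + (1 / (4 * exp z) + q2) * y z) (at z)" if "Re z < ln r" for z
      using untwist_solution[OF v(1) rho(1), of z] that by (auto simp: y_def y1_def)
    have Dy': "(y' has_field_derivative y1' z) (at z)" "(y1' has_field_derivative (p1 - 1) * y1' z + (1 / (4 * exp z) + q2) * y' z) (at z)" if "Re z < ln r" for z
      using untwist_solution[OF v'(1) rho(1), of z] that by (auto simp: y'_def y1'_def)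
    define Z where "Z = (\<lambda>w. t (exp w) * y w)"
    define Z1 where "Z1 = (\<lambda>w. exp w * deriv t (exp w) * y w + t (exp w) * y1 w)"
    define Z' where "Z' = (\<lambda>w. t (exp w) * y' w)"
    define Z1' where "Z1' = (\<lambda>w. exp w * deriv t (exp w) * y' w + t (exp w) * y1' w)"
    have DyA: "\<forall>z. Re z < ln r \<longrightarrow> (y has_field_derivative y1 z) (at z)" "\<forall>z. Re z < ln r \<longrightarrow> (y1 has_field_derivative (p1 - 1) * y1 z + (1 / (4 * exp z) + q2) * y z) (at z)"
      using Dy by blast+
    have DyA': "\<forall>z. Re z < ln r \<longrightarrow> (y' has_field_derivative y1' z) (at z)" "\<forall>z. Re z < ln r \<longrightarrow> (y1' has_field_derivative (p1 - 1) * y1' z + (1 / (4 * exp z) + q2) * y' z) (at z)"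
      using Dy' by blast+
    have T: "(Z has_field_derivative Z1 w) (at w)"
      "(Z1 has_field_derivative (x * deriv e x / e x + (p1' - 1) * e x) * Z1 w + (e x)\<^sup>2 * (1 / (4 * ph x) + q2') * Z w) (at w)"
      unfolding Z_def Z1_def by (rule tr[OF DyA w(2,1)])+
    have T': "(Z' has_field_derivative Z1' w) (at w)"
      "(Z1' has_field_derivative (x * deriv e x / e x + (p1' - 1) * e x) * Z1' w + (e x)\<^sup>2 * (1 / (4 * ph x) + q2') * Z' w) (at w)"
      unfolding Z'_def Z1'_def by (rule tr[OF DyA' w(2,1)])+
    define W where "W z = Z z * Z1' z - Z' z * Z1 z" for z
    have W: "W z = (t (exp z))\<^sup>2 * exp ((p1 - 1) * z)" if "Re z < ln r" for z
    proof -
      have "W z = (t (exp z))\<^sup>2 * (exp ((p1 - 1) / 2 * z) * exp ((p1 - 1) / 2 * z)) * (v z * d' z - v' z * d z)"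
        by (simp add: W_def Z_def Z1_def Z'_def Z1'_def y_def y1_def y'_def y1'_def algebra_simps power2_eq_square)
      also have "exp ((p1 - 1) / 2 * z) * exp ((p1 - 1) / 2 * z) = exp ((p1 - 1) * z)"
        unfolding exp_add[symmetric] by (rule arg_cong[of _ _ exp]) (simp add: field_simps)
      finally show ?thesis using wr[OF that] by simp
    qed
    have "(W has_field_derivative (Z1 w * Z1' w + ((x * deriv e x / e x + (p1' - 1) * e x) * Z1' w + (e x)\<^sup>2 * (1 / (4 * ph x) + q2') * Z' w) * Z w)
       - (Z1' w * Z1 w + ((x * deriv e x / e x + (p1' - 1) * e x) * Z1 w + (e x)\<^sup>2 * (1 / (4 * ph x) + q2') * Z w) * Z' w)) (at w)"
      unfolding W_def by (intro DERIV_diff DERIV_mult T T')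
    then have "(W has_field_derivative (x * deriv e x / e x + (p1' - 1) * e x) * W w) (at w)"
      by (simp add: W_def algebra_simps)
    then have 1: "((\<lambda>z. (t (exp z))\<^sup>2 * exp ((p1 - 1) * z)) has_field_derivative (x * deriv e x / e x + (p1' - 1) * e x) * W w) (at w)"
      by (rule has_field_derivative_transform_within_open[OF _ open_halfspace_Re_lt[of "ln r"]]) (use W w in auto)
    have e': "((\<lambda>z. exp ((p1 - 1) * z)) has_field_derivative (p1 - 1) * exp ((p1 - 1) * w)) (at w)" by (auto intro!: derivative_eq_intros)
    have "((\<lambda>z. (t (exp z) * t (exp z)) * exp ((p1 - 1) * z)) has_field_derivative
       ((exp w * deriv t (exp w)) * t (exp w) + (exp w * deriv t (exp w)) * t (exp w)) * exp ((p1 - 1) * w) + (p1 - 1) * exp ((p1 - 1) * w) * (t (exp w) * t (exp w))) (at w)"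
      by (intro DERIV_mult e' DERIV_comp_exp[OF t(1) xw'[OF w(2)]])
    then have "(x * deriv e x / e x + (p1' - 1) * e x) * W w =
       ((x * deriv t x) * t x + (x * deriv t x) * t x) * exp ((p1 - 1) * w) + (p1 - 1) * exp ((p1 - 1) * w) * (t x * t x)"
      using DERIV_unique[OF 1] by (simp add: power2_eq_square w(1))
    also have "\<dots> = (2 * (x * deriv t x) / t x + (p1 - 1)) * W w"
      unfolding W[OF w(2)] w(1)[symmetric] using t(2)[OF x(1)] by (simp add: field_simps power2_eq_square)
    finally show "x * deriv e x / e x + (p1' - 1) * e x = 2 * (x * deriv t x) / t x + (p1 - 1)"
      using W[OF w(2)] t(2)[OF x(1)] w(1) by simp
  qed
  from this[of 0] show pp: "p1 = p1'" using r by (simp add: e_def)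
  define P where "P = p1 - 1"
  obtain v d where v: "solution_on UNIV (\<lambda>w. (1/4) / exp w + \<rho>\<^sup>2) v d"
    and vper: "\<And>w. v (w + ?p) = exp (?p * (- \<rho>)) * v w" and vnz: "\<And>c. \<exists>w. Re w < c \<and> v w \<noteq> 0"
    using frobenius_solution[OF rho(2), of "1/4"] by metis
  obtain v' d' where v': "solution_on UNIV (\<lambda>w. (1/4) / exp w + \<rho>'\<^sup>2) v' d'"
    and vper': "\<And>w. v' (w + ?p) = exp (?p * (- \<rho>')) * v' w" and vnz': "\<And>c. \<exists>w. Re w < c \<and> v' w \<noteq> 0"
    using frobenius_solution[OF rho'(2), of "1/4"] by metis
  define y where "y = (\<lambda>w. exp (P / 2 * w) * v w)"
  define y1 where "y1 = (\<lambda>w. exp (P / 2 * w) * (P / 2 * v w + d w))"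
  define y' where "y' = (\<lambda>w. exp (P / 2 * w) * v' w)"
  define y1' where "y1' = (\<lambda>w. exp (P / 2 * w) * (P / 2 * v' w + d' w))"
  have Dy: "(y has_field_derivative y1 z) (at z)" "(y1 has_field_derivative (p1 - 1) * y1 z + (1 / (4 * exp z) + q2) * y z) (at z)" for z
    using untwist_solution[OF v rho(1), of z] by (auto simp: y_def y1_def P_def)
  have Dy': "(y' has_field_derivative y1' z) (at z)" "(y1' has_field_derivative P * y1' z + (1 / (4 * exp z) + q2') * y' z) (at z)" for z
    using untwist_solution[OF v' rho'(1), of z] by (auto simp: y'_def y1'_def P_def pp)
  have Pp: "exp (P / 2 * (w + ?p)) = exp (P * of_real pi * \<i>) * exp (P / 2 * w)" for w
    unfolding exp_add[symmetric] by (simp add: algebra_simps)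
  define La where "La = exp (P * of_real pi * \<i>) * exp (?p * (- \<rho>))"
  define La' where "La' = exp (P * of_real pi * \<i>) * exp (?p * (- \<rho>'))"
  have yper: "y (w + ?p) = La * y w" "y' (w + ?p) = La' * y' w" for w
    unfolding y_def y'_def Pp vper vper' La_def La'_def by (simp_all add: mult_ac)
  define om where "om w = w + l (exp w)" for w
  have eom: "exp (om w) = ph (exp w)" if "Re w < ln r" for w
    using l(2)[OF xw'[OF that]] p(2)[OF xw'[OF that]] by (simp add: om_def exp_add)
  have dom: "(om has_field_derivative e (exp w)) (at w)" if "Re w < ln r" for w
    unfolding om_def e_def by (intro DERIV_add DERIV_ident DERIV_comp_exp[OF l(1) xw'[OF that]])
  have omper: "om (w + ?p) = om w + ?p" for w by (simp add: om_def exp_add)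
  define Z where "Z = (\<lambda>w. t (exp w) * y w)"
  define Z1 where "Z1 = (\<lambda>w. exp w * deriv t (exp w) * y w + t (exp w) * y1 w)"
  \<comment> \<open>The target eigenvector pulled back along \<open>om\<close>. It and the
    transported eigenvector \<open>Z\<close> satisfy the same second-order equation, with
    first-order coefficient \<open>c\<close>.\<close>
  define X where "X w = y' (om w)" for w
  define X1 where "X1 w = e (exp w) * y1' (om w)" for w
  define c where "c w = exp w * deriv e (exp w) / e (exp w) + P * e (exp w)" for w
  define g where "g w = (e (exp w))\<^sup>2 * (1 / (4 * ph (exp w)) + q2')" for w
  have DyA: "\<forall>z. Re z < ln r \<longrightarrow> (y has_field_derivative y1 z) (at z)" "\<forall>z. Re z < ln r \<longrightarrow> (y1 has_field_derivative (p1 - 1) * y1 z + (1 / (4 * exp z) + q2) * y z) (at z)"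
      using Dy by blast+
  have DZ: "(Z has_field_derivative Z1 w) (at w)" "(Z1 has_field_derivative c w * Z1 w + g w * Z w) (at w)" if w: "Re w < ln r" for w
    using tr[OF DyA w refl] by (auto simp: c_def g_def P_def pp Z_def Z1_def)
  have DX: "(X has_field_derivative X1 w) (at w)" "(X1 has_field_derivative c w * X1 w + g w * X w) (at w)" if w: "Re w < ln r" for w
  proof -
    have "(X has_field_derivative y1' (om w) * e (exp w)) (at w)" unfolding X_def by (rule DERIV_chain2[OF Dy'(1) dom[OF w]])
    then show "(X has_field_derivative X1 w) (at w)" by (simp add: X1_def mult.commute)
    have "(X1 has_field_derivative (exp w * deriv e (exp w)) * y1' (om w) + (P * y1' (om w) + (1 / (4 * exp (om w)) + q2') * y' (om w)) * e (exp w) * e (exp w)) (at w)"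
      unfolding X1_def by (rule DERIV_mult[OF DERIV_comp_exp[OF eh xw'[OF w]] DERIV_chain2[OF Dy'(2) dom[OF w]]])
    moreover have "(exp w * deriv e (exp w)) * y1' (om w) + (P * y1' (om w) + (1 / (4 * exp (om w)) + q2') * y' (om w)) * e (exp w) * e (exp w) = c w * X1 w + g w * X w"
      unfolding eom[OF w] c_def g_def X1_def X_def using enz[OF xw'[OF w]] by (simp add: algebra_simps power2_eq_square)
    ultimately show "(X1 has_field_derivative c w * X1 w + g w * X w) (at w)" by simp
  qed
  define W where "W w = Z w * X1 w - X w * Z1 w" for w
  \<comment> \<open>A nonvanishing solution of the first-order equation of the Wronskian, so
    \<open>W / N\<close> is constant; its multiplier is that of the factor
    \<open>exp (P * om w)\<close>.\<close>
  define N where "N w = e (exp w) * exp (P * om w)" for w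
  have Nnz: "N w \<noteq> 0" if "Re w < ln r" for w using enz[OF xw'[OF that]] by (simp add: N_def)
  have "\<exists>C. \<forall>w\<in>?H. W w / N w = C"
  proof (rule has_field_derivative_zero_constant[OF convex_halfspace_Re_lt])
    fix w assume "w \<in> ?H"
    then have w: "Re w < ln r" by simp
    have "(W has_field_derivative (Z1 w * X1 w + (c w * X1 w + g w * X w) * Z w) - (X1 w * Z1 w + (c w * Z1 w + g w * Z w) * X w)) (at w)"
      unfolding W_def by (intro DERIV_diff DERIV_mult DZ DX w)
    then have dW: "(W has_field_derivative c w * W w) (at w)" by (simp add: W_def algebra_simps)
    have "((\<lambda>w. exp (P * om w)) has_field_derivative exp (P * om w) * (P * e (exp w))) (at w)"
      by (rule DERIV_chain2[OF DERIV_exp DERIV_cmult[OF dom[OF w]]])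
    then have "(N has_field_derivative (exp w * deriv e (exp w)) * exp (P * om w) + exp (P * om w) * (P * e (exp w)) * e (exp w)) (at w)"
      unfolding N_def by (intro DERIV_mult DERIV_comp_exp[OF eh xw'[OF w]])
    moreover have "(exp w * deriv e (exp w)) * exp (P * om w) + exp (P * om w) * (P * e (exp w)) * e (exp w) = c w * N w"
      using enz[OF xw'[OF w]] by (simp add: c_def N_def algebra_simps)
    ultimately have dN: "(N has_field_derivative c w * N w) (at w)" by simp
    have "((\<lambda>w. W w / N w) has_field_derivative (c w * W w * N w - W w * (c w * N w)) / (N w * N w)) (at w)"
      by (rule DERIV_divide[OF dW dN Nnz[OF w]])
    then show "((\<lambda>w. W w / N w) has_field_derivative 0) (at w within ?H)" by (simp add: has_field_derivative_at_within mult_ac)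
  qed
  then obtain C where C: "\<And>w. Re w < ln r \<Longrightarrow> W w = C * N w" using Nnz by (auto simp: field_simps)
  have ex: "exp (w + ?p) = exp w" for w by (simp add: exp_add)
  have perZ: "Z (w + ?p) = La * Z w" for w unfolding Z_def ex yper by (simp only: mult_ac)
  have perX: "X (w + ?p) = La' * X w" for w unfolding X_def omper yper ..
  have perZ1: "Z1 (w + ?p) = La * Z1 w" if "Re w < ln r" for w by (rule derivative_multiplier[OF DZ(1) perZ that])
  have perX1: "X1 (w + ?p) = La' * X1 w" if "Re w < ln r" for w by (rule derivative_multiplier[OF DX(1) perX that])
  obtain w0 where w0: "Re w0 < ln r" "v w0 \<noteq> 0" using vnz by blast
  have Z0: "Z w0 \<noteq> 0" using w0 t(2)[OF xw'[OF w0(1)]] by (simp add: Z_def y_def)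
  have Zh: "Z holomorphic_on ?H" and Xh: "X holomorphic_on ?H"
    using DZ(1) DX(1) by (auto simp: holomorphic_on_open[OF open_halfspace_Re_lt])
  \<comment> \<open>A nonzero Wronskian has the multiplier \<open>La * La'\<close> and also that of
    \<open>N\<close>; a vanishing one makes the two eigenvectors proportional.\<close>
  have "La = La' \<or> La * La' = exp (P * ?p)"
  proof (cases "C = 0")
    case False
    have "W (w0 + ?p) = La * La' * W w0" unfolding W_def perZ perX perZ1[OF w0(1)] perX1[OF w0(1)] by (simp add: algebra_simps)
    moreover have "N (w0 + ?p) = exp (P * ?p) * N w0" unfolding N_def omper distrib_left[of P] ex exp_add[of "P * om w0"] by (simp only: mult_ac)
    ultimately have "La * La' * (C * N w0) = C * (exp (P * ?p) * N w0)" using C[OF w0(1)] C[of "w0 + ?p"] w0(1) by auto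
    then have "(C * N w0) * (La * La') = (C * N w0) * exp (P * ?p)" by (simp only: mult_ac)
    then show ?thesis using False Nnz[OF w0(1)] by (simp only: mult_cancel_left) auto
  next
    case True
    then have W0: "W w = 0" if "Re w < ln r" for w using C[OF that] by simp
    \<comment> \<open>The quotient \<open>X / Z\<close> is constant near a point with
      \<open>Z \<noteq> 0\<close>; analytic continuation then gives proportionality on the whole
      half-plane.\<close>
    have "open {w \<in> ?H. Z w \<in> - {0}}"
      using continuous_open_preimage[OF holomorphic_on_imp_continuous_on[OF Zh] open_halfspace_Re_lt, of "- {0}"] by (simp add: vimage_def Int_def open_delete Compl_eq_Diff_UNIV)
    then obtain s where s: "0 < s" "ball w0 s \<subseteq> {w \<in> ?H. Z w \<in> - {0}}" using w0(1) Z0 open_contains_ball[of "{w \<in> ?H. Z w \<in> - {0}}"] by blast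
    have "\<exists>K. \<forall>w\<in>ball w0 s. X w / Z w = K"
    proof (rule has_field_derivative_zero_constant[OF convex_ball])
      fix w assume "w \<in> ball w0 s"
      then have w: "Re w < ln r" "Z w \<noteq> 0" using s by auto
      have "((\<lambda>w. X w / Z w) has_field_derivative (X1 w * Z w - X w * Z1 w) / (Z w * Z w)) (at w)"
        by (rule DERIV_divide[OF DX(1)[OF w(1)] DZ(1)[OF w(1)] w(2)])
      then show "((\<lambda>w. X w / Z w) has_field_derivative 0) (at w within ball w0 s)"
        using W0[OF w(1)] by (simp add: W_def mult.commute has_field_derivative_at_within)
    qed
    then obtain K where K: "\<And>w. w \<in> ball w0 s \<Longrightarrow> X w = K * Z w" using s(2) by (auto simp: field_simps subset_iff)
    have XK: "X w = K * Z w" if "w \<in> ?H" for w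
    proof (rule analytic_continuation_open[of "ball w0 s" ?H X "\<lambda>w. K * Z w" w])
      show "connected ?H" by (rule convex_connected[OF convex_halfspace_Re_lt])
      show "ball w0 s \<subseteq> ?H" using s by auto
    qed (use s K that Xh Zh in \<open>auto intro!: holomorphic_intros open_halfspace_Re_lt\<close>)
    \<comment> \<open>If the pulled-back eigenvector were 0, \<open>v'\<close> and its derivative
      would vanish at \<open>om w0\<close>, and uniqueness would contradict
      \<open>vnz'\<close>.\<close>
    have "K \<noteq> 0"
    proof
      assume K0: "K = 0"
      have X0: "X w = 0" if "w \<in> ?H" for w using XK[OF that] K0 by simp
      have "((\<lambda>w. 0) has_field_derivative X1 w0) (at w0)"
        by (rule has_field_derivative_transform_within_open[OF DX(1)[OF w0(1)] open_halfspace_Re_lt[of "ln r"]]) (use w0 X0 in auto)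
      then have "X1 w0 = 0" using DERIV_const DERIV_unique by blast
      then have z: "v' (om w0) = 0" "d' (om w0) = 0"
        using X0[of w0] w0 enz[OF xw'[OF w0(1)]] by (auto simp: X_def X1_def y'_def y1'_def)
      define b where "b = Re (om w0) + 1"
      obtain u where u: "Re u < b" "v' u \<noteq> 0" using vnz' by blast
      have ob: "Re (om w0) < b" by (simp add: b_def)
      obtain c1 c1' where c1: "solution_on {w. Re w < b} (\<lambda>w. 1/4 / exp w + \<rho>'\<^sup>2) c1 c1'" "c1 (om w0) = 1" "c1' (om w0) = 0"
        using linear_ode_exists_halfplane[OF qh ob] by metis
      obtain s1 s1' where s1: "solution_on {w. Re w < b} (\<lambda>w. 1/4 / exp w + \<rho>'\<^sup>2) s1 s1'" "s1 (om w0) = 0" "s1' (om w0) = 1"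
        using linear_ode_exists_halfplane[OF qh ob] by metis
      have z0: "solution_on {w. Re w < b} (\<lambda>w. 1/4 / exp w + \<rho>'\<^sup>2) (\<lambda>_. 0) (\<lambda>_. 0)" by (simp add: solution_on_def)
      have "v' u = 0"
        by (rule solution_unique(1)[OF solution_on_subset[OF v'] z0 c1(1) s1(1) convex_halfspace_Re_lt, of "om w0"]) (use ob u z c1 s1 in auto)
      then show False using u by simp
    qed
    have "X (w0 + ?p) = K * Z (w0 + ?p)" using XK[of "w0 + ?p"] w0(1) by simp
    then have "La' * (K * Z w0) = K * (La * Z w0)" unfolding perX perZ using XK[of w0] w0(1) by auto
    then have "(K * Z w0) * La' = (K * Z w0) * La" by (simp only: mult_ac)
    then have "La' = La" using \<open>K \<noteq> 0\<close> Z0 by simp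
    then show ?thesis by simp
  qed
  then show "exp (?p * \<rho>) = exp (?p * \<rho>') \<or> exp (?p * \<rho>) * exp (?p * \<rho>') = 1"
  proof
    assume "La = La'"
    then have "exp (?p * (- \<rho>)) = exp (?p * (- \<rho>'))" by (simp add: La_def La'_def)
    then have "inverse (exp (?p * \<rho>)) = inverse (exp (?p * \<rho>'))" by (simp add: exp_minus)
    then show ?thesis by simp
  next
    assume *: "La * La' = exp (P * ?p)"
    have PP: "exp (P * of_real pi * \<i>) * exp (P * of_real pi * \<i>) = exp (P * ?p)" unfolding exp_add[symmetric] by (simp add: algebra_simps)
    have "La * La' = exp (P * ?p) * (exp (?p * (- \<rho>)) * exp (?p * (- \<rho>')))"
      unfolding PP[symmetric] La_def La'_def by (simp only: mult_ac)
    then have "exp (?p * (- \<rho>)) * exp (?p * (- \<rho>')) = 1" using * by simp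
    then have "inverse (exp (?p * \<rho>) * exp (?p * \<rho>')) = 1" by (simp add: exp_minus)
    then show ?thesis using inverse_eq_1_iff by blast
  qed
qed

section \<open>Monodromy eigenvalues and the classification\<close>

lemma multiplier_exists:
  assumes q: "q holomorphic_on {w. Re w < c}" and qper: "\<And>w. q (w + 2 * of_real pi * \<i>) = q w"
  obtains v d l w1 where "solution_on {w. Re w < c} q v d" "\<And>w. Re w < c \<Longrightarrow> v (w + 2 * of_real pi * \<i>) = l * v w"
    "Re w1 < c" "v w1 \<noteq> (0::complex)"
proof -
  let ?H = "{w. Re w < c}" let ?p = "2 * of_real pi * \<i>"
  define w0 where "w0 = complex_of_real (c - 1)"
  have w0: "Re w0 < c" by (simp add: w0_def)
  obtain f f' where f: "solution_on ?H q f f'" "f w0 = 1" "f' w0 = 0" using linear_ode_exists_halfplane[OF q w0] by metis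
  obtain s s' where s: "solution_on ?H q s s'" "s w0 = 0" "s' w0 = 1" using linear_ode_exists_halfplane[OF q w0] by metis
  have fp: "solution_on ?H q (\<lambda>w. f (w + ?p)) (\<lambda>w. f' (w + ?p))" by (rule solution_on_shift[OF f(1)]) (use qper in auto)
  have sp: "solution_on ?H q (\<lambda>w. s (w + ?p)) (\<lambda>w. s' (w + ?p))" by (rule solution_on_shift[OF s(1)]) (use qper in auto)
  define A where "A = f (w0 + ?p)" define B where "B = f' (w0 + ?p)"
  define C where "C = s (w0 + ?p)" define D where "D = s' (w0 + ?p)"
  have W: "f w0 * s' w0 - s w0 * f' w0 = 1" using f s by simp
  have fe: "f (w + ?p) = A * f w + B * s w" if "Re w < c" for w
    by (rule solution_unique(1)[OF fp solution_on_linear[OF f(1) s(1)] f(1) s(1) convex_halfspace_Re_lt, of w0])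
       (use that w0 f s W in \<open>auto simp: A_def B_def\<close>)
  have se: "s (w + ?p) = C * f w + D * s w" if "Re w < c" for w
    by (rule solution_unique(1)[OF sp solution_on_linear[OF f(1) s(1)] f(1) s(1) convex_halfspace_Re_lt, of w0])
       (use that w0 f s W in \<open>auto simp: C_def D_def\<close>)
  show ?thesis
  proof (cases "B = 0")
    case True
    show ?thesis by (rule that[OF f(1), of A w0]) (use True fe f w0 in auto)
  next
    case False
    \<comment> \<open>A root of the characteristic polynomial of the monodromy matrix with rows (A,
      B), (C, D) in the basis \<open>f\<close>, \<open>s\<close>. The combination with coefficients
      \<open>l - D\<close>, \<open>B\<close> is an eigenvector; it is not 0, since its derivative at
      \<open>w0\<close> is \<open>B\<close>.\<close>
    define l where "l = ((A + D) + csqrt ((A - D)\<^sup>2 + 4 * B * C)) / 2"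
    have "(csqrt ((A - D)\<^sup>2 + 4 * B * C))\<^sup>2 = (A - D)\<^sup>2 + 4 * B * C" by simp
    moreover have "csqrt ((A - D)\<^sup>2 + 4 * B * C) = 2 * l - (A + D)" by (simp add: l_def field_simps)
    ultimately have "(2 * l - (A + D))\<^sup>2 = (A - D)\<^sup>2 + 4 * B * C" by simp
    then have l: "l * l = (A + D) * l - A * D + B * C" by algebra
    have sol: "solution_on ?H q (\<lambda>w. (l - D) * f w + B * s w) (\<lambda>w. (l - D) * f' w + B * s' w)"
      by (rule solution_on_linear[OF f(1) s(1)])
    have "\<exists>w1. Re w1 < c \<and> (l - D) * f w1 + B * s w1 \<noteq> 0"
    proof (rule ccontr)
      assume "\<not> ?thesis"
      then have z: "(l - D) * f w + B * s w = 0" if "w \<in> ?H" for w using that by auto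
      have "w0 \<in> ?H" using w0 by simp
      note d = solution_onD(1)[OF sol this]
      have "((\<lambda>w. 0) has_field_derivative (l - D) * f' w0 + B * s' w0) (at w0)"
        by (rule has_field_derivative_transform_within_open[OF d open_halfspace_Re_lt[of c]]) (use z w0 in auto)
      then have "(l - D) * f' w0 + B * s' w0 = 0" using DERIV_const DERIV_unique by blast
      then show False using f s False by simp
    qed
    then obtain w1 where w1: "Re w1 < c" "(l - D) * f w1 + B * s w1 \<noteq> 0" by blast
    show ?thesis
    proof (rule that[OF sol _ w1(1)])
      fix w assume w: "Re w < c"
      have "(l - D) * (A * f w + B * s w) + B * (C * f w + D * s w) - l * ((l - D) * f w + B * s w)
         = f w * ((A + D) * l - A * D + B * C - l * l)" by (simp add: algebra_simps)
      then show "(l - D) * f (w + ?p) + B * s (w + ?p) = l * ((l - D) * f w + B * s w)"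
        unfolding fe[OF w] se[OF w] l by simp
    qed (use w1 in simp)
  qed
qed

text \<open>Subtracting an integer from the exponent keeps the multiplier and makes the real part
  nonpositive.\<close>

lemma exponent_exists:
  assumes "l \<noteq> 0"
  obtains a where "Re a \<le> 0" "exp (2 * of_real pi * \<i> * a) = l"
proof -
  define a0 where "a0 = Ln l / (2 * of_real pi * \<i>)"
  obtain n :: nat where n: "Re a0 \<le> real n" using real_arch_simple by blast
  show ?thesis
  proof (rule that[of "a0 - of_nat n"])
    show "Re (a0 - of_nat n) \<le> 0" using n by simp
    have "2 * of_real pi * \<i> * (a0 - of_nat n) = Ln l - of_nat n * (2 * of_real pi * \<i>)" by (simp add: a0_def algebra_simps)
    moreover have "exp (of_nat n * (2 * of_real pi * \<i>)) = 1" by (simp add: exp_of_nat_mult)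
    ultimately show "exp (2 * of_real pi * \<i> * (a0 - of_nat n)) = l" using assms by (simp add: exp_diff)
  qed
qed

lemma normal_form_exists:
  assumes rk: "rank1_LDE p q" and nd: "nondeg_resonant_irregular p q"
  shows "\<exists>p1 q2. analytically_equivalent p q (nf_p p1) (nf_q q2)"
proof -
  \<comment> \<open>\<open>delta1\<close> vanishes at 0, so with \<open>p 0 = 0\<close> the
    condition on \<open>Delta\<close> reads 4 q(0) = 0.\<close>
  have p0: "p 0 = 0" and q0: "q 0 = 0" using nd by (auto simp: nondeg_resonant_irregular_def Delta_def delta1_def)
  obtain R1 where R1: "R1 > 0" "p holomorphic_on ball 0 R1" using rk by (auto simp: rank1_LDE_def analytic_on_def)
  obtain R2 where R2: "R2 > 0" "q holomorphic_on ball 0 R2" using rk by (auto simp: rank1_LDE_def analytic_on_def)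
  define R where "R = min R1 R2"
  have R: "0 < R" using R1 R2 by (simp add: R_def)
  have pqh: "p holomorphic_on ball 0 R" "q holomorphic_on ball 0 R"
    using R1(2) R2(2) by (auto intro: holomorphic_on_subset simp: R_def)
  obtain pa where pa: "pa holomorphic_on ball 0 R" "\<And>x. x \<in> ball 0 R \<Longrightarrow> p x = (x - 0) * pa x"
    by (rule holomorphic_divide_root[OF pqh(1) open_ball, of 0]) (use p0 in auto)
  obtain qa where qa: "qa holomorphic_on ball 0 R" "\<And>x. x \<in> ball 0 R \<Longrightarrow> q x = (x - 0) * qa x"
    by (rule holomorphic_divide_root[OF pqh(2) open_ball, of 0]) (use q0 in auto)
  define A where "A = qa 0"
  obtain qb where qb: "qb holomorphic_on ball 0 R" "\<And>x. x \<in> ball 0 R \<Longrightarrow> qa x - A = (x - 0) * qb x"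
    by (rule holomorphic_divide_root[of "\<lambda>x. qa x - A" "ball 0 R" 0]) (use qa in \<open>auto intro!: holomorphic_intros simp: A_def\<close>)
  \<comment> \<open>If \<open>q\<close> vanished to second order, both rank-zero coefficients would
    be holomorphic at 0, against the minimality of the rank.\<close>
  have A: "A \<noteq> 0"
  proof
    assume "A = 0"
    then have "holo_ext_at0 (\<lambda>x. q x / x\<^sup>2)" unfolding holo_ext_at0_def
      using qb qa(2) R by (intro exI[of _ qb] exI[of _ R]) (auto simp: power2_eq_square)
    moreover have "holo_ext_at0 (\<lambda>x. p x / x - 1)" unfolding holo_ext_at0_def
      using pa R by (intro exI[of _ "\<lambda>x. pa x - 1"] exI[of _ R]) (auto intro!: holomorphic_intros)
    ultimately show False using rk by (simp add: rank1_LDE_def)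
  qed
  have pf: "p x = x * pa x" if "x \<in> ball 0 R" for x using pa(2)[OF that] by simp
  have qf: "q x = x * (A + x * qb x)" if "x \<in> ball 0 R" for x using qa(2)[OF that] qb(2)[OF that] by (simp add: algebra_simps)
  define Q where "Q w = A / exp w + (qb (exp w) + (pa (exp w) - 1)\<^sup>2 / 4 - exp w * deriv pa (exp w) / 2)" for w
  have im: "exp ` {w. Re w < ln R} \<subseteq> ball 0 R"
    by (rule image_subsetI) (use exp_in_punctured_ball[OF R] in blast)
  have cmp: "(\<lambda>w. f (exp w)) holomorphic_on {w. Re w < ln R}" if "f holomorphic_on ball 0 R" for f
    using holomorphic_on_compose_gen[OF holomorphic_on_exp that im] by (simp add: o_def)
  have Qh: "Q holomorphic_on {w. Re w < ln R}" unfolding Q_def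
    by (intro holomorphic_intros cmp qb(1) pa(1) holomorphic_deriv open_ball) auto
  have Qper: "Q (w + 2 * of_real pi * \<i>) = Q w" for w by (simp add: Q_def exp_add)
  obtain v d l w1 where v: "solution_on {w. Re w < ln R} Q v d"
    and vper: "\<And>w. Re w < ln R \<Longrightarrow> v (w + 2 * of_real pi * \<i>) = l * v w" and nz: "Re w1 < ln R" "v w1 \<noteq> 0"
    using multiplier_exists[OF Qh Qper] by metis
  have "l \<noteq> 0" by (rule floquet_complement[OF v Qh Qper vper nz]) auto
  then obtain a where a: "Re a \<le> 0" "exp (2 * of_real pi * \<i> * a) = l" by (rule exponent_exists)
  have "analytically_equivalent p q (nf_p (pa 0)) (nf_q (a\<^sup>2 - (pa 0 - 1)\<^sup>2 / 4))"
    by (rule floquet_equivalence[OF R pa(1) qb(1) A a(1) pf qf v[unfolded Q_def[abs_def]] _ nz]) (use vper a(2) in auto)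
  then show ?thesis by blast
qed

text \<open>1 + p1^2 + 4 q2 - 2 p1 = (p1 - 1)^2 + 4 q2, so half the root is the exponent of the
  untwisted normal form at infinity; the principal root has the sign that the Frobenius series
  requires.\<close>

lemma csqrt_exponent:
  "(csqrt (1 + Delta2 p1 q2) / 2)\<^sup>2 = q2 + (p1 - 1)\<^sup>2 / 4" "0 \<le> Re (csqrt (1 + Delta2 p1 q2) / 2)"
proof -
  have "(csqrt (1 + Delta2 p1 q2) / 2)\<^sup>2 = (1 + Delta2 p1 q2) / 4" by (simp add: power_divide)
  also have "\<dots> = q2 + (p1 - 1)\<^sup>2 / 4" by (simp add: Delta2_def power2_eq_square field_simps)
  finally show "(csqrt (1 + Delta2 p1 q2) / 2)\<^sup>2 = q2 + (p1 - 1)\<^sup>2 / 4" .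
  show "0 \<le> Re (csqrt (1 + Delta2 p1 q2) / 2)" using csqrt_principal[of "1 + Delta2 p1 q2"] by auto
qed

text \<open>With x, y the two exponentials, x + 1/x = y + 1/y amounts to (x - y) (x y - 1) =
  0.\<close>

lemma cos_eq_iff_multiplier:
  "cos (2 * of_real pi * \<rho>) = cos (2 * of_real pi * \<rho>') \<longleftrightarrow>
     exp (2 * of_real pi * \<i> * \<rho>) = exp (2 * of_real pi * \<i> * \<rho>') \<or> exp (2 * of_real pi * \<i> * \<rho>) * exp (2 * of_real pi * \<i> * \<rho>') = 1"
proof -
  define x where "x = exp (2 * of_real pi * \<i> * \<rho>)"
  define y where "y = exp (2 * of_real pi * \<i> * \<rho>')"
  have xy: "x \<noteq> 0" "y \<noteq> 0" by (auto simp: x_def y_def)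
  have c: "cos (2 * of_real pi * r) = (exp (2 * of_real pi * \<i> * r) + 1 / exp (2 * of_real pi * \<i> * r)) / 2" for r
    by (simp add: cos_exp_eq exp_minus inverse_eq_divide mult_ac)
  have "(x + 1/x) - (y + 1/y) = (x - y) * (x * y - 1) / (x * y)" using xy by (simp add: field_simps)
  then have "x + 1/x = y + 1/y \<longleftrightarrow> (x - y) * (x * y - 1) = 0" using xy by (metis divide_eq_0_iff eq_iff_diff_eq_0 mult_eq_0_iff)
  then have "x + 1/x = y + 1/y \<longleftrightarrow> x = y \<or> x * y = 1" by simp
  moreover have "(x + 1/x) / 2 = (y + 1/y) / 2 \<longleftrightarrow> x + 1/x = y + 1/y" for x y :: complex by (simp only: divide_cancel_right) simp
  ultimately show ?thesis unfolding c x_def[symmetric] y_def[symmetric] by (simp only:)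
qed

text \<open>The untwisted first equation has the monodromy eigenvalues exp (\<plusminus> 2 \<pi>
  \<i> \<rho>), and by assumption exp (- 2 \<pi> \<i> \<rho>') is one of them. With an eigenvector
  for it and the exponent - \<rho>', the reduction to normal form lands on the second
  equation.\<close>

lemma nf_equivalentI:
  fixes p1 q2 q2' \<rho> \<rho>' :: complex
  assumes rho: "\<rho>\<^sup>2 = q2 + (p1 - 1)\<^sup>2 / 4" "0 \<le> Re \<rho>" and rho': "\<rho>'\<^sup>2 = q2' + (p1 - 1)\<^sup>2 / 4" "0 \<le> Re \<rho>'"
    and eq: "exp (2 * of_real pi * \<i> * \<rho>) = exp (2 * of_real pi * \<i> * \<rho>') \<or> exp (2 * of_real pi * \<i> * \<rho>) * exp (2 * of_real pi * \<i> * \<rho>') = 1"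
  shows "analytically_equivalent (nf_p p1) (nf_q q2) (nf_p p1) (nf_q q2')"
proof -
  let ?p = "2 * of_real pi * \<i>" let ?H = "{w::complex. Re w < ln 1}" let ?q = "\<lambda>w. 1/4 / exp w + \<rho>\<^sup>2"
  have qh: "?q holomorphic_on ?H" by (intro holomorphic_intros) auto
  have qper: "?q (w + ?p) = ?q w" for w by (simp add: exp_add)
  obtain v d where v: "solution_on UNIV ?q v d" and vper: "\<And>w. v (w + ?p) = exp (?p * (- \<rho>)) * v w"
    and vnz: "\<And>c. \<exists>w. Re w < c \<and> v w \<noteq> 0"
    using frobenius_solution[OF rho(2), of "1/4"] by metis
  have vH: "solution_on ?H ?q v d" by (rule solution_on_subset[OF v]) simp
  obtain w0 where w0: "Re w0 < ln 1" "v w0 \<noteq> 0" using vnz by blast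
  have "\<exists>v d w1. solution_on ?H ?q v d \<and> (\<forall>w. Re w < ln 1 \<longrightarrow> v (w + ?p) = exp (?p * (- \<rho>')) * v w) \<and> Re w1 < ln 1 \<and> v w1 \<noteq> 0"
  proof (cases "exp (?p * (- \<rho>)) = exp (?p * (- \<rho>'))")
    case True
    then show ?thesis using vH vper w0 by (intro exI[of _ v] exI[of _ d] exI[of _ w0]) auto
  next
    case False
    then have "exp (?p * \<rho>) \<noteq> exp (?p * \<rho>')" by (auto simp: exp_minus)
    then have "exp (?p * \<rho>) * exp (?p * \<rho>') = 1" using eq by blast
    then have inv': "exp (?p * (- \<rho>')) = 1 / exp (?p * (- \<rho>))" by (simp add: exp_minus field_simps)
    show ?thesis
    \<comment> \<open>In the remaining case the wanted multiplier is the inverse of that of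
      \<open>v\<close> and belongs to the complementary solution.\<close>
    proof (rule floquet_complement[OF vH qh qper vper w0])
      fix v2 d2 k assume v2: "solution_on ?H ?q v2 d2" and W: "\<And>w. Re w < ln 1 \<Longrightarrow> v w * d2 w - v2 w * d w = 1"
        and per: "\<And>w. Re w < ln 1 \<Longrightarrow> v2 (w + ?p) = k * v w + v2 w / exp (?p * (- \<rho>))" and k: "k \<noteq> 0 \<Longrightarrow> (exp (?p * (- \<rho>)))\<^sup>2 = 1"
      \<comment> \<open>A Jordan block would force the multiplier to equal its inverse, which this
        case excludes.\<close>
      have "k = 0"
      proof (rule ccontr)
        assume "k \<noteq> 0"
        then have "exp (?p * (- \<rho>)) * exp (?p * (- \<rho>)) = 1" using k by (simp add: power2_eq_square)
        then have "exp (?p * (- \<rho>)) = 1 / exp (?p * (- \<rho>))" by (simp add: nonzero_eq_divide_eq)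
        then show False using False inv' by simp
      qed
      have "\<exists>w1. Re w1 < ln 1 \<and> v2 w1 \<noteq> 0"
      proof (rule ccontr)
        assume "\<not> ?thesis"
        then have z: "v2 w = 0" if "w \<in> ?H" for w using that by auto
        have w0H: "w0 \<in> ?H" using w0 by simp
        have "((\<lambda>w. 0) has_field_derivative d2 w0) (at w0)"
          by (rule has_field_derivative_transform_within_open[OF solution_onD(1)[OF v2 w0H] open_halfspace_Re_lt[of "ln 1"]]) (use z w0 in auto)
        then have "d2 w0 = 0" using DERIV_const DERIV_unique by blast
        then show False using W[OF w0(1)] z[OF w0H] by simp
      qed
      then show ?thesis using v2 per inv' \<open>k = 0\<close> by (intro exI[of _ v2] exI[of _ d2]) auto
    qed
  qed
  then obtain v d w1 where v: "solution_on ?H ?q v d" "\<And>w. Re w < ln 1 \<Longrightarrow> v (w + ?p) = exp (?p * (- \<rho>')) * v w" "Re w1 < ln 1" "v w1 \<noteq> 0" by blast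
  have "analytically_equivalent (nf_p p1) (nf_q q2) (nf_p ((\<lambda>_. p1) 0)) (nf_q ((- \<rho>')\<^sup>2 - ((\<lambda>_. p1) 0 - 1)\<^sup>2 / 4))"
  proof (rule floquet_equivalence[where R=1 and A="1/4" and qb="\<lambda>_. q2" and v=v and d=d and ?w1.0=w1])
    show "solution_on ?H (\<lambda>w. 1/4 / exp w + (q2 + ((\<lambda>_. p1) (exp w) - 1)\<^sup>2 / 4 - exp w * deriv (\<lambda>_. p1) (exp w) / 2)) v d"
      using v(1) rho(1) by simp
  qed (use v rho' in \<open>auto simp: nf_p_def nf_q_def algebra_simps power2_eq_square\<close>)
  then show ?thesis using rho' by simp
qed

theorem theoremD:
  shows "(\<forall>p q. rank1_LDE p q \<and> nondeg_resonant_irregular p q \<longrightarrow>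
            (\<exists>p1 q2. analytically_equivalent p q (nf_p p1) (nf_q q2)))
       \<and> (\<forall>p1 q2 x. Delta (nf_p p1) (nf_q q2) x = x + Delta2 p1 q2 * x\<^sup>2)
       \<and> (\<forall>p1 q2 p1' q2'.
            analytically_equivalent (nf_p p1) (nf_q q2) (nf_p p1') (nf_q q2') \<longleftrightarrow>
            p1 = p1' \<and>
            cos (complex_of_real pi * csqrt (1 + Delta2 p1 q2)) =
            cos (complex_of_real pi * csqrt (1 + Delta2 p1' q2')))"
proof (intro conjI allI impI)
  fix p q assume "rank1_LDE p q \<and> nondeg_resonant_irregular p q"
  then show "\<exists>p1 q2. analytically_equivalent p q (nf_p p1) (nf_q q2)" using normal_form_exists by blast
next
  fix p1 q2 x :: complex
  have "deriv (\<lambda>x. p1 * x) x = p1" by (rule DERIV_imp_deriv) (auto intro!: derivative_eq_intros)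
  then show "Delta (nf_p p1) (nf_q q2) x = x + Delta2 p1 q2 * x\<^sup>2"
    by (simp add: Delta_def delta1_def nf_p_def nf_q_def Delta2_def power2_eq_square algebra_simps)
next
  fix p1 q2 p1' q2' :: complex
  \<comment> \<open>Halving makes the cosine that of 2 \<pi> \<rho>, which is half the trace of the
    untwisted monodromy.\<close>
  define \<rho> where "\<rho> = csqrt (1 + Delta2 p1 q2) / 2"
  define \<rho>' where "\<rho>' = csqrt (1 + Delta2 p1' q2') / 2"
  note r = csqrt_exponent[of p1 q2, folded \<rho>_def] and r' = csqrt_exponent[of p1' q2', folded \<rho>'_def]
  have "cos (complex_of_real pi * csqrt (1 + Delta2 p1 q2)) = cos (2 * of_real pi * \<rho>)"
    "cos (complex_of_real pi * csqrt (1 + Delta2 p1' q2')) = cos (2 * of_real pi * \<rho>')"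
    by (simp_all add: \<rho>_def \<rho>'_def)
  note c = this cos_eq_iff_multiplier[of \<rho> \<rho>']
  show "analytically_equivalent (nf_p p1) (nf_q q2) (nf_p p1') (nf_q q2') \<longleftrightarrow>
            p1 = p1' \<and>
            cos (complex_of_real pi * csqrt (1 + Delta2 p1 q2)) =
            cos (complex_of_real pi * csqrt (1 + Delta2 p1' q2'))"
    unfolding c using nf_equivalent_imp[OF _ r r'] nf_equivalentI[OF r, of \<rho>' q2'] r' by blast
qed

end
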